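(* Let $d\ge5$ and $0<\delta<1$. There exist integers $s>r\ge2$ and $J\ge0$, and constants $\zeta>0$, $c>0$ and $\Lambda_0\in\mathbb N$, depending only on $d$ and $\delta$, with the following property. For all sufficiently large $N$, every set $B\subseteq Q_N$ satisfying $|B|\ge\delta|Q_N|$ satisfies $$\frac1{|Q_N|}\sum_{\mathbf x\in\mathbb Z^d}\mathbf 1_B(\mathbf x)\sum_{j=0}^{J}A^{(r^j)}_{s^{2(J-j)}\lambda}\mathbf 1_B(\mathbf x)\ \ge\ \zeta$$ for every integer $\lambda$ satisfying $\Lambda_0\le\lambda\le cN^2$. Thus $D^2(B)\cap\{r^{2j}s^{2(J-j)}\lambda:0\le j\le J\}\ne\varnothing$ for every integer $\lambda$ in this range.
   Context: $Q_N=[-N,N]^d\cap\mathbb Z^d$; $S_\lambda=\{\mathbf v\in\mathbb Z^d:|\mathbf v|^2=\lambda\}$ (Euclidean norm); for $q\in\mathbb N$ and $f:\mathbb Z^d\to\mathbb R$, $A_\lambda^{(q)}f(\mathbf x)=\frac1{|S_\lambda|}\sum_{\mathbf v\in S_\lambda}f(\mathbf x+q\mathbf v)$; $\mathbf 1_B$ is the indicator function of $B$; $D^2(B)=\{|\mathbf x-\mathbf y|^2:\mathbf x,\mathbf y\in B\}$. *)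

theory Defs
  imports "HOL-Analysis.Analysis"
begin

text \<open>Points of the lattice \<open>\<int>\<^sup>d\<close> are vectors of type \<^typ>\<open>int ^ 'd\<close>, with \<open>d = CARD('d)\<close>.
  The library norm needs real components, so the squared Euclidean norm is
  introduced as an integer; \<open>of_int_sqnorm\<close> relates it to the library norm.\<close>

definition sqnorm :: "int ^ 'd \<Rightarrow> int" where
  "sqnorm v = (\<Sum>i\<in>UNIV. (v $ i)\<^sup>2)"

lemma of_int_sqnorm:
  "real_of_int (sqnorm v) = (norm (\<chi> i. real_of_int (v $ i)))\<^sup>2"
  by (simp add: sqnorm_def norm_vec_def L2_set_def sum_nonneg)

definition lattice_box :: "nat \<Rightarrow> (int ^ 'd) set" where
  "lattice_box N = {x. \<forall>i. x $ i \<in> {- int N..int N}}"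

definition lattice_sphere :: "int \<Rightarrow> (int ^ 'd) set" where
  "lattice_sphere l = {v. sqnorm v = l}"

lemma finite_lattice_box: "finite (lattice_box N :: (int ^ 'd) set)"
proof (rule finite_imageD)
  have "vec_nth ` (lattice_box N :: (int ^ 'd) set)
      \<subseteq> PiE UNIV (\<lambda>_. {- int N..int N})"
    by (auto simp: lattice_box_def)
  then show "finite (vec_nth ` (lattice_box N :: (int ^ 'd) set))"
    by (rule finite_subset) (auto intro: finite_PiE)
  show "inj_on vec_nth (lattice_box N :: (int ^ 'd) set)"
    by (auto simp: inj_on_def vec_eq_iff)
qed

lemma finite_lattice_sphere: "finite (lattice_sphere l :: (int ^ 'd) set)"
proof (rule finite_subset[OF _ finite_lattice_box[of "nat l"]], rule subsetI)
  fix v :: "int ^ 'd" assume v: "v \<in> lattice_sphere l"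
  have "\<bar>v $ i\<bar> \<le> l" for i
  proof -
    have "(v $ i)\<^sup>2 \<le> l"
      using v member_le_sum[of i UNIV "\<lambda>i. (v $ i)\<^sup>2"]
      by (simp add: lattice_sphere_def sqnorm_def)
    moreover have "\<bar>v $ i\<bar> \<le> (v $ i)\<^sup>2"
      using self_le_power[of "\<bar>v $ i\<bar>" 2] by (cases "v $ i = 0") auto
    ultimately show ?thesis by linarith
  qed
  then show "v \<in> lattice_box (nat l)"
    by (auto simp: lattice_box_def abs_le_iff) (smt (verit))+
qed

definition sphere_avg :: "nat \<Rightarrow> int \<Rightarrow> (int ^ 'd \<Rightarrow> real) \<Rightarrow> int ^ 'd \<Rightarrow> real" where
  "sphere_avg q l f x =
     1 / real (card (lattice_sphere l :: (int ^ 'd) set)) *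
       (\<Sum>v\<in>lattice_sphere l. f (x + int q *s v))"

definition sqdist_set :: "(int ^ 'd) set \<Rightarrow> int set" where
  "sqdist_set B = {sqnorm (x - y) | x y. x \<in> B \<and> y \<in> B}"

end

theory Submission
  imports Defs "HOL-Real_Asymp.Real_Asymp" "HOL-Number_Theory.Cong" "HOL-Computational_Algebra.Primes"
begin

text \<open>Expand the correlations of \<open>\<one>\<^sub>B\<close> in characters on the finite grid of frequencies \<open>k/L\<close>, \<open>L = 2(2N+1)\<close>. The
averaging operator with index \<open>j\<close> acts by the multiplier \<open>m\<^sub>j(\<xi>) = \<sigma>(r\<^sup>j \<xi>)\<close>, where \<open>\<sigma>\<close> is the normalised
exponential sum over the lattice sphere of squared radius \<open>s\<^bsup>2(J-j)\<^esup> l\<close>. The zero frequency alone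
contributes at least a constant times \<open>(J+1) \<delta>\<^sup>2 |Q\<^sub>N|\<close>, because there every \<open>m\<^sub>j\<close> equals 1. So it suffices that
\<open>m\<^sub>0 + ... + m\<^sub>J \<ge> - 1 - \<epsilon> (J+1)\<close> at every frequency: with \<open>\<epsilon>\<close> small against \<open>\<delta>\<^sup>2\<close> and \<open>J\<close> large, the zero
frequency wins.

This pointwise bound (\<open>sum_sphere_mult_ge\<close>) holds because at most one of the \<open>m\<^sub>j(\<xi>)\<close> is smaller than
\<open>- \<epsilon>\<close>. Suppose \<open>m\<^sub>j(\<xi>) < - \<epsilon>\<close>. A large exponential sum over a sphere is possible only close to a
rational point of bounded denominator (\<open>sphere_sum_large_imp_rational\<close>): there are \<open>r\<close> and \<open>C\<close>
depending on \<open>\<epsilon>\<close> and the dimension such that \<open>r \<cdot> r\<^sup>j \<xi>\<close> lies within \<open>C\<close> divided by the radius of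
\<open>\<int>\<^sup>d\<close>. For \<open>k > j\<close> the dilation \<open>r\<^sup>k\<close> has therefore cleared the denominator, and if \<open>s\<close> is large
compared with \<open>r\<close> and \<open>C\<close>, the remaining distance to the integers is tiny compared with the inverse of the
\<open>k\<close>-th radius. All phases are then at most a quarter turn and \<open>m\<^sub>k(\<xi>) \<ge> 0\<close>.

The rationality statement comes from the circle method, used with the finitely many points \<open>\<alpha> = k/P\<close>,
\<open>P = d l + 1\<close>, in place of an integral over the circle. Up to phases, a sphere sum is the average over these points of a
product of \<open>d\<close> one-dimensional quadratic sums. Weyl differencing bounds each of them, uniformly in the
linear phase, in terms of a rational approximation to \<open>2 \<alpha>\<close>; since \<open>d \<ge> 5\<close>, the points outside boundedly many
major ones contribute together less than \<open>\<epsilon> l\<^bsup>d/2-1\<^esup>\<close> (\<open>minor_arcs\<close>). At a major point a single quadratic sum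
is small unless its linear phase is nearly rational.

To turn this into a statement on normalised sums one needs at least \<open>c l\<^bsup>d/2-1\<^esup>\<close> lattice points on the
sphere (\<open>sphere_count_lower\<close>). The same estimate shows that two spheres have nearly the same
number of points if their squared radii are relatively close and differ by a multiple of a highly divisible
\<open>M\<close>. So it suffices to count on average, that is to count the points of a shell with \<open>|v|\<^sup>2 \<equiv> l\<close> modulo \<open>M\<close>.
The essential point is a lower bound for the number of solutions modulo \<open>M\<close> whose constant does
not depend on \<open>M\<close> (\<open>card_five_squares_mod_ge\<close>).\<close>

section \<open>Characters and the distance to the nearest integer\<close>

text \<open>The additive character usually written \<open>e(t)\<close>.\<close>

definition ee :: "real \<Rightarrow> complex" where
  "ee t = cis (2 * pi * t)"

lemma ee_add: "ee (x + y) = ee x * ee y"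
  by (simp add: ee_def cis_mult distrib_left)

lemma ee_diff: "ee (x - y) = ee x * ee (- y)"
  by (simp flip: ee_add)

lemma ee_0 [simp]: "ee 0 = 1"
  by (simp add: ee_def)

lemma ee_of_int [simp]: "ee (of_int n) = 1"
  by (simp add: ee_def cis_conv_exp exp_eq_1 algebra_simps) 

lemma norm_ee [simp]: "norm (ee x) = 1"
  by (simp add: ee_def)

lemma cnj_ee: "cnj (ee x) = ee (- x)"
  by (simp add: ee_def cis_cnj)

lemma ee_add_of_int [simp]: "ee (x + of_int n) = ee x"
  by (simp add: ee_add)

lemma ee_power: "ee x ^ n = ee (real n * x)"
  by (simp add: ee_def Complex.DeMoivre mult_ac)

lemma ee_sum: "finite A \<Longrightarrow> ee (\<Sum>i\<in>A. f i) = (\<Prod>i\<in>A. ee (f i))"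
  by (induction A rule: finite_induct) (auto simp: ee_add)

lemma norm_ee_minus_one: "norm (ee x - 1) = 2 * \<bar>sin (pi * x)\<bar>"
proof -
  have "(norm (ee x - 1))\<^sup>2 = (cos (2 * (pi * x)) - 1)\<^sup>2 + (sin (2 * (pi * x)))\<^sup>2"
    by (simp add: ee_def cmod_power2 mult_ac)
  also have "\<dots> = 2 - 2 * cos (2 * (pi * x))"
    using sin_cos_squared_add[of "2 * (pi * x)"] by (simp add: power2_eq_square algebra_simps)
  also have "\<dots> = (2 * \<bar>sin (pi * x)\<bar>)\<^sup>2"
    by (simp add: cos_double_sin power_mult_distrib)
  finally show ?thesis
    by (rule power2_eq_imp_eq) auto
qed

lemma norm_ee_minus_one_le: "norm (ee x - 1) \<le> 2 * pi * \<bar>x\<bar>"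
  using abs_sin_x_le_abs_x[of "pi * x"] by (simp add: norm_ee_minus_one abs_mult)

definition int_dist :: "real \<Rightarrow> real" where
  "int_dist t = \<bar>t - of_int (round t)\<bar>"

lemma int_dist_nonneg: "0 \<le> int_dist t"
  by (simp add: int_dist_def)

lemma int_dist_le_half: "int_dist t \<le> 1 / 2"
  using of_int_round_abs_le[of t] by (simp add: int_dist_def abs_minus_commute)

lemma int_dist_le: "int_dist t \<le> \<bar>t - of_int m\<bar>"
  unfolding int_dist_def by (rule round_diff_minimal)

lemma int_dist_triangle: "int_dist (x + y) \<le> int_dist x + \<bar>y\<bar>"
  using int_dist_le[of "x + y" "round x"] by (simp add: int_dist_def)

lemma int_dist_add_of_int: "int_dist (x + of_int m) = int_dist x"
proof (rule antisym)
  show "int_dist (x + of_int m) \<le> int_dist x"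
    using int_dist_le[of "x + of_int m" "round x + m"] by (simp add: int_dist_def)
  show "int_dist x \<le> int_dist (x + of_int m)"
    using int_dist_le[of x "round (x + of_int m) - m"] by (simp add: int_dist_def algebra_simps)
qed

lemma int_dist_mult_le: "int_dist (of_int m * x) \<le> \<bar>of_int m\<bar> * int_dist x"
  using int_dist_le[of "of_int m * x" "m * round x"]
  by (simp add: int_dist_def flip: abs_mult right_diff_distrib)

lemma int_dist_minus: "int_dist (- x) = int_dist x"
  using int_dist_mult_le[of "-1" x] int_dist_mult_le[of "-1" "- x"] by simp

lemma int_dist_eq_abs: "\<bar>x\<bar> \<le> 1 / 2 \<Longrightarrow> int_dist x = \<bar>x\<bar>"
proof (rule antisym)
  assume x: "\<bar>x\<bar> \<le> 1 / 2"
  show "int_dist x \<le> \<bar>x\<bar>" using int_dist_le[of x 0] by simp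
  have "\<bar>of_int (round x)\<bar> \<ge> (1::real) \<or> round x = 0" by linarith
  then show "\<bar>x\<bar> \<le> int_dist x" using x by (auto simp: int_dist_def) 
qed

text \<open>The sine is concave on \<open>[0, \<pi>/2]\<close>, so it lies above its chord.\<close>

lemma sin_pi_lower:
  assumes "\<bar>x\<bar> \<le> 1 / 2" shows "2 * \<bar>x\<bar> \<le> \<bar>sin (pi * x)\<bar>"
proof -
  have *: "2 * y \<le> sin (pi * y)" if y: "0 \<le> y" "y \<le> 1 / 2" for y :: real
  proof -
    have "concave_on {0..1 / 2} (\<lambda>y. sin (pi * y))"
    proof (rule f''_le0_imp_concave)
      show "((\<lambda>y. sin (pi * y)) has_real_derivative pi * cos (pi * y)) (at y)" for y
        by (auto intro!: derivative_eq_intros)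
      show "((\<lambda>y. pi * cos (pi * y)) has_real_derivative - (pi * (pi * sin (pi * y)))) (at y)" for y
        by (auto intro!: derivative_eq_intros)
      show "- (pi * (pi * sin (pi * y))) \<le> 0" if "y \<in> {0..1 / 2}" for y
      proof -
        have "pi * y \<le> pi" using that by (intro mult_left_le) auto
        then have "0 \<le> sin (pi * y)" using that by (intro sin_ge_zero) auto
        then show ?thesis by simp
      qed
    qed auto
    from concave_onD_Icc'[OF this, of y] y show ?thesis
      by (simp add: sin_pi_half)
  qed
  show ?thesis
  proof (cases "x \<ge> 0")
    case True
    then show ?thesis using *[of x] assms by simp
  next
    case False
    then show ?thesis using *[of "- x"] assms by simp
  qed
qed

lemma norm_ee_minus_one_ge: "4 * int_dist x \<le> norm (ee x - 1)"
proof -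
  define y where "y = x - of_int (round x)"
  have "ee x = ee y" using ee_add_of_int[of y "round x"] by (simp add: y_def)
  moreover have "\<bar>y\<bar> \<le> 1 / 2" using int_dist_le_half[of x] by (simp add: int_dist_def y_def)
  moreover have "int_dist x = \<bar>y\<bar>" by (simp add: int_dist_def y_def)
  ultimately show ?thesis using sin_pi_lower[of y] by (simp add: norm_ee_minus_one)
qed

lemma geometric_sum_ee:
  "norm (\<Sum>n\<in>{a..b::int}. ee (\<gamma> * of_int n)) * (2 * int_dist \<gamma>) \<le> 1"
proof (cases "a \<le> b")
  case True
  have "(ee \<gamma> - 1) * (\<Sum>n\<in>{a..a + int k}. ee (\<gamma> * of_int n))
      = ee (\<gamma> * of_int (a + int k + 1)) - ee (\<gamma> * of_int a)" for k
  proof (induction k)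
    case 0
    then show ?case by (simp add: ee_add algebra_simps)
  next
    case (Suc k)
    have "{a..a + int (Suc k)} = insert (a + int (Suc k)) {a..a + int k}" by auto
    moreover have "ee (\<gamma> * 2) = ee \<gamma> * ee \<gamma>"
      using ee_add[of \<gamma> \<gamma>] by (simp add: mult_2_right)
    ultimately show ?case using Suc by (simp add: ee_add algebra_simps)
  qed
  from this[of "nat (b - a)"] True
  have "norm ((ee \<gamma> - 1) * (\<Sum>n\<in>{a..b}. ee (\<gamma> * of_int n))) \<le> 2"
    using norm_triangle_ineq4[of "ee (\<gamma> * of_int (b + 1))" "ee (\<gamma> * of_int a)"] by simp
  then have "norm (ee \<gamma> - 1) * norm (\<Sum>n\<in>{a..b}. ee (\<gamma> * of_int n)) \<le> 2"
    by (simp add: norm_mult)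
  moreover have "4 * int_dist \<gamma> * norm (\<Sum>n\<in>{a..b}. ee (\<gamma> * of_int n))
      \<le> norm (ee \<gamma> - 1) * norm (\<Sum>n\<in>{a..b}. ee (\<gamma> * of_int n))"
    by (intro mult_right_mono norm_ee_minus_one_ge) auto
  ultimately show ?thesis by (simp add: mult_ac)
qed simp

text \<open>The discrete substitute for integration over the circle, both in the frequency of the circle method
and in each coordinate of the Fourier transform of a set.\<close>

lemma orthogonality_ee:
  assumes "P > 0"
  shows "(\<Sum>k<P. ee (real k * of_int m / real P)) = (if int P dvd m then of_nat P else 0)"
proof (cases "int P dvd m")
  case True
  then obtain t where m: "m = int P * t" by blast
  have "ee (real k * of_int m / real P) = 1" for k
    using ee_of_int[of "int k * t"] assms by (simp add: m)
  then show ?thesis using True by simp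
next
  case False
  define z where "z = ee (of_int m / real P)"
  have z: "ee (real k * of_int m / real P) = z ^ k" for k
    by (simp add: z_def ee_power)
  have "z \<noteq> 1"
  proof
    assume "z = 1"
    then have "int_dist (of_int m / real P) = 0"
      using norm_ee_minus_one_ge[of "of_int m / real P"] int_dist_nonneg[of "of_int m / real P"]
      by (simp add: z_def)
    then have "of_int m = real P * of_int (round (of_int m / real P))"
      using assms by (simp add: int_dist_def field_simps)
    then have "m = int P * round (of_int m / real P :: real)"
      by (metis of_int_eq_iff of_int_mult of_int_of_nat_eq)
    with False show False by (metis dvd_triv_left)
  qed
  moreover have "z ^ P = 1"
    using assms by (simp add: z_def ee_power)
  ultimately have "(\<Sum>k<P. z ^ k) = 0"
    by (simp add: geometric_sum)
  then show ?thesis using False by (simp add: z)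
qed

text \<open>A bound for a sum of \<open>e(t n)\<close> over at most \<open>X\<close> consecutive integers. The maximum combines the trivial
bound with the bound for geometric sums and gives the value \<open>X\<close>, and not \<open>1/0\<close>, at integral \<open>t\<close>.\<close>

definition weyl_kernel :: "real \<Rightarrow> real \<Rightarrow> real" where
  "weyl_kernel X t = 1 / max (1 / X) (2 * int_dist t)"

lemma weyl_kernel_le: "X > 0 \<Longrightarrow> weyl_kernel X t \<le> X"
proof -
  assume X: "X > 0"
  then have "1 / max (1 / X) (2 * int_dist t) \<le> 1 / (1 / X)"
    by (intro divide_left_mono mult_pos_pos) (auto simp: less_max_iff_disj)
  then show ?thesis by (simp add: weyl_kernel_def)
qed

lemma weyl_kernel_nonneg: "X > 0 \<Longrightarrow> 0 \<le> weyl_kernel X t"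
  by (simp add: weyl_kernel_def le_max_iff_disj)

lemma weyl_kernel_le_inverse: "X > 0 \<Longrightarrow> 0 < y \<Longrightarrow> y \<le> int_dist t \<Longrightarrow> weyl_kernel X t \<le> 1 / (2 * y)"
proof -
  assume X: "X > 0" "0 < y" "y \<le> int_dist t"
  then have "1 / max (1 / X) (2 * int_dist t) \<le> 1 / (2 * y)"
    by (intro divide_left_mono mult_pos_pos) (auto simp: less_max_iff_disj le_max_iff_disj)
  then show ?thesis by (simp add: weyl_kernel_def)
qed

lemma norm_geometric_sum_le_weyl_kernel:
  assumes "X > 0" and "real (card {a..b}) \<le> X"
  shows "norm (\<Sum>n\<in>{a..b::int}. ee (\<gamma> * of_int n)) \<le> weyl_kernel X \<gamma>" (is "?S \<le> _")
proof -
  have "?S \<le> (\<Sum>n\<in>{a..b}. 1)"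
    by (rule sum_norm_le) simp
  then have "?S \<le> X" using assms(2) by simp
  then have "?S * (1 / X) \<le> 1" using assms(1) by (simp add: field_simps)
  then have "?S * max (1 / X) (2 * int_dist \<gamma>) \<le> 1"
    using geometric_sum_ee[of \<gamma> a b] by (auto simp: max_def)
  moreover have "0 < max (1 / X) (2 * int_dist \<gamma>)" using assms(1) by (simp add: less_max_iff_disj)
  ultimately show ?thesis by (simp add: weyl_kernel_def field_simps)
qed

section \<open>Quadratic exponential sums and Weyl differencing\<close>

definition quad_sum :: "nat \<Rightarrow> real \<Rightarrow> real \<Rightarrow> complex" where
  "quad_sum N \<alpha> \<theta> = (\<Sum>n\<in>{- int N..int N}. ee (\<alpha> * (of_int n)\<^sup>2 + \<theta> * of_int n))"

lemma norm_quad_sum_le: "norm (quad_sum N \<alpha> \<theta>) \<le> 2 * real N + 1"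
proof -
  have "norm (quad_sum N \<alpha> \<theta>) \<le> (\<Sum>n\<in>{- int N..int N}. 1)"
    unfolding quad_sum_def by (rule sum_norm_le) simp
  then show ?thesis by simp
qed

text \<open>Squaring and substituting \<open>n = m + h\<close> leaves, for each \<open>h\<close>, a linear phase in \<open>m\<close>; the linear
coefficient \<open>\<theta>\<close> survives only in a factor of modulus 1. This is why the estimates on the minor
arcs are uniform in \<open>\<theta>\<close>.\<close>

lemma weyl_differencing:
  "(norm (quad_sum N \<alpha> \<theta>))\<^sup>2 \<le> (\<Sum>h\<in>{- 2 * int N..2 * int N}. weyl_kernel (2 * real N + 1) (2 * \<alpha> * of_int h))"
proof -
  define I where "I = {- int N..int N}"
  define H where "H = {- 2 * int N..2 * int N}"
  define M where "M h = {max (- int N) (- int N - h)..min (int N) (int N - h)}" for h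
  define p where "p n = \<alpha> * (of_int n)\<^sup>2 + \<theta> * of_int n" for n :: int
  have "complex_of_real ((norm (quad_sum N \<alpha> \<theta>))\<^sup>2) = quad_sum N \<alpha> \<theta> * cnj (quad_sum N \<alpha> \<theta>)"
    by (rule complex_norm_square)
  also have "\<dots> = (\<Sum>n\<in>I. \<Sum>m\<in>I. ee (p n - p m))"
    by (simp add: quad_sum_def I_def p_def sum_product cnj_ee ee_diff)
  also have "\<dots> = (\<Sum>(n, m)\<in>I \<times> I. ee (p n - p m))"
    by (simp add: sum.cartesian_product)
  also have "\<dots> = (\<Sum>(h, m)\<in>Sigma H M. ee (p (m + h) - p m))"
    by (rule sum.reindex_bij_witness[where i = "\<lambda>(h, m). (m + h, m)" and j = "\<lambda>(n, m). (n - m, m)"])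
       (auto simp: I_def H_def M_def)
  also have "\<dots> = (\<Sum>h\<in>H. \<Sum>m\<in>M h. ee (p (m + h) - p m))"
    by (rule sum.Sigma[symmetric]) (auto simp: H_def M_def)
  also have "\<dots> = (\<Sum>h\<in>H. ee (p h) * (\<Sum>m\<in>M h. ee (2 * \<alpha> * of_int h * of_int m)))"
    by (intro sum.cong refl, unfold sum_distrib_left, intro sum.cong refl)
       (simp add: p_def power2_eq_square algebra_simps flip: ee_add)
  finally have eq: "complex_of_real ((norm (quad_sum N \<alpha> \<theta>))\<^sup>2) = \<dots>" .
  have "(norm (quad_sum N \<alpha> \<theta>))\<^sup>2 = norm (complex_of_real ((norm (quad_sum N \<alpha> \<theta>))\<^sup>2))"
    unfolding norm_of_real by simp
  also have "\<dots> \<le> (\<Sum>h\<in>H. weyl_kernel (2 * real N + 1) (2 * \<alpha> * of_int h))"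
    unfolding eq
  proof (rule sum_norm_le)
    fix h assume "h \<in> H"
    have "real (card (M h)) \<le> 2 * real N + 1" by (auto simp: M_def)
    then show "norm (ee (p h) * (\<Sum>m\<in>M h. ee (2 * \<alpha> * of_int h * of_int m)))
        \<le> weyl_kernel (2 * real N + 1) (2 * \<alpha> * of_int h)"
      unfolding M_def norm_mult norm_ee mult_1_left by (intro norm_geometric_sum_le_weyl_kernel) auto
  qed
  finally show ?thesis by (simp add: H_def)
qed

lemma weyl_kernel_minus: "weyl_kernel X (- t) = weyl_kernel X t"
  by (simp add: weyl_kernel_def int_dist_minus)

lemma weyl_differencing_one_sided:
  "(norm (quad_sum N \<alpha> \<theta>))\<^sup>2 \<le> (2 * real N + 1)
     + 2 * (\<Sum>h\<in>{1..2 * N}. weyl_kernel (2 * real N + 1) (2 * \<alpha> * real h))"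
proof -
  define k where "k h = weyl_kernel (2 * real N + 1) (2 * \<alpha> * of_int h)" for h
  have *: "{- 2 * int N..2 * int N} = {0} \<union> ({1..2 * int N} \<union> {- 2 * int N..-1})" by auto
  have "(\<Sum>h\<in>{- 2 * int N..2 * int N}. k h) = k 0 + ((\<Sum>h\<in>{1..2 * int N}. k h) + (\<Sum>h\<in>{- 2 * int N..-1}. k h))"
    unfolding * by (subst sum.union_disjoint, auto)+
  also have "(\<Sum>h\<in>{- 2 * int N..-1}. k h) = (\<Sum>h\<in>{1..2 * int N}. k h)"
    by (rule sum.reindex_bij_witness[where i = uminus and j = uminus])
       (auto simp: k_def weyl_kernel_minus)
  also have "(\<Sum>h\<in>{1..2 * int N}. k h) = (\<Sum>h\<in>{1..2 * N}. weyl_kernel (2 * real N + 1) (2 * \<alpha> * real h))"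
    by (rule sum.reindex_bij_witness[where i = int and j = nat]) (auto simp: k_def)
  also have "k 0 \<le> 2 * real N + 1" unfolding k_def by (rule weyl_kernel_le) simp
  finally show ?thesis
    using weyl_differencing[of N \<alpha> \<theta>] by (simp add: k_def)
qed

lemma sum_inverse_sqrt_le: "(\<Sum>m\<in>{1..M}. 1 / sqrt (real m)) \<le> 2 * sqrt (real M)"
proof (induction M)
  case (Suc M)
  have "sqrt (real M) * sqrt (real (Suc M)) \<le> (real M + real (Suc M)) / 2"
    by (rule arith_geo_mean_sqrt[unfolded real_sqrt_mult]) auto
  then have "2 * sqrt (real M) * sqrt (real (Suc M)) + 1 \<le> 2 * real (Suc M)" by simp
  also have "\<dots> = 2 * sqrt (real (Suc M)) * sqrt (real (Suc M))"
    by (simp only: mult.assoc real_sqrt_mult_self abs_of_nat)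
  finally have "2 * sqrt (real M) + 1 / sqrt (real (Suc M)) \<le> 2 * sqrt (real (Suc M))"
    by (simp add: field_simps del: of_nat_Suc)
  then show ?case using Suc by simp
qed simp

lemma abs_diff_divide: "0 < q \<Longrightarrow> \<bar>x - y / q\<bar> = \<bar>q * x - y\<bar> / q" for q :: real
proof -
  assume q: "0 < q"
  then have "x - y / q = (q * x - y) / q" by (simp add: field_simps)
  then show ?thesis using q by simp
qed

lemma int_dist_rational_ge:
  fixes b :: int
  assumes "0 < q" "\<not> int q dvd b"
  shows "1 / real q \<le> int_dist (of_int b / real q)"
proof -
  define m where "m = round (of_int b / real q)"
  have "b - m * int q \<noteq> 0" using assms by auto
  then have "1 \<le> \<bar>b - m * int q\<bar>" by linarith
  then have "real_of_int 1 \<le> real_of_int \<bar>b - m * int q\<bar>" by (simp only: of_int_le_iff)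
  then have "1 \<le> \<bar>real q * of_int m - of_int b\<bar>" by (simp add: mult.commute abs_minus_commute)
  then show ?thesis
    using assms abs_diff_divide[of "real q" "of_int m" "of_int b"]
    by (simp add: int_dist_def m_def[symmetric] abs_minus_commute divide_right_mono)
qed

text \<open>The nearest integer lies either at distance at least \<open>c/q\<close> or at least \<open>(q - c)/q\<close>; adding both bounds
avoids a case distinction in the sum over \<open>c\<close>.\<close>

lemma inverse_int_dist_rational_le:
  assumes "0 < c" "c < q"
  shows "1 / int_dist (real c / real q) \<le> real q / real c + real q / real (q - c)"
proof -
  define m where "m = round (real c / real q)"
  have id: "int_dist (real c / real q) = \<bar>real c - of_int m * real q\<bar> / real q"
    unfolding int_dist_def m_def[symmetric]
    using assms abs_diff_divide[of "real q" "of_int m" "real c"]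
    by (simp only: abs_minus_commute[of "real c / real q"] abs_minus_commute[of "real c"] mult.commute[of "of_int m"] of_nat_0_less_iff)
  have "real c \<le> \<bar>real c - of_int m * real q\<bar> \<or> real (q - c) \<le> \<bar>real c - of_int m * real q\<bar>"
  proof (cases "m \<le> 0")
    case True
    then have "of_int m * real q \<le> 0" by (simp add: mult_le_0_iff)
    then show ?thesis by linarith
  next
    case False
    then have "1 * real q \<le> of_int m * real q" by (intro mult_right_mono) auto
    moreover have "real (q - c) = real q - real c" using assms by (simp add: of_nat_diff)
    ultimately show ?thesis by linarith
  qed
  moreover have "1 / (x / real q) \<le> real q / y" "1 \<le> x" if "y \<le> x" "y \<ge> 1" for x y
    using that assms by (auto simp: field_simps intro: mult_left_mono)
  ultimately have "(1 / int_dist (real c / real q) \<le> real q / real c \<or>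
    1 / int_dist (real c / real q) \<le> real q / real (q - c)) \<and> 1 \<le> \<bar>real c - of_int m * real q\<bar>"
    unfolding id using assms by (smt (verit) of_nat_1 of_nat_le_iff Suc_leI zero_less_diff One_nat_def)
  then consider "1 / int_dist (real c / real q) \<le> real q / real c" | "1 / int_dist (real c / real q) \<le> real q / real (q - c)"
    by blast
  moreover have "0 \<le> real q / real c" "0 \<le> real q / real (q - c)" by auto
  ultimately show ?thesis by cases (rule add_increasing2 add_increasing; assumption)+
qed

lemma harmonic_le:
  assumes "n > 0" shows "(\<Sum>c\<in>{1..n}. 1 / real c) \<le> 1 + ln (real n)"
proof -
  have "harm n - ln (real n) \<le> harm 1 - ln (real 1)"
    using assms by (intro euler_mascheroni_sequence_decreasing) auto
  moreover have "harm 1 = (1 :: real)" by (simp add: harm_def)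
  moreover have "harm n = (\<Sum>c\<in>{1..n}. 1 / real c)" by (simp add: harm_def inverse_eq_divide)
  ultimately show ?thesis by simp
qed

lemma sum_inverse_int_dist_residues_le:
  assumes "0 < q"
  shows "(\<Sum>c\<in>{1..<q}. 1 / int_dist (real c / real q)) \<le> 2 * real q * (1 + ln (real q))"
proof (cases "q = 1")
  case False
  have "(\<Sum>c\<in>{1..<q}. 1 / int_dist (real c / real q)) \<le> (\<Sum>c\<in>{1..<q}. real q / real c + real q / real (q - c))"
    by (intro sum_mono inverse_int_dist_rational_le) auto
  also have "\<dots> = (\<Sum>c\<in>{1..<q}. real q / real c) + (\<Sum>c\<in>{1..<q}. real q / real (q - c))"
    by (rule sum.distrib)
  also have "(\<Sum>c\<in>{1..<q}. real q / real (q - c)) = (\<Sum>c\<in>{1..<q}. real q / real c)"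
    by (rule sum.reindex_bij_witness[where i = "\<lambda>c. q - c" and j = "\<lambda>c. q - c"]) auto
  also have "(\<Sum>c\<in>{1..<q}. real q / real c) = real q * (\<Sum>c\<in>{1..<q}. 1 / real c)"
    by (simp add: sum_distrib_left)
  also have "real q * (\<Sum>c\<in>{1..<q}. 1 / real c) + real q * (\<Sum>c\<in>{1..<q}. 1 / real c) \<le> 2 * real q * (1 + ln (real q))"
  proof -
    have "(\<Sum>c\<in>{1..<q}. 1 / real c) \<le> (\<Sum>c\<in>{1..q}. 1 / real c)"
      by (intro sum_mono2) auto
    also have "\<dots> \<le> 1 + ln (real q)" using assms by (rule harmonic_le)
    finally have "real q * (\<Sum>c\<in>{1..<q}. 1 / real c) \<le> real q * (1 + ln (real q))"
      by (rule mult_left_mono) simp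
    then show ?thesis by linarith
  qed
  finally show ?thesis .
qed simp

text \<open>Since \<open>a\<close> is invertible modulo \<open>q\<close>, the residue of \<open>h a\<close> determines that of \<open>h\<close>.\<close>

lemma card_residue_multiples_le:
  fixes a :: int
  assumes "0 < q" "coprime a (int q)"
  shows "card {h\<in>{1..n}. (int h * a) mod int q = int c} \<le> n div q + 1"
proof -
  have "inj_on (\<lambda>h. h div q) {h\<in>{1..n}. (int h * a) mod int q = int c}"
  proof (rule inj_onI, clarsimp)
    fix x y assume *: "(int x * a) mod int q = int c" "(int y * a) mod int q = int c" "x div q = y div q"
    then have "[int x * a = int y * a] (mod int q)" by (simp add: cong_def)
    then have "[int x = int y] (mod int q)"
      using assms by (simp add: cong_mult_rcancel)
    then have "x mod q = y mod q" unfolding cong_int_iff by (simp add: cong_def)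
    with * show "x = y" by (metis div_mult_mod_eq)
  qed
  then have "card {h\<in>{1..n}. (int h * a) mod int q = int c} \<le> card {0..n div q}"
    by (rule card_inj_on_le) (auto intro: div_le_mono)
  then show ?thesis by simp
qed

lemma sum_inverse_int_dist_rational_le:
  fixes a :: int
  assumes "0 < q" "coprime a (int q)"
  shows "(\<Sum>h | h \<in> {1..n} \<and> \<not> q dvd h. 1 / int_dist (real h * of_int a / real q))
     \<le> 2 * (real n + real q) * (1 + ln (real q))"
proof -
  define H where "H = {h\<in>{1..n}. \<not> q dvd h}"
  define R where "R h = nat ((int h * a) mod int q)" for h
  have R: "int (R h) = (int h * a) mod int q" for h using assms by (simp add: R_def)
  have R_range: "R ` H \<subseteq> {1..<q}"
  proof
    fix c assume "c \<in> R ` H"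
    then obtain h where h: "c = R h" "\<not> q dvd h" by (auto simp: H_def)
    have "\<not> int q dvd int h * a"
      using h assms by (simp add: coprime_dvd_mult_left_iff coprime_commute)
    then have "(int h * a) mod int q \<noteq> 0" by (simp add: dvd_eq_mod_eq_0)
    then have "R h \<noteq> 0" using R[of h] by simp
    moreover have "R h < q" using R[of h] assms by (metis of_nat_less_iff of_nat_0_less_iff pos_mod_bound)
    ultimately show "c \<in> {1..<q}" using h by simp
  qed
  have idR: "int_dist (real h * of_int a / real q) = int_dist (real (R h) / real q)" for h
  proof -
    have "int h * a = int (R h) + int q * (int h * a div int q)" by (simp add: R)
    then have "real h * of_int a = real (R h) + real q * of_int (int h * a div int q)"
      by (metis of_int_add of_int_mult of_int_of_nat_eq)
    then have "real h * of_int a / real q = real (R h) / real q + of_int (int h * a div int q)"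
      using assms by (simp add: field_simps)
    then show ?thesis by (simp add: int_dist_add_of_int)
  qed
  have "(\<Sum>h\<in>H. 1 / int_dist (real h * of_int a / real q))
      = (\<Sum>c\<in>{1..<q}. \<Sum>h\<in>{h\<in>H. R h = c}. 1 / int_dist (real c / real q))"
    unfolding idR using R_range by (subst sum.group[symmetric, where g = R and T = "{1..<q}"]) (auto simp: H_def)
  also have "\<dots> \<le> (\<Sum>c\<in>{1..<q}. (real n / real q + 1) * (1 / int_dist (real c / real q)))"
  proof (rule sum_mono)
    fix c assume "c \<in> {1..<q}"
    have "card {h\<in>H. R h = c} \<le> card {h\<in>{1..n}. (int h * a) mod int q = int c}"
      by (intro card_mono) (auto simp: H_def R[symmetric])
    also have "\<dots> \<le> n div q + 1" by (rule card_residue_multiples_le[OF assms])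
    finally have "real (card {h\<in>H. R h = c}) \<le> real (n div q) + 1" by simp
    also have "real (n div q) \<le> real n / real q" 
      using assms div_times_less_eq_dividend[of n q] by (simp add: field_simps flip: of_nat_mult)
    finally show "(\<Sum>h\<in>{h\<in>H. R h = c}. 1 / int_dist (real c / real q))
        \<le> (real n / real q + 1) * (1 / int_dist (real c / real q))"
      by (simp add: divide_right_mono int_dist_nonneg)
  qed
  also have "\<dots> = (real n / real q + 1) * (\<Sum>c\<in>{1..<q}. 1 / int_dist (real c / real q))"
    by (simp add: sum_distrib_left)
  also have "\<dots> \<le> (real n / real q + 1) * (2 * real q * (1 + ln (real q)))"
    by (intro mult_left_mono sum_inverse_int_dist_residues_le assms) auto
  also have "\<dots> = 2 * (real n + real q) * (1 + ln (real q))"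
    using assms by (simp add: field_simps)
  finally show ?thesis by (simp add: H_def)
qed

text \<open>The loss in the trivial bound \<open>|quad_sum|\<^sup>2 \<le> X\<^sup>2\<close> at a point with approximation \<open>a/q + \<beta>\<close>, namely
\<open>min 1 ((X\<^sup>2 |\<beta>|)\<^bsup>-1/2\<^esup>) / q\<close>, in a form that is also correct for \<open>\<beta> = 0\<close>. Weyl differencing would
give the exponent \<open>-1\<close> up to a logarithm; the weaker exponent is free of logarithms and
suffices.\<close>

definition arc_weight :: "real \<Rightarrow> nat \<Rightarrow> real \<Rightarrow> real" where
  "arc_weight X q \<beta> = 1 / (real q * max 1 (X * sqrt \<bar>\<beta>\<bar>))"

text \<open>For \<open>h\<close> not divisible by \<open>q\<close>, the point \<open>\<gamma> h\<close> is at least half as far from the integers as \<open>h a/q\<close>,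
and the sum over such \<open>h\<close> is harmonic. The multiples \<open>h = m q\<close> are the resonant terms: there the distance
is exactly \<open>m |q \<gamma> - a|\<close>, and interpolating \<open>min x y \<le> sqrt (x y)\<close> between the two bounds for the kernel
gives the decay in \<open>\<beta>\<close>.\<close>

lemma sum_weyl_kernel_arc_le:
  fixes a :: int and n :: nat
  defines "X \<equiv> real n + 1"
  assumes q: "0 < q" "real q \<le> 2 * X" "coprime a (int q)"
    and \<gamma>: "\<bar>real q * \<gamma> - of_int a\<bar> \<le> 1 / (2 * X)"
  shows "(\<Sum>h\<in>{1..n}. weyl_kernel X (\<gamma> * real h))
     \<le> 6 * X * (1 + ln (2 * X)) + 3 / 2 * X\<^sup>2 * arc_weight X q (\<gamma> - of_int a / real q)"
proof -
  define \<delta> where "\<delta> = \<bar>real q * \<gamma> - of_int a\<bar>"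
  define \<beta> where "\<beta> = \<gamma> - of_int a / real q"
  have X: "X \<ge> 1" by (simp add: X_def)
  have \<beta>\<delta>: "\<bar>\<beta>\<bar> = \<delta> / real q" 
    unfolding \<beta>_def \<delta>_def by (rule abs_diff_divide) (use q in simp)
  have nX: "real n \<le> X" by (simp add: X_def)
  have split: "(\<Sum>h\<in>{1..n}. weyl_kernel X (\<gamma> * real h)) =
      (\<Sum>h | h \<in> {1..n} \<and> \<not> q dvd h. weyl_kernel X (\<gamma> * real h)) + (\<Sum>h | h \<in> {1..n} \<and> q dvd h. weyl_kernel X (\<gamma> * real h))"
    by (subst sum.union_disjoint[symmetric]) (auto intro!: sum.cong)
  have "(\<Sum>h | h \<in> {1..n} \<and> \<not> q dvd h. weyl_kernel X (\<gamma> * real h))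
      \<le> (\<Sum>h | h \<in> {1..n} \<and> \<not> q dvd h. 1 / int_dist (real h * of_int a / real q))"
  proof (rule sum_mono)
    fix h assume "h \<in> {h. h \<in> {1..n} \<and> \<not> q dvd h}"
    then have h: "1 \<le> h" "h \<le> n" "\<not> q dvd h" by auto
    define u where "u = int_dist (real h * of_int a / real q)"
    have "\<not> int q dvd int h * a"
      using h q by (simp add: coprime_dvd_mult_left_iff coprime_commute)
    then have u1: "1 / real q \<le> u"
      using int_dist_rational_ge[of q "int h * a"] q by (simp add: u_def)
    have "u \<le> int_dist (\<gamma> * real h) + \<bar>- (real h * \<beta>)\<bar>"
      using int_dist_triangle[of "\<gamma> * real h" "- (real h * \<beta>)"] by (simp add: u_def \<beta>_def algebra_simps)
    moreover have "\<bar>- (real h * \<beta>)\<bar> \<le> 1 / (2 * real q)"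
    proof -
      have "real h * \<delta> \<le> X * (1 / (2 * X))"
        using h \<gamma> X by (intro mult_mono) (auto simp: \<delta>_def X_def)
      then have "real h * \<delta> \<le> 1 / 2" using X by simp
      then show ?thesis using q by (simp add: abs_mult \<beta>\<delta> field_simps)
    qed
    ultimately have "u / 2 \<le> int_dist (\<gamma> * real h)" using u1 by simp
    moreover have "0 < u / 2" using u1 q by (smt (verit) divide_pos_pos of_nat_0_less_iff half_gt_zero)
    ultimately have "weyl_kernel X (\<gamma> * real h) \<le> 1 / (2 * (u / 2))"
      using X by (intro weyl_kernel_le_inverse) auto
    then show "weyl_kernel X (\<gamma> * real h) \<le> 1 / int_dist (real h * of_int a / real q)" by (simp add: u_def)
  qed
  also have "\<dots> \<le> 2 * (real n + real q) * (1 + ln (real q))"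
    by (rule sum_inverse_int_dist_rational_le[OF q(1,3)])
  also have "\<dots> \<le> 2 * (X + 2 * X) * (1 + ln (2 * X))"
    using q X nX by (intro mult_mono add_mono) (auto simp: X_def)
  finally have A: "(\<Sum>h | h \<in> {1..n} \<and> \<not> q dvd h. weyl_kernel X (\<gamma> * real h)) \<le> 6 * X * (1 + ln (2 * X))" by simp

  define M where "M = n div q"
  have Mq: "real M * real q \<le> X" 
    using nX by (metis M_def div_times_less_eq_dividend of_nat_le_iff of_nat_mult order_trans)
  have MX: "real M \<le> X / real q" using Mq q by (simp add: field_simps)
  have B_eq: "(\<Sum>h | h \<in> {1..n} \<and> q dvd h. weyl_kernel X (\<gamma> * real h)) = (\<Sum>m\<in>{1..M}. weyl_kernel X (\<gamma> * real (m * q)))"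
    using q by (intro sum.reindex_bij_witness[where i = "\<lambda>m. m * q" and j = "\<lambda>h. h div q"])
      (auto simp: M_def div_le_mono less_eq_div_iff_mult_less_eq)
  have id_mult: "int_dist (\<gamma> * real (m * q)) = real m * \<delta>" if "m \<in> {1..M}" for m
  proof -
    have "real m \<le> X" 
    proof -
      have "real m * 1 \<le> real M * real q" using that q by (intro mult_mono) auto
      then show ?thesis using Mq by simp
    qed
    then have "real m * \<delta> \<le> X * (1 / (2 * X))"
      using \<gamma> X by (intro mult_mono) (auto simp: \<delta>_def)
    then have "\<bar>real m * (real q * \<gamma> - of_int a)\<bar> \<le> 1 / 2" using X by (simp add: abs_mult \<delta>_def)
    from int_dist_eq_abs[OF this] have "int_dist (real m * (real q * \<gamma> - of_int a)) = real m * \<delta>"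
      by (simp add: abs_mult \<delta>_def)
    moreover have "\<gamma> * real (m * q) = real m * (real q * \<gamma> - of_int a) + of_int (int m * a)"
      by (simp add: algebra_simps)
    ultimately show ?thesis by (simp only: int_dist_add_of_int)
  qed
  have B1: "(\<Sum>m\<in>{1..M}. weyl_kernel X (\<gamma> * real (m * q))) \<le> X\<^sup>2 / real q"
  proof -
    have "(\<Sum>m\<in>{1..M}. weyl_kernel X (\<gamma> * real (m * q))) \<le> (\<Sum>m\<in>{1..M}. X)"
      using X by (intro sum_mono weyl_kernel_le) auto
    also have "\<dots> \<le> X / real q * X" using mult_right_mono[OF MX, of X] X by simp
    finally show ?thesis by (simp add: power2_eq_square)
  qed
  have B2: "(\<Sum>m\<in>{1..M}. weyl_kernel X (\<gamma> * real (m * q))) \<le> 3 / 2 * X\<^sup>2 / (real q * (X * sqrt \<bar>\<beta>\<bar>))" if "\<beta> \<noteq> 0"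
  proof -
    have \<delta>: "\<delta> > 0" using that \<beta>\<delta> q by (smt (verit) divide_eq_0_iff \<delta>_def)
    have "(\<Sum>m\<in>{1..M}. weyl_kernel X (\<gamma> * real (m * q))) \<le> (\<Sum>m\<in>{1..M}. sqrt (X / (2 * \<delta>)) * (1 / sqrt (real m)))"
    proof (rule sum_mono)
      fix m assume m: "m \<in> {1..M}"
      let ?k = "weyl_kernel X (\<gamma> * real (m * q))"
      have "?k \<le> 1 / (2 * (real m * \<delta>))"
        using m \<delta> X id_mult[OF m] by (intro weyl_kernel_le_inverse) auto
      moreover have "?k \<le> X" using X by (intro weyl_kernel_le) auto
      moreover have "0 \<le> ?k" using X by (intro weyl_kernel_nonneg) auto
      ultimately have "?k * ?k \<le> X * (1 / (2 * (real m * \<delta>)))" using X by (intro mult_mono) auto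
      then have "?k \<le> sqrt (X * (1 / (2 * (real m * \<delta>))))"
        by (intro real_le_rsqrt) (simp add: power2_eq_square)
      then show "?k \<le> sqrt (X / (2 * \<delta>)) * (1 / sqrt (real m))"
        by (simp add: real_sqrt_mult real_sqrt_divide mult_ac)
    qed
    also have "\<dots> = sqrt (X / (2 * \<delta>)) * (\<Sum>m\<in>{1..M}. 1 / sqrt (real m))"
      by (simp add: sum_distrib_left)
    also have "\<dots> \<le> sqrt (X / (2 * \<delta>)) * (2 * sqrt (X / real q))"
      using X \<delta> by (intro mult_left_mono order.trans[OF sum_inverse_sqrt_le]) (auto simp: MX)
    also have "\<dots> = sqrt 2 * (X / (sqrt \<delta> * sqrt (real q)))"
      using X \<delta> q by (simp add: real_sqrt_divide real_sqrt_mult field_simps)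
    also have "\<dots> = sqrt 2 * (X\<^sup>2 / (real q * (X * sqrt \<bar>\<beta>\<bar>)))"
      unfolding \<beta>\<delta> using X \<delta> q by (simp add: real_sqrt_divide power2_eq_square field_simps)
    also have "\<dots> \<le> 3 / 2 * (X\<^sup>2 / (real q * (X * sqrt \<bar>\<beta>\<bar>)))"
      using X by (intro mult_right_mono real_le_lsqrt) (auto simp: power2_eq_square)
    finally show ?thesis by simp
  qed
  have "(\<Sum>m\<in>{1..M}. weyl_kernel X (\<gamma> * real (m * q))) \<le> 3 / 2 * X\<^sup>2 * arc_weight X q \<beta>"
  proof (cases "X * sqrt \<bar>\<beta>\<bar> \<le> 1")
    case True
    have "0 \<le> X\<^sup>2 / real q" by simp
    then have "X\<^sup>2 / real q \<le> 3 / 2 * (X\<^sup>2 / real q)" by linarith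
    then show ?thesis using B1 True by (simp add: arc_weight_def max_def)
  next
    case False
    then show ?thesis using B2 by (cases "\<beta> = 0") (simp_all add: arc_weight_def max_def)
  qed
  then show ?thesis unfolding split B_eq using A by (simp add: \<beta>_def)
qed

text \<open>Dirichlet approximation of \<open>2 \<alpha>\<close>, which is the frequency that appears after differencing, supplies the
fraction. The second term is the one that matters when \<open>q\<close> and \<open>X\<^sup>2 |\<beta>|\<close> are bounded.\<close>

lemma weyl_bound_arc:
  fixes \<alpha> :: real and N :: nat
  defines "X \<equiv> 2 * real N + 1"
  shows "\<exists>q a. 0 < q \<and> real q \<le> 2 * X \<and> \<bar>real q * (2 * \<alpha>) - of_int a\<bar> \<le> 1 / (2 * X) \<and>
    (\<forall>\<theta>. (norm (quad_sum N \<alpha> \<theta>))\<^sup>2 \<le> 13 * X * (1 + ln (2 * X))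
        + 3 * X\<^sup>2 * arc_weight X q (2 * \<alpha> - of_int a / real q))"
proof -
  have "0 < 2 * (2 * N + 1)" by simp
  then obtain a k where k: "coprime a k" "0 < k" "k \<le> int (2 * (2 * N + 1))"
    "\<bar>of_int k * (2 * \<alpha>) - of_int a\<bar> < 1 / real (2 * (2 * N + 1))"
    by (rule Dirichlet_approx_coprime)
  define q where "q = nat k"
  have q: "k = int q" "0 < q" using k by (auto simp: q_def)
  have qX: "real q \<le> 2 * X" using k(3) q by (simp add: X_def)
  have qa: "\<bar>real q * (2 * \<alpha>) - of_int a\<bar> \<le> 1 / (2 * X)" using k(4) q by (simp add: X_def add.commute)
  have "(\<Sum>h\<in>{1..2 * N}. weyl_kernel X (2 * \<alpha> * real h))
      \<le> 6 * X * (1 + ln (2 * X)) + 3 / 2 * X\<^sup>2 * arc_weight X q (2 * \<alpha> - of_int a / real q)"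
    using sum_weyl_kernel_arc_le[of q "2 * N" a "2 * \<alpha>"] q qX qa k(1) by (simp add: X_def)
  moreover have "X \<le> X * (1 + ln (2 * X))" by (simp add: X_def)
  ultimately have "(norm (quad_sum N \<alpha> \<theta>))\<^sup>2 \<le> 13 * X * (1 + ln (2 * X))
        + 3 * X\<^sup>2 * arc_weight X q (2 * \<alpha> - of_int a / real q)" for \<theta>
    using weyl_differencing_one_sided[of N \<alpha> \<theta>] by (simp add: X_def[symmetric])
  with q qX qa show ?thesis by blast
qed

section \<open>Minor arcs\<close>

lemma summable_shifted_decay:
  "summable (\<lambda>j::nat. (max 1 (real j / real d)) powr (- (9 / 8)))" if "d > 0"
proof (rule summable_comparison_test')
  show "summable (\<lambda>j. real d powr (9 / 8) * real j powr (- (9 / 8)))"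
    by (intro summable_mult) (simp add: summable_real_powr_iff)
  fix j :: nat assume j: "j \<ge> 1"
  have "(max 1 (real j / real d)) powr (- (9 / 8)) \<le> (real j / real d) powr (- (9 / 8))"
    using that j by (intro powr_mono2') auto
  also have "\<dots> = real d powr (9 / 8) * real j powr (- (9 / 8))"
    using that j by (simp add: powr_divide powr_minus field_simps)
  finally show "norm ((max 1 (real j / real d)) powr (- (9 / 8))) \<le> \<dots>" by simp
qed

text \<open>At most two of the integers \<open>k\<close> have \<open>|k - y|\<close> in a given unit interval, so the sum is at most twice a
convergent series, wherever \<open>y\<close> lies.\<close>

lemma sum_decay_around_point_le:
  assumes "d > 0"
  shows "\<exists>K\<ge>0. \<forall>y P. (\<Sum>k<P. (max 1 (\<bar>real k - y\<bar> / real d)) powr (- (9 / 8))) \<le> K"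
proof -
  define \<psi> where "\<psi> j = (max 1 (real j / real d)) powr (- (9 / 8))" for j :: nat
  have sm: "summable \<psi>" unfolding \<psi>_def by (rule summable_shifted_decay[OF assms])
  have \<psi>0: "\<psi> j \<ge> 0" for j by (simp add: \<psi>_def)
  have "(\<Sum>k<P. (max 1 (\<bar>real k - y\<bar> / real d)) powr (- (9 / 8))) \<le> 2 * suminf \<psi>" for y P
  proof -
    define j where "j k = nat \<lfloor>\<bar>real k - y\<bar>\<rfloor>" for k
    have "(\<Sum>k<P. (max 1 (\<bar>real k - y\<bar> / real d)) powr (- (9 / 8))) \<le> (\<Sum>k<P. \<psi> (j k))"
      unfolding \<psi>_def
      by (intro sum_mono powr_mono2' max.mono divide_right_mono) (auto simp: j_def)
    also have "\<dots> = (\<Sum>i\<in>j ` {..<P}. \<Sum>k\<in>{k\<in>{..<P}. j k = i}. \<psi> (j k))"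
      by (rule sum.image_gen) simp
    also have "\<dots> \<le> (\<Sum>i\<in>j ` {..<P}. 2 * \<psi> i)"
    proof (rule sum_mono)
      fix i
      have "{k\<in>{..<P}. j k = i} \<subseteq> {nat (int i + \<lceil>y\<rceil>), nat (\<lfloor>y\<rfloor> - int i)}"
      proof
        fix k assume "k \<in> {k\<in>{..<P}. j k = i}"
        then have k: "\<lfloor>\<bar>real k - y\<bar>\<rfloor> = int i" by (auto simp: j_def)
        show "k \<in> {nat (int i + \<lceil>y\<rceil>), nat (\<lfloor>y\<rfloor> - int i)}"
        proof (cases "y \<le> real k")
          case True
          then have "int k = int i + \<lceil>y\<rceil>" using k by simp linarith
          then show ?thesis by (metis insertCI nat_int)
        next
          case False
          then have "int k = \<lfloor>y\<rfloor> - int i" using k by simp linarith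
          then show ?thesis by (metis insertCI nat_int)
        qed
      qed
      then have "card {k\<in>{..<P}. j k = i} \<le> card {nat (int i + \<lceil>y\<rceil>), nat (\<lfloor>y\<rfloor> - int i)}"
        by (intro card_mono) auto
      also have "\<dots> \<le> 2" by (simp add: card_insert_if)
      finally have "real (card {k\<in>{..<P}. j k = i}) * \<psi> i \<le> 2 * \<psi> i"
        using \<psi>0 by (intro mult_right_mono) auto
      then show "(\<Sum>k\<in>{k\<in>{..<P}. j k = i}. \<psi> (j k)) \<le> 2 * \<psi> i" by simp
    qed
    also have "\<dots> = 2 * (\<Sum>i\<in>j ` {..<P}. \<psi> i)" by (simp add: sum_distrib_left)
    also have "\<dots> \<le> 2 * suminf \<psi>"
      using sm \<psi>0 by (intro mult_left_mono sum_le_suminf) auto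
    finally show ?thesis .
  qed
  moreover have "0 \<le> 2 * suminf \<psi>" using suminf_nonneg[OF sm \<psi>0] by simp
  ultimately show ?thesis by blast
qed

text \<open>The points \<open>2 k/P\<close> have spacing at least \<open>2/(d X\<^sup>2)\<close>. In units of \<open>X\<^bsup>-2\<^esup>\<close> the distance to \<open>a/q\<close> is,
up to a factor \<open>d\<close>, at least the distance from the integer \<open>k\<close> to a fixed real number.\<close>

lemma arc_weight_powr_le:
  assumes d: "d > 0" and q: "q > 0" and X: "X > 0" and P: "P > 0" and XP: "real P \<le> real d * X\<^sup>2"
  shows "arc_weight X q (2 * (real k / real P) - of_int a / real q) powr (9 / 4)
    \<le> real q powr (- (9 / 4)) * (max 1 (\<bar>real k - of_int a * real P / (2 * real q)\<bar> / real d)) powr (- (9 / 8))"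
proof -
  define \<beta> where "\<beta> = 2 * (real k / real P) - of_int a / real q"
  define u where "u = \<bar>real k - of_int a * real P / (2 * real q)\<bar>"
  have \<beta>: "\<bar>\<beta>\<bar> = 2 / real P * u"
  proof -
    have "\<beta> = 2 / real P * (real k - of_int a * real P / (2 * real q))"
      using P q by (simp add: \<beta>_def field_simps)
    then have "\<bar>\<beta>\<bar> = \<bar>2 / real P\<bar> * u" by (simp only: u_def abs_mult)
    then show ?thesis using P by simp
  qed
  have "u / real d \<le> X\<^sup>2 * \<bar>\<beta>\<bar>"
  proof -
    have "u * real P \<le> u * (real d * X\<^sup>2)" using XP by (intro mult_left_mono) (auto simp: u_def)
    also have "\<dots> \<le> 2 * (u * (real d * X\<^sup>2))" by (simp add: u_def)
    finally show ?thesis using P d by (simp add: \<beta> field_simps)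
  qed
  then have le: "max 1 (u / real d) \<le> max 1 (X\<^sup>2 * \<bar>\<beta>\<bar>)" by simp
  have "max 1 (X * sqrt \<bar>\<beta>\<bar>) = max (sqrt 1) (sqrt (X\<^sup>2 * \<bar>\<beta>\<bar>))"
    using X by (simp add: real_sqrt_mult)
  also have "\<dots> = sqrt (max 1 (X\<^sup>2 * \<bar>\<beta>\<bar>))"
    by (simp add: max_def)
  also have "\<dots> = (max 1 (X\<^sup>2 * \<bar>\<beta>\<bar>)) powr (1 / 2)"
    by (simp add: powr_half_sqrt)
  finally have m: "max 1 (X * sqrt \<bar>\<beta>\<bar>) = (max 1 (X\<^sup>2 * \<bar>\<beta>\<bar>)) powr (1 / 2)" .
  have "arc_weight X q \<beta> powr (9 / 4) = real q powr (- (9 / 4)) * ((max 1 (X\<^sup>2 * \<bar>\<beta>\<bar>)) powr (1 / 2)) powr (- (9 / 4))"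
    unfolding arc_weight_def m using q by (simp add: powr_divide powr_mult powr_minus divide_simps)
  also have "((max 1 (X\<^sup>2 * \<bar>\<beta>\<bar>)) powr (1 / 2)) powr (- (9 / 4)) = (max 1 (X\<^sup>2 * \<bar>\<beta>\<bar>)) powr (- (9 / 8))"
    by (simp add: powr_powr)
  also have "\<dots> \<le> (max 1 (u / real d)) powr (- (9 / 8))"
    using le by (intro powr_mono2') auto
  finally show ?thesis by (simp add: u_def \<beta>_def mult_left_mono)
qed

text \<open>For each \<open>q\<close> there are at most \<open>2 q + 1\<close> fractions in \<open>[0, 2]\<close>, and the sum over the points
near each of them is bounded. What remains is the sum of \<open>q \<cdot> q\<^bsup>-9/4\<^esup>\<close>. The exponent \<open>9/4\<close> lies strictly
between 2, at which both sums diverge, and \<open>5/2\<close>, which five variables provide; the difference between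
\<open>5/2\<close> and \<open>9/4\<close> yields the smallness on the minor arcs.\<close>

lemma sum_arc_weight_le:
  assumes "d > 0"
  shows "\<exists>K\<ge>0. \<forall>X P q a. X \<ge> 1 \<longrightarrow> P > 0 \<longrightarrow> real P \<le> real d * X\<^sup>2 \<longrightarrow>
    (\<forall>k<P. 0 < q k \<and> \<bar>real (q k) * (2 * (real k / real P)) - of_int (a k)\<bar> \<le> 1 / (2 * X)) \<longrightarrow>
    (\<Sum>k<P. arc_weight X (q k) (2 * (real k / real P) - of_int (a k) / real (q k)) powr (9 / 4)) \<le> K"
proof -
  obtain K1 where K1: "K1 \<ge> 0"
    "\<And>y P. (\<Sum>k<P. (max 1 (\<bar>real k - y\<bar> / real d)) powr (- (9 / 8))) \<le> K1"
    using sum_decay_around_point_le[OF assms] by blast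
  have sm: "summable (\<lambda>q. real q powr (- (5 / 4)))" by (simp add: summable_real_powr_iff)
  define K where "K = 3 * K1 * (\<Sum>q. real q powr (- (5 / 4)))"
  have "(\<Sum>k<P. arc_weight X (q k) (2 * (real k / real P) - of_int (a k) / real (q k)) powr (9 / 4)) \<le> K"
    if X: "X \<ge> 1" and P: "P > 0" and XP: "real P \<le> real d * X\<^sup>2" and
      qa: "\<And>k. k < P \<Longrightarrow> 0 < q k \<and> \<bar>real (q k) * (2 * (real k / real P)) - of_int (a k)\<bar> \<le> 1 / (2 * X)"
    for X P q a
  proof -
    define w where "w k r b = arc_weight X r (2 * (real k / real P) - of_int b / real r) powr (9 / 4)" for k r b
    define T where "T = (SIGMA r:q ` {..<P}. {0..2 * int r})"
    have fin: "finite T" by (auto simp: T_def)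
    have rng: "(\<lambda>k. (q k, a k)) ` {..<P} \<subseteq> T"
    proof clarsimp
      fix k assume k: "k < P"
      have "\<bar>real (q k) * (2 * (real k / real P)) - of_int (a k)\<bar> \<le> 1 / (2 * X)" using qa[OF k] by simp
      also have "\<dots> \<le> 1 / 2" using X by (simp add: field_simps)
      finally have 1: "\<bar>real (q k) * (2 * (real k / real P)) - of_int (a k)\<bar> \<le> 1 / 2" .
      moreover have "real (q k) * (2 * (real k / real P)) \<le> real (q k) * (2 * 1)"
        using k P by (intro mult_left_mono) (auto simp: field_simps)
      moreover have "0 \<le> real (q k) * (2 * (real k / real P))" by simp
      ultimately have "real_of_int (a k) < 2 * real (q k) + 1" "-1 < real_of_int (a k)"
        unfolding abs_le_iff by linarith+
      then have "a k \<le> 2 * int (q k)" "0 \<le> a k" by linarith+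
      then show "(q k, a k) \<in> T" using k by (auto simp: T_def)
    qed
    have "(\<Sum>k<P. w k (q k) (a k)) = (\<Sum>(r, b)\<in>T. \<Sum>k\<in>{k\<in>{..<P}. (q k, a k) = (r, b)}. w k (q k) (a k))"
      unfolding case_prod_beta' prod.collapse by (rule sum.group[symmetric, OF _ fin rng]) simp
    also have "\<dots> \<le> (\<Sum>(r, b)\<in>T. \<Sum>k<P. w k r b)"
    proof (intro sum_mono, clarify)
      fix r b
      have "(\<Sum>k\<in>{k\<in>{..<P}. (q k, a k) = (r, b)}. w k (q k) (a k)) = (\<Sum>k\<in>{k\<in>{..<P}. (q k, a k) = (r, b)}. w k r b)"
        by (intro sum.cong) auto
      also have "\<dots> \<le> (\<Sum>k<P. w k r b)" by (intro sum_mono2) (auto simp: w_def)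
      finally show "(\<Sum>k\<in>{k\<in>{..<P}. (q k, a k) = (r, b)}. w k (q k) (a k)) \<le> (\<Sum>k<P. w k r b)" .
    qed
    also have "\<dots> \<le> (\<Sum>(r, b)\<in>T. real r powr (- (9 / 4)) * K1)"
    proof (intro sum_mono, clarify)
      fix r b assume "(r, b) \<in> T"
      then have r: "r > 0" using qa by (auto simp: T_def)
      have "(\<Sum>k<P. w k r b) \<le> (\<Sum>k<P. real r powr (- (9 / 4)) *
          (max 1 (\<bar>real k - of_int b * real P / (2 * real r)\<bar> / real d)) powr (- (9 / 8)))"
        unfolding w_def using assms r X P XP by (intro sum_mono arc_weight_powr_le) auto
      also have "\<dots> \<le> real r powr (- (9 / 4)) * K1"
        unfolding sum_distrib_left[symmetric] by (intro mult_left_mono K1) auto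
      finally show "(\<Sum>k<P. w k r b) \<le> real r powr (- (9 / 4)) * K1" .
    qed
    also have "\<dots> = (\<Sum>r\<in>q ` {..<P}. \<Sum>b\<in>{0..2 * int r}. real r powr (- (9 / 4)) * K1)"
      unfolding T_def by (rule sum.Sigma[symmetric]) auto
    also have "\<dots> \<le> (\<Sum>r\<in>q ` {..<P}. 3 * K1 * real r powr (- (5 / 4)))"
    proof (rule sum_mono)
      fix r assume "r \<in> q ` {..<P}"
      then have r: "r > 0" using qa by auto
      have "(\<Sum>b\<in>{0..2 * int r}. real r powr (- (9 / 4)) * K1) = (2 * real r + 1) * (real r powr (- (9 / 4)) * K1)"
        by (simp add: nat_add_distrib nat_mult_distrib)
      also have "\<dots> \<le> (3 * real r) * (real r powr (- (9 / 4)) * K1)"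
        using r K1(1) by (intro mult_right_mono) auto
      also have "real r powr (- (5 / 4)) = real r powr 1 * real r powr (- (9 / 4))"
        unfolding powr_add[symmetric] by simp
      then have "(3 * real r) * (real r powr (- (9 / 4)) * K1) = 3 * K1 * real r powr (- (5 / 4))"
        using r by simp
      finally show "(\<Sum>b\<in>{0..2 * int r}. real r powr (- (9 / 4)) * K1) \<le> 3 * K1 * real r powr (- (5 / 4))" .
    qed
    also have "\<dots> = 3 * K1 * (\<Sum>r\<in>q ` {..<P}. real r powr (- (5 / 4)))"
      by (simp add: sum_distrib_left)
    also have "\<dots> \<le> K"
      unfolding K_def using K1(1) sm by (intro mult_left_mono sum_le_suminf) auto
    finally show ?thesis by (simp add: w_def)
  qed
  moreover have "K \<ge> 0" using K1(1) sm by (auto simp: K_def intro!: mult_nonneg_nonneg suminf_nonneg)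
  ultimately show ?thesis by blast
qed

lemma powr_five_halves_add_le:
  fixes x y :: real
  assumes "x \<ge> 0" "y \<ge> 0"
  shows "(x + y) powr (5 / 2) \<le> 6 * (x powr (5 / 2) + y powr (5 / 2))"
proof -
  have "(x + y) powr (5 / 2) \<le> (2 * max x y) powr (5 / 2)" using assms by (intro powr_mono2) auto
  also have "\<dots> = 2 powr (5 / 2) * (max x y) powr (5 / 2)" using assms by (simp add: powr_mult)
  also have "\<dots> \<le> 6 * (max x y) powr (5 / 2)"
  proof (rule mult_right_mono)
    have "(2::real) powr (5 / 2) = 2 powr (2 + 1 / 2)" by simp
    also have "\<dots> = 4 * sqrt 2" unfolding powr_add by (simp add: powr_half_sqrt)
    also have "\<dots> \<le> 4 * (3 / 2)" by (intro mult_left_mono real_le_lsqrt) (auto simp: power2_eq_square)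
    finally show "(2::real) powr (5 / 2) \<le> 6" by simp
  qed auto
  also have "(max x y) powr (5 / 2) \<le> x powr (5 / 2) + y powr (5 / 2)" by (simp add: max_def)
  finally show ?thesis by simp
qed

text \<open>Five factors are estimated by the common bound \<open>b\<close>, the others trivially.\<close>

lemma prod_quad_sum_le:
  fixes \<theta> :: "'d::finite \<Rightarrow> real"
  assumes d: "CARD('d) \<ge> 5" and X: "X = 2 * real N + 1"
    and b: "\<And>\<theta>. (norm (quad_sum N \<alpha> \<theta>))\<^sup>2 \<le> b"
  shows "(\<Prod>i\<in>UNIV. norm (quad_sum N \<alpha> (\<theta> i))) \<le> b powr (5 / 2) * X ^ (CARD('d) - 5)"
proof -
  obtain J :: "'d set" where J: "card J = 5"
    using obtain_subset_with_card_n[OF d] by blast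
  have b0: "b \<ge> 0" using b[of 0] by (smt (verit) zero_le_power2)
  have "(\<Prod>i\<in>UNIV. norm (quad_sum N \<alpha> (\<theta> i))) = (\<Prod>i\<in>J. norm (quad_sum N \<alpha> (\<theta> i))) * (\<Prod>i\<in>-J. norm (quad_sum N \<alpha> (\<theta> i)))"
    by (subst prod.union_disjoint[symmetric]) auto
  also have "\<dots> \<le> (\<Prod>i\<in>J. sqrt b) * (\<Prod>i\<in>-J. X)"
    using b norm_quad_sum_le[of N \<alpha>] X by (intro mult_mono prod_mono prod_nonneg) (auto intro!: real_le_rsqrt b0)
  also have "\<dots> = sqrt b ^ 5 * X ^ (CARD('d) - 5)"
    using J by (simp add: Compl_eq_Diff_UNIV card_Diff_subset)
  also have "sqrt b ^ 5 = b powr (5 / 2)"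
  proof (cases "b = 0")
    case False
    then have "sqrt b ^ 5 = sqrt b powr real 5"
      using b0 by (subst powr_realpow) auto
    then have "sqrt b ^ 5 = (b powr (1 / 2)) powr 5"
      using b0 by (simp add: powr_half_sqrt)
    then show ?thesis by (simp add: powr_powr)
  qed simp
  finally show ?thesis .
qed

lemma log_error_negligible:
  fixes e C :: real
  assumes "e > 0" "C > 0"
  shows "\<exists>X0. \<forall>X\<ge>X0. C * X\<^sup>2 * (13 * X * (1 + ln (2 * X))) powr (5 / 2) \<le> e * X ^ 5"
proof -
  have "((\<lambda>X::real. C * X\<^sup>2 * (13 * X * (1 + ln (2 * X))) powr (5 / 2) / X ^ 5) \<longlongrightarrow> 0) at_top"
    using assms by real_asymp
  then have "\<forall>\<^sub>F X in at_top. C * X\<^sup>2 * (13 * X * (1 + ln (2 * X))) powr (5 / 2) / X ^ 5 < e"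
    using assms(1) by (rule order_tendstoD)
  then have "\<forall>\<^sub>F X in at_top. C * X\<^sup>2 * (13 * X * (1 + ln (2 * X))) powr (5 / 2) \<le> e * X ^ 5"
    using eventually_gt_at_top[of 0]
    by eventually_elim (simp add: divide_less_eq)
  then show ?thesis by (simp add: eventually_at_top_linorder)
qed

text \<open>A point is major when its arc weight exceeds a threshold \<open>\<tau>\<close>. The bounded sum of the powers \<open>9/4\<close> of the
weights limits the number of major points, and elsewhere the power \<open>5/2\<close> of a weight is at
most \<open>\<tau>\<^bsup>1/4\<^esup>\<close> times its power \<open>9/4\<close>.\<close>

lemma minor_arcs:
  fixes e :: real
  assumes d: "CARD('d::finite) \<ge> 5" and e: "e > 0"
  shows "\<exists>(Q::nat) T K l0. T > 0 \<and> K \<ge> 0 \<and>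
    (\<forall>(l::nat) N P. l0 \<le> l \<longrightarrow> l < (N + 1)\<^sup>2 \<longrightarrow> P = CARD('d) * l + 1 \<longrightarrow>
      (\<exists>M. M \<subseteq> {..<P} \<and> real (card M) \<le> K \<and>
        (\<forall>k\<in>M. \<exists>q a. 0 < q \<and> q \<le> Q \<and> \<bar>2 * (real k / real P) - of_int a / real q\<bar> \<le> T / real l) \<and>
        (\<forall>\<theta> :: 'd \<Rightarrow> real. (\<Sum>k\<in>{..<P} - M. \<Prod>i\<in>UNIV. norm (quad_sum N (real k / real P) (\<theta> i)))
            \<le> e * (2 * real N + 1) ^ CARD('d))))"
proof -
  define d where "d = CARD('d)"
  have d5: "d \<ge> 5" "d > 0" using d by (auto simp: d_def)
  obtain K where K: "K \<ge> 0" "\<forall>X P q a. X \<ge> 1 \<longrightarrow> P > 0 \<longrightarrow> real P \<le> real d * X\<^sup>2 \<longrightarrow>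
    (\<forall>k<P. 0 < q k \<and> \<bar>real (q k) * (2 * (real k / real P)) - of_int (a k)\<bar> \<le> 1 / (2 * X)) \<longrightarrow>
    (\<Sum>k<P. arc_weight X (q k) (2 * (real k / real P) - of_int (a k) / real (q k)) powr (9 / 4)) \<le> K"
    using sum_arc_weight_le[OF d5(2)] by (elim exE conjE)
  \<comment> \<open>The threshold is chosen so that \<open>96 (K + 1) \<tau>\<^bsup>1/4\<^esup> = e/2\<close>; the constants 6 and \<open>96 = 6 \<cdot> 16\<close> come from splitting the power \<open>5/2\<close> of a sum and from \<open>3\<^bsup>5/2\<^esup> \<le> 16\<close>.\<close>
  define \<tau> where "\<tau> = (e / (192 * (K + 1))) ^ 4"
  have \<tau>: "\<tau> > 0" using e K(1) by (simp add: \<tau>_def)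
  have \<tau>4: "\<tau> powr (1 / 4) = e / (192 * (K + 1))"
  proof -
    define u where "u = e / (192 * (K + 1))"
    have "u > 0" using e K(1) by (simp add: u_def)
    then have "u ^ 4 = u powr real 4" by (subst powr_realpow) auto
    then have "(u ^ 4) powr (1 / 4) = u" using \<open>u > 0\<close> by (simp add: powr_powr del: powr_numeral)
    then show ?thesis by (simp add: \<tau>_def u_def)
  qed
  \<comment> \<open>The logarithmic term of the Weyl bound, summed over all \<open>P \<le> d X\<^sup>2\<close> points, is of lower order than \<open>X\<^sup>5\<close>.\<close>
  obtain X0 where X0: "\<And>X. X \<ge> X0 \<Longrightarrow>
      6 * real d * X\<^sup>2 * (13 * X * (1 + ln (2 * X))) powr (5 / 2) \<le> (e / 2) * X ^ 5"
    using log_error_negligible[of "e / 2" "6 * real d"] e d5 by auto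
  define l0 where "l0 = (nat \<lceil>X0\<rceil>)\<^sup>2 + 1"
  have main: "\<exists>M. M \<subseteq> {..<P} \<and> real (card M) \<le> K / \<tau> powr (9 / 4) \<and>
        (\<forall>k\<in>M. \<exists>q a. 0 < q \<and> q \<le> nat \<lceil>1 / \<tau>\<rceil> \<and> \<bar>2 * (real k / real P) - of_int a / real q\<bar> \<le> (1 / \<tau>)\<^sup>2 / real l) \<and>
        (\<forall>\<theta> :: 'd \<Rightarrow> real. (\<Sum>k\<in>{..<P} - M. \<Prod>i\<in>UNIV. norm (quad_sum N (real k / real P) (\<theta> i)))
            \<le> e * (2 * real N + 1) ^ CARD('d))"
    if l: "l0 \<le> l" "l < (N + 1)\<^sup>2" and P: "P = CARD('d) * l + 1" for l N P
  proof -
    define X where "X = 2 * real N + 1"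
    have l1: "l \<ge> 1" using l by (simp add: l0_def)
    have X1: "X \<ge> 1" by (simp add: X_def)
    have X2: "real l + 1 \<le> X\<^sup>2"
    proof -
      have "real (l + 1) \<le> real ((N + 1)\<^sup>2)" using l(2) by (intro of_nat_mono) simp
      also have "\<dots> \<le> X\<^sup>2" unfolding X_def of_nat_power by (intro power_mono) auto
      finally show ?thesis by simp
    qed
    have XX0: "X \<ge> X0"
    proof -
      have "(nat \<lceil>X0\<rceil>)\<^sup>2 \<le> (N + 1)\<^sup>2" using l unfolding l0_def by linarith
      then have "nat \<lceil>X0\<rceil> \<le> N + 1" using power2_le_imp_le by blast
      then have "N \<ge> 1 \<or> X0 \<le> 1" "real (nat \<lceil>X0\<rceil>) \<le> real (N + 1)" by linarith+
      moreover have "X0 \<le> real (nat \<lceil>X0\<rceil>)" by linarith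
      ultimately show ?thesis by (auto simp: X_def)
    qed
    have Pd: "real P \<le> real d * X\<^sup>2"
    proof -
      have "real P \<le> real d * (real l + 1)" using d5 by (simp add: P d_def algebra_simps)
      also have "\<dots> \<le> real d * X\<^sup>2" using X2 by (intro mult_left_mono) auto
      finally show ?thesis .
    qed
    have P0: "P > 0" by (simp add: P)
    define good where "good k q a \<longleftrightarrow> 0 < q \<and> real q \<le> 2 * X
       \<and> \<bar>real q * (2 * (real k / real P)) - of_int a\<bar> \<le> 1 / (2 * X)
       \<and> (\<forall>\<theta>. (norm (quad_sum N (real k / real P) \<theta>))\<^sup>2 \<le> 13 * X * (1 + ln (2 * X))
          + 3 * X\<^sup>2 * arc_weight X q (2 * (real k / real P) - of_int a / real q))" for k q a
    have "\<exists>q a. good k q a" for k unfolding good_def X_def by (rule weyl_bound_arc)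
    then obtain q a where good: "\<And>k. good k (q k) (a k)" by metis
    have qa: "\<And>k. 0 < q k" "\<And>k. \<bar>real (q k) * (2 * (real k / real P)) - of_int (a k)\<bar> \<le> 1 / (2 * X)"
      "\<And>k \<theta>. (norm (quad_sum N (real k / real P) \<theta>))\<^sup>2 \<le> 13 * X * (1 + ln (2 * X))
          + 3 * X\<^sup>2 * arc_weight X (q k) (2 * (real k / real P) - of_int (a k) / real (q k))"
      using good unfolding good_def by simp_all
    define w where "w k = arc_weight X (q k) (2 * (real k / real P) - of_int (a k) / real (q k))" for k
    have w0: "w k \<ge> 0" for k by (simp add: w_def arc_weight_def)
    have sw: "(\<Sum>k<P. w k powr (9 / 4)) \<le> K"
      unfolding w_def using qa X1 Pd P0 by (intro K(2)[rule_format]) auto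
    define M where "M = {k\<in>{..<P}. w k > \<tau>}"
    define A where "A = 13 * X * (1 + ln (2 * X))"
    have A0: "A \<ge> 0" using X1 by (simp add: A_def)
    have "real (card M) * \<tau> powr (9 / 4) = (\<Sum>k\<in>M. \<tau> powr (9 / 4))" by simp
    also have "\<dots> \<le> (\<Sum>k\<in>M. w k powr (9 / 4))"
      using \<tau> by (intro sum_mono powr_mono2) (auto simp: M_def)
    also have "\<dots> \<le> (\<Sum>k<P. w k powr (9 / 4))" by (intro sum_mono2) (auto simp: M_def)
    finally have cM: "real (card M) \<le> K / \<tau> powr (9 / 4)"
      using sw \<tau> by (simp add: field_simps)
    have arcs: "\<exists>q a. 0 < q \<and> q \<le> nat \<lceil>1 / \<tau>\<rceil> \<and> \<bar>2 * (real k / real P) - of_int a / real q\<bar> \<le> (1 / \<tau>)\<^sup>2 / real l"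
      if k: "k \<in> M" for k
    proof -
      define \<beta> where "\<beta> = 2 * (real k / real P) - of_int (a k) / real (q k)"
      have "\<tau> < 1 / (real (q k) * max 1 (X * sqrt \<bar>\<beta>\<bar>))" using k by (simp add: M_def w_def arc_weight_def \<beta>_def)
      moreover have pos: "0 < real (q k) * max 1 (X * sqrt \<bar>\<beta>\<bar>)" using qa(1)[of k] by simp
      ultimately have "real (q k) * max 1 (X * sqrt \<bar>\<beta>\<bar>) < 1 / \<tau>" using \<tau> by (simp add: field_simps)
      moreover have "real (q k) * 1 \<le> real (q k) * max 1 (X * sqrt \<bar>\<beta>\<bar>)" by (intro mult_left_mono) auto
      moreover have "1 * (X * sqrt \<bar>\<beta>\<bar>) \<le> real (q k) * max 1 (X * sqrt \<bar>\<beta>\<bar>)"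
        using qa(1)[of k] X1 by (intro mult_mono) auto
      ultimately have 1: "real (q k) \<le> 1 / \<tau>" "X * sqrt \<bar>\<beta>\<bar> \<le> 1 / \<tau>" by linarith+
      have "(X * sqrt \<bar>\<beta>\<bar>)\<^sup>2 \<le> (1 / \<tau>)\<^sup>2" using 1(2) X1 by (intro power_mono) auto
      then have "X\<^sup>2 * \<bar>\<beta>\<bar> \<le> (1 / \<tau>)\<^sup>2" by (simp add: power_mult_distrib)
      moreover have "real l * \<bar>\<beta>\<bar> \<le> X\<^sup>2 * \<bar>\<beta>\<bar>" using X2 by (intro mult_right_mono) auto
      ultimately have "\<bar>\<beta>\<bar> * real l \<le> (1 / \<tau>)\<^sup>2" by (simp only: mult.commute)
      then have "\<bar>\<beta>\<bar> \<le> (1 / \<tau>)\<^sup>2 / real l" using l1 by (simp only: le_divide_eq) simp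
      moreover have "q k \<le> nat \<lceil>1 / \<tau>\<rceil>" using 1(1) by linarith
      ultimately show ?thesis using qa(1)[of k] by (auto simp: \<beta>_def)
    qed
    have "(\<Sum>k\<in>{..<P} - M. \<Prod>i\<in>UNIV. norm (quad_sum N (real k / real P) (\<theta> i))) \<le> e * X ^ d"
      for \<theta> :: "'d \<Rightarrow> real"
    proof -
      have each: "(\<Prod>i\<in>UNIV. norm (quad_sum N (real k / real P) (\<theta> i)))
        \<le> (6 * A powr (5 / 2) + 96 * X ^ 5 * \<tau> powr (1 / 4) * w k powr (9 / 4)) * X ^ (d - 5)"
        if k: "k \<in> {..<P} - M" for k
      proof -
        have wk: "w k \<le> \<tau>" using k by (auto simp: M_def)
        have "(\<Prod>i\<in>UNIV. norm (quad_sum N (real k / real P) (\<theta> i))) \<le> (A + 3 * X\<^sup>2 * w k) powr (5 / 2) * X ^ (d - 5)"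
          unfolding d_def using d X_def qa(3)[of k] by (intro prod_quad_sum_le) (auto simp: A_def w_def)
        also have "(A + 3 * X\<^sup>2 * w k) powr (5 / 2) \<le> 6 * (A powr (5 / 2) + (3 * X\<^sup>2 * w k) powr (5 / 2))"
          using A0 w0[of k] by (intro powr_five_halves_add_le) auto
        also have "(3 * X\<^sup>2 * w k) powr (5 / 2) = 3 powr (5 / 2) * X ^ 5 * (w k powr (5 / 2))"
        proof -
          have "X\<^sup>2 = X powr real 2" "X ^ 5 = X powr real 5"
            using X1 by (subst powr_realpow; simp)+
          then have "(X\<^sup>2) powr (5 / 2) = X ^ 5"
            by (simp add: powr_powr del: powr_numeral)
          then show ?thesis using X1 w0[of k] by (simp add: powr_mult)
        qed
        also have "w k powr (5 / 2) = w k powr (1 / 4) * w k powr (9 / 4)"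
          by (simp flip: powr_add)
        also have "6 * (A powr (5 / 2) + 3 powr (5 / 2) * X ^ 5 * (w k powr (1 / 4) * w k powr (9 / 4)))
            \<le> 6 * (A powr (5 / 2) + 16 * X ^ 5 * (\<tau> powr (1 / 4) * w k powr (9 / 4)))"
        proof -
          have "(3::real) powr (5 / 2) = 3 powr (2 + 1 / 2)" by simp
          also have "\<dots> = 9 * sqrt 3" unfolding powr_add by (simp add: powr_half_sqrt)
          also have "\<dots> \<le> 9 * (16 / 9)" by (intro mult_left_mono real_le_lsqrt) (auto simp: power2_eq_square)
          finally have "(3::real) powr (5 / 2) \<le> 16" by simp
          moreover have "w k powr (1 / 4) \<le> \<tau> powr (1 / 4)" using wk w0[of k] by (intro powr_mono2) auto
          ultimately have "3 powr (5 / 2) * X ^ 5 * (w k powr (1 / 4) * w k powr (9 / 4))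
            \<le> 16 * X ^ 5 * (\<tau> powr (1 / 4) * w k powr (9 / 4))"
            using X1 by (intro mult_mono) auto
          then show ?thesis by (intro mult_left_mono add_left_mono, assumption) simp
        qed
        finally show ?thesis using X1 by (simp add: mult_right_mono algebra_simps)
      qed
      have "(\<Sum>k\<in>{..<P} - M. \<Prod>i\<in>UNIV. norm (quad_sum N (real k / real P) (\<theta> i)))
        \<le> (\<Sum>k\<in>{..<P} - M. (6 * A powr (5 / 2) + 96 * X ^ 5 * \<tau> powr (1 / 4) * w k powr (9 / 4)) * X ^ (d - 5))"
        by (intro sum_mono each)
      also have "\<dots> \<le> (\<Sum>k<P. (6 * A powr (5 / 2) + 96 * X ^ 5 * \<tau> powr (1 / 4) * w k powr (9 / 4)) * X ^ (d - 5))"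
        using X1 by (intro sum_mono2) auto
      also have "\<dots> = (6 * real P * A powr (5 / 2) + 96 * X ^ 5 * \<tau> powr (1 / 4) * (\<Sum>k<P. w k powr (9 / 4))) * X ^ (d - 5)"
        by (simp add: sum.distrib sum_distrib_left sum_distrib_right algebra_simps)
      also have "\<dots> \<le> (e / 2 * X ^ 5 + e / 2 * X ^ 5) * X ^ (d - 5)"
      proof (intro mult_right_mono add_mono)
        have "6 * real P * A powr (5 / 2) \<le> 6 * (real d * X\<^sup>2) * A powr (5 / 2)"
          using Pd by (intro mult_right_mono mult_left_mono) auto
        also have "\<dots> \<le> e / 2 * X ^ 5" using X0[OF XX0] by (simp add: A_def mult.assoc)
        finally show "6 * real P * A powr (5 / 2) \<le> e / 2 * X ^ 5" .
        have "96 * X ^ 5 * \<tau> powr (1 / 4) * (\<Sum>k<P. w k powr (9 / 4)) \<le> 96 * X ^ 5 * \<tau> powr (1 / 4) * (K + 1)"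
          using X1 sw by (intro mult_left_mono) auto
        also have "\<dots> = e / 2 * X ^ 5" unfolding \<tau>4 using K(1) by (simp add: field_simps)
        finally show "96 * X ^ 5 * \<tau> powr (1 / 4) * (\<Sum>k<P. w k powr (9 / 4)) \<le> e / 2 * X ^ 5" .
      qed (use X1 in auto)
      also have "\<dots> = e * (X ^ 5 * X ^ (d - 5))" by (simp add: algebra_simps)
      also have "X ^ 5 * X ^ (d - 5) = X ^ d" using d5 by (simp flip: power_add)
      finally show ?thesis .
    qed
    with cM arcs show ?thesis by (intro exI[of _ M]) (auto simp: M_def X_def d_def)
  qed
  have pos: "(1 / \<tau>)\<^sup>2 > 0" "K / \<tau> powr (9 / 4) \<ge> 0" using \<tau> K(1) by auto
  show ?thesis
    by (rule exI[of _ "nat \<lceil>1 / \<tau>\<rceil>"], rule exI[of _ "(1 / \<tau>)\<^sup>2"],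
        rule exI[of _ "K / \<tau> powr (9 / 4)"], rule exI[of _ l0], intro conjI allI impI)
       (rule pos, rule pos, rule main)
qed

section \<open>Exponential sums over lattice spheres\<close>

definition sphere_sum :: "nat \<Rightarrow> ('d::finite \<Rightarrow> real) \<Rightarrow> complex" where
  "sphere_sum l \<xi> = (\<Sum>v\<in>(lattice_sphere (int l) :: (int ^ 'd) set). ee (\<Sum>i\<in>UNIV. \<xi> i * of_int (v $ i)))"

lemma prod_quad_sum_eq:
  fixes \<theta> :: "'d::finite \<Rightarrow> real"
  shows "(\<Prod>i\<in>UNIV. quad_sum N \<alpha> (\<theta> i))
    = (\<Sum>v\<in>(lattice_box N :: (int ^ 'd) set). ee (\<alpha> * of_int (sqnorm v) + (\<Sum>i\<in>UNIV. \<theta> i * of_int (v $ i))))"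
proof -
  have "(\<Prod>i\<in>UNIV. quad_sum N \<alpha> (\<theta> i)) =
      (\<Sum>g\<in>PiE UNIV (\<lambda>_. {- int N..int N}). \<Prod>i\<in>UNIV. ee (\<alpha> * (of_int (g i))\<^sup>2 + \<theta> i * of_int (g i)))"
    unfolding quad_sum_def by (rule prod_sum_PiE) auto
  also have "\<dots> = (\<Sum>v\<in>(lattice_box N :: (int ^ 'd) set). \<Prod>i\<in>UNIV. ee (\<alpha> * (of_int (v $ i))\<^sup>2 + \<theta> i * of_int (v $ i)))"
    by (rule sum.reindex_bij_witness[where i = vec_nth and j = vec_lambda])
       (auto simp: lattice_box_def PiE_def)
  also have "\<dots> = (\<Sum>v\<in>(lattice_box N :: (int ^ 'd) set). ee (\<alpha> * of_int (sqnorm v) + (\<Sum>i\<in>UNIV. \<theta> i * of_int (v $ i))))"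
    by (intro sum.cong refl) (simp add: sqnorm_def sum_distrib_left sum.distrib flip: ee_sum)
  finally show ?thesis .
qed

lemma sqnorm_nonneg: "0 \<le> sqnorm v"
  by (simp add: sqnorm_def sum_nonneg)

lemma component_square_le_sqnorm: "(v $ i)\<^sup>2 \<le> sqnorm v"
  unfolding sqnorm_def by (intro member_le_sum) auto

lemma lattice_sphere_subset_box:
  assumes "l < (N + 1)\<^sup>2"
  shows "(lattice_sphere (int l) :: (int ^ 'd) set) \<subseteq> lattice_box N"
proof
  fix v :: "int ^ 'd" assume "v \<in> lattice_sphere (int l)"
  then have "(v $ i)\<^sup>2 \<le> int l" for i
    using component_square_le_sqnorm[of v i] by (simp add: lattice_sphere_def)
  moreover have "int l < (int N + 1)\<^sup>2" using assms by (metis of_nat_1 of_nat_add of_nat_less_iff of_nat_power)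
  ultimately have "\<bar>v $ i\<bar>\<^sup>2 < (int N + 1)\<^sup>2" for i by (metis order_le_less_trans power2_abs)
  then have "\<bar>v $ i\<bar> < int N + 1" for i by (rule power2_less_imp_less) simp
  then have "- int N \<le> v $ i \<and> v $ i \<le> int N" for i by (smt (verit))
  then show "v \<in> lattice_box N" by (simp add: lattice_box_def)
qed

lemma sqnorm_le_box:
  assumes "v \<in> (lattice_box N :: (int ^ 'd::finite) set)"
  shows "sqnorm v \<le> int (CARD('d) * N\<^sup>2)"
proof -
  have "(v $ i)\<^sup>2 \<le> (int N)\<^sup>2" for i
    using assms by (intro power2_le_iff_abs_le[THEN iffD2]) (auto simp: lattice_box_def abs_le_iff minus_le_iff)
  then have "sqnorm v \<le> (\<Sum>i\<in>(UNIV :: 'd set). (int N)\<^sup>2)" unfolding sqnorm_def by (intro sum_mono)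
  then show ?thesis by simp
qed

text \<open>Orthogonality detects \<open>|v|\<^sup>2 = m\<close>. The box of half-side \<open>N\<close>, the integer square root of \<open>l\<close>, contains all the spheres
in question, so one family of quadratic sums represents all squared radii \<open>m \<le> l\<close>; this is what makes
spheres of different radii comparable.\<close>

lemma sphere_sum_eq:
  fixes \<xi> :: "'d::finite \<Rightarrow> real"
  assumes N: "N\<^sup>2 \<le> l" "l < (N + 1)\<^sup>2" and P: "P = CARD('d) * l + 1" and m: "m \<le> l"
  shows "sphere_sum m \<xi> = 1 / of_nat P *
    (\<Sum>k<P. ee (- (real m * (real k / real P))) * (\<Prod>i\<in>UNIV. quad_sum N (real k / real P) (\<xi> i)))"
proof -
  define B where "B = (lattice_box N :: (int ^ 'd) set)"
  define ph where "ph v = ee (\<Sum>i\<in>UNIV. \<xi> i * of_int (v $ i))" for v :: "int ^ 'd"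
  have "(\<Sum>k<P. ee (- (real m * (real k / real P))) * (\<Prod>i\<in>UNIV. quad_sum N (real k / real P) (\<xi> i)))
     = (\<Sum>k<P. \<Sum>v\<in>B. ph v * ee (real k * of_int (sqnorm v - int m) / real P))"
    unfolding prod_quad_sum_eq sum_distrib_left B_def ph_def
    by (intro sum.cong refl) (simp add: algebra_simps diff_divide_distrib flip: ee_add)
  also have "\<dots> = (\<Sum>v\<in>B. ph v * (\<Sum>k<P. ee (real k * of_int (sqnorm v - int m) / real P)))"
    by (subst sum.swap) (simp add: sum_distrib_left)
  also have "\<dots> = (\<Sum>v\<in>B. ph v * (if sqnorm v = int m then of_nat P else 0))"
  proof (intro sum.cong refl)
    fix v assume v: "v \<in> B"
    have "sqnorm v \<le> int (CARD('d) * N\<^sup>2)" using v sqnorm_le_box by (auto simp: B_def)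
    also have "\<dots> \<le> int (CARD('d) * l)" using N by (intro of_nat_mono mult_left_mono) auto
    also have "\<dots> < int P" by (simp add: P)
    finally have "sqnorm v < int P" .
    have "1 * l \<le> CARD('d) * l" by (intro mult_right_mono) (auto simp: Suc_le_eq)
    \<comment> \<open>Both \<open>|v|\<^sup>2\<close> and \<open>m\<close> lie in an interval of length less than \<open>P = d l + 1\<close>, so congruence modulo \<open>P\<close> means equality.\<close>
    then have "l < P" unfolding P by linarith
    then have "int m < int P" using m by linarith
    with \<open>sqnorm v < int P\<close> have "\<bar>sqnorm v - int m\<bar> < int P" using sqnorm_nonneg[of v] by linarith
    then have "int P dvd (sqnorm v - int m) \<longleftrightarrow> sqnorm v = int m"
      using dvd_imp_le_int[of "sqnorm v - int m" "int P"] by auto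
    then show "ph v * (\<Sum>k<P. ee (real k * of_int (sqnorm v - int m) / real P)) = ph v * (if sqnorm v = int m then of_nat P else 0)"
      by (subst orthogonality_ee) (auto simp: P)
  qed
  also have "\<dots> = (\<Sum>v\<in>{v\<in>B. sqnorm v = int m}. ph v * of_nat P)"
    by (subst sum.inter_filter) (auto simp: B_def finite_lattice_box intro!: sum.cong)
  also have "{v\<in>B. sqnorm v = int m} = lattice_sphere (int m)"
    using lattice_sphere_subset_box[of m N] m N by (auto simp: B_def lattice_sphere_def)
  also have "(\<Sum>v\<in>lattice_sphere (int m). ph v * of_nat P) = of_nat P * sphere_sum m \<xi>"
    by (simp add: sphere_sum_def ph_def sum_distrib_left mult.commute)
  finally have eq: "(\<Sum>k<P. ee (- (real m * (real k / real P))) * (\<Prod>i\<in>UNIV. quad_sum N (real k / real P) (\<xi> i)))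
     = of_nat P * sphere_sum m \<xi>" .
  have "(of_nat P :: complex) \<noteq> 0" unfolding of_nat_eq_0_iff by (simp add: P)
  then show ?thesis unfolding eq by simp
qed

lemma sphere_sum_0: "sphere_sum l (\<lambda>_ :: 'd::finite. 0) = of_nat (card (lattice_sphere (int l) :: (int ^ 'd) set))"
  by (simp add: sphere_sum_def)

section \<open>Quadratic sums near a rational point\<close>

lemma norm_translated_sum_diff_le:
  fixes \<phi> :: "int \<Rightarrow> complex"
  assumes "\<And>n. norm (\<phi> n) = 1"
  shows "norm ((\<Sum>n\<in>{- int N..int N}. \<phi> n) - (\<Sum>n\<in>{- int N..int N}. \<phi> (n + int t))) \<le> 2 * real t"
proof -
  have shift: "(\<Sum>n\<in>{- int N..int N}. \<phi> (n + s)) = (\<Sum>n\<in>{- int N + s..int N + s}. \<phi> n)" for s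
    by (rule sum.reindex_bij_witness[where i = "\<lambda>n. n - s" and j = "\<lambda>n. n + s"]) auto
  show ?thesis
  proof (induction t)
    case (Suc t)
    define I where "I = {- int N + int t + 1..int N + int t}"
    have 1: "{- int N + int t..int N + int t} = insert (- int N + int t) I"
      and 2: "{- int N + int (Suc t)..int N + int (Suc t)} = insert (int N + int t + 1) I"
      by (auto simp: I_def)
    have "(\<Sum>n\<in>{- int N..int N}. \<phi> (n + int t)) - (\<Sum>n\<in>{- int N..int N}. \<phi> (n + int (Suc t)))
      = \<phi> (- int N + int t) - \<phi> (int N + int t + 1)"
      unfolding shift 1 2 by (simp add: I_def)
    also have "norm \<dots> \<le> 2"
      using norm_triangle_ineq4[of "\<phi> (- int N + int t)" "\<phi> (int N + int t + 1)"] by (simp add: assms)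
    finally have s: "norm ((\<Sum>n\<in>{- int N..int N}. \<phi> (n + int t)) - (\<Sum>n\<in>{- int N..int N}. \<phi> (n + int (Suc t)))) \<le> 2" .
    have "norm ((\<Sum>n\<in>{- int N..int N}. \<phi> n) - (\<Sum>n\<in>{- int N..int N}. \<phi> (n + int (Suc t)))) \<le> 2 * real t + 2"
      using norm_diff_triangle_le[OF Suc s] .
    then show ?case by simp
  qed simp
qed

text \<open>Translating \<open>n\<close> by a multiple \<open>2 q m\<close> of the period \<open>2 q\<close> changes the quadratic phase at
\<open>\<alpha> = a/(2 q) + \<beta>/2\<close> only by an integer and an error proportional to \<open>\<beta>\<close>, while the linear phase turns by
\<open>2 q m \<theta>\<close>. Averaging over \<open>m < R\<close> therefore produces a geometric sum with ratio \<open>e(2 q \<theta>)\<close>.\<close>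

lemma norm_quad_sum_le_near_rational:
  fixes \<alpha> \<theta> :: real and a :: int and q R N :: nat
  assumes R: "R > 0" and q: "q > 0"
  defines "\<beta> \<equiv> 2 * \<alpha> - of_int a / real q"
  assumes id: "int_dist (2 * real q * \<theta>) > 0"
  shows "norm (quad_sum N \<alpha> \<theta>) \<le> (2 * real N + 1) / (2 * real R * int_dist (2 * real q * \<theta>))
    + (2 * real N + 1) * (4 * pi * real q * \<bar>\<beta>\<bar> * (real R * real N + real q * (real R)\<^sup>2)) + 4 * real q * real R"
proof -
  define \<phi> where "\<phi> n = ee (\<alpha> * (of_int n)\<^sup>2 + \<theta> * of_int n)" for n :: int
  define I where "I = {- int N..int N}"
  define E where "E = 4 * pi * real q * \<bar>\<beta>\<bar> * (real R * real N + real q * (real R)\<^sup>2)"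
  have \<phi>1: "norm (\<phi> n) = 1" for n by (simp add: \<phi>_def)
  have \<alpha>: "2 * real q * \<alpha> = of_int a + real q * \<beta>" using q by (simp add: \<beta>_def field_simps)
  have \<phi>_shift: "\<phi> (n + int (2 * q * m)) = \<phi> n * ee (2 * real q * \<theta> * of_int (int m)) *
      ee (2 * real q * \<beta> * (real m * of_int n + real q * (real m)\<^sup>2))" for n m
  proof -
    have "\<alpha> * (of_int (n + int (2 * q * m)))\<^sup>2 + \<theta> * of_int (n + int (2 * q * m))
      = (\<alpha> * (of_int n)\<^sup>2 + \<theta> * of_int n) + 2 * real q * \<theta> * real m + 2 * (2 * real q * \<alpha>) * (real m * of_int n + real q * (real m)\<^sup>2)"
      by (simp add: power2_eq_square algebra_simps)
    also have "\<dots> = (\<alpha> * (of_int n)\<^sup>2 + \<theta> * of_int n) + 2 * real q * \<theta> * real m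
       + 2 * real q * \<beta> * (real m * of_int n + real q * (real m)\<^sup>2) + of_int (2 * a * (int m * n + int q * (int m)\<^sup>2))"
      unfolding \<alpha> by (simp add: algebra_simps)
    finally show ?thesis unfolding \<phi>_def by (simp only: ee_add_of_int) (simp add: ee_add)
  qed
  have geo: "norm (\<Sum>m<R. ee (2 * real q * \<theta> * of_int (int m))) \<le> 1 / (2 * int_dist (2 * real q * \<theta>))"
  proof -
    have "(\<Sum>m<R. ee (2 * real q * \<theta> * of_int (int m))) = (\<Sum>m\<in>{0..int R - 1}. ee (2 * real q * \<theta> * of_int m))"
      by (rule sum.reindex_bij_witness[where i = nat and j = int]) auto
    moreover have "0 < 2 * int_dist (2 * real q * \<theta>)" using id by simp
    ultimately show ?thesis
      using geometric_sum_ee[of "2 * real q * \<theta>" 0 "int R - 1"] by (simp only: pos_le_divide_eq)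
  qed
  have inner: "norm (\<Sum>m<R. \<phi> (n + int (2 * q * m))) \<le> 1 / (2 * int_dist (2 * real q * \<theta>)) + real R * E" if n: "n \<in> I" for n
  proof -
    define e1 where "e1 m = ee (2 * real q * \<theta> * of_int (int m))" for m
    define e2 where "e2 m = ee (2 * real q * \<beta> * (real m * of_int n + real q * (real m)\<^sup>2))" for m
    have "\<phi> (n + int (2 * q * m)) = \<phi> n * e1 m + \<phi> n * e1 m * (e2 m - 1)" for m
      unfolding \<phi>_shift[of n m] e1_def[symmetric] e2_def[symmetric] by (simp add: algebra_simps)
    then have "(\<Sum>m<R. \<phi> (n + int (2 * q * m))) = \<phi> n * (\<Sum>m<R. e1 m) + (\<Sum>m<R. \<phi> n * e1 m * (e2 m - 1))"
      by (simp only: sum_distrib_left sum.distrib)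
    also have "norm \<dots> \<le> norm (\<Sum>m<R. e1 m) + (\<Sum>m<R. E)"
    proof (intro norm_triangle_mono sum_norm_le)
      show "norm (\<phi> n * (\<Sum>m<R. e1 m)) \<le> norm (\<Sum>m<R. e1 m)"
        by (simp add: norm_mult \<phi>1)
      fix m assume "m \<in> {..<R}"
      then have m: "real m \<le> real R" by simp
      have "norm (ee (2 * real q * \<beta> * (real m * of_int n + real q * (real m)\<^sup>2)) - 1)
          \<le> 2 * pi * \<bar>2 * real q * \<beta> * (real m * of_int n + real q * (real m)\<^sup>2)\<bar>"
        by (rule norm_ee_minus_one_le)
      also have "\<dots> = 4 * pi * real q * \<bar>\<beta>\<bar> * \<bar>real m * of_int n + real q * (real m)\<^sup>2\<bar>"
        by (simp add: abs_mult)
      also have "\<dots> \<le> E" unfolding E_def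
      proof (intro mult_left_mono)
        have "\<bar>real m * of_int n + real q * (real m)\<^sup>2\<bar> \<le> real m * \<bar>of_int n\<bar> + real q * (real m)\<^sup>2"
          using abs_triangle_ineq[of "real m * of_int n" "real q * (real m)\<^sup>2"] by (simp add: abs_mult)
        also have "\<dots> \<le> real R * real N + real q * (real R)\<^sup>2"
          using m n by (intro add_mono mult_mono power_mono) (auto simp: I_def)
        finally show "\<bar>real m * of_int n + real q * (real m)\<^sup>2\<bar> \<le> real R * real N + real q * (real R)\<^sup>2" .
      qed auto
      finally show "norm (\<phi> n * e1 m * (e2 m - 1)) \<le> E"
        by (simp add: norm_mult \<phi>1 e1_def e2_def)
    qed
    also have "\<dots> \<le> 1 / (2 * int_dist (2 * real q * \<theta>)) + (\<Sum>m<R. E)"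
      by (rule add_right_mono[OF geo[folded e1_def]])
    finally show ?thesis by (simp only: sum_constant card_lessThan)
  qed
  have "real R * norm (quad_sum N \<alpha> \<theta>) = norm (\<Sum>m<R. quad_sum N \<alpha> \<theta>)"
    by (simp add: norm_mult)
  also have "(\<Sum>m<R. quad_sum N \<alpha> \<theta>) = (\<Sum>n\<in>I. \<Sum>m<R. \<phi> (n + int (2 * q * m)))
      + (\<Sum>m<R. (\<Sum>n\<in>I. \<phi> n) - (\<Sum>n\<in>I. \<phi> (n + int (2 * q * m))))"
    by (subst sum.swap) (simp add: quad_sum_def \<phi>_def I_def sum_subtractf)
  also have "norm \<dots> \<le> (\<Sum>n\<in>I. 1 / (2 * int_dist (2 * real q * \<theta>)) + real R * E) + (\<Sum>m<R. 4 * real q * real R)"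
  proof (intro norm_triangle_mono sum_norm_le inner)
    fix m assume "m \<in> {..<R}"
    then have "2 * real (2 * q * m) \<le> 4 * real q * real R" by (simp add: mult_left_mono)
    then show "norm ((\<Sum>n\<in>I. \<phi> n) - (\<Sum>n\<in>I. \<phi> (n + int (2 * q * m)))) \<le> 4 * real q * real R"
      using norm_translated_sum_diff_le[of \<phi> N "2 * q * m", OF \<phi>1] unfolding I_def by linarith
  qed
  also have "\<dots> = real R * ((2 * real N + 1) / (2 * real R * int_dist (2 * real q * \<theta>)) + (2 * real N + 1) * E + 4 * real q * real R)"
    using R id by (simp add: I_def field_simps)
  finally show ?thesis unfolding E_def using R by (simp only: mult_le_cancel_left_pos of_nat_0_less_iff)
qed

text \<open>The averaging length in the preceding bound is taken to be a small multiple \<open>\<rho>\<close> of the radius: then the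
error terms are at most half of the assumed lower bound, and the geometric sum must account for the
rest.\<close>

lemma quad_sum_large_imp_rational:
  fixes T e :: real and Q :: nat
  assumes T: "T \<ge> 0" and e: "e > 0"
  shows "\<exists>C>0. \<exists>l0. \<forall>(l::nat) N q a \<alpha> \<theta>. l0 \<le> real l \<longrightarrow> N\<^sup>2 \<le> l \<longrightarrow> l < (N + 1)\<^sup>2 \<longrightarrow>
    0 < q \<longrightarrow> q \<le> Q \<longrightarrow> \<bar>2 * \<alpha> - of_int a / real q\<bar> \<le> T / real l \<longrightarrow>
    e * (2 * real N + 1) < norm (quad_sum N \<alpha> \<theta>) \<longrightarrow> int_dist (2 * real q * \<theta>) \<le> C / sqrt (real l)"
proof -
  define D where "D = 4 * pi * real Q * T * (2 + 4 * real Q) + 8 * real Q"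
  have D0: "D \<ge> 0" using T by (simp add: D_def)
  \<comment> \<open>The error terms are at most \<open>\<rho> D X\<close>, while the geometric sum contributes \<open>e X/2\<close> when the distance is exactly \<open>C\<close> divided by the radius.\<close>
  define \<rho> where "\<rho> = min 1 (e / (2 * (D + 1)))"
  have \<rho>: "\<rho> > 0" "\<rho> \<le> 1" using e D0 by (auto simp: \<rho>_def)
  have \<rho>D: "\<rho> * D \<le> e / 2"
  proof -
    have "\<rho> * D \<le> e / (2 * (D + 1)) * (D + 1)" using e D0 \<rho> by (intro mult_mono) (auto simp: \<rho>_def)
    also have "\<dots> = e / 2" using D0 by (simp add: field_simps)
    finally show ?thesis .
  qed
  define C where "C = 1 / (\<rho> * e)"
  have C: "C > 0" using \<rho> e by (simp add: C_def)
  have "int_dist (2 * real q * \<theta>) \<le> C / sqrt (real l)"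
    if l: "1 / \<rho>\<^sup>2 \<le> real l" and N: "N\<^sup>2 \<le> l" "l < (N + 1)\<^sup>2" and q: "0 < q" "q \<le> Q"
      and \<beta>: "\<bar>2 * \<alpha> - of_int a / real q\<bar> \<le> T / real l" and big: "e * (2 * real N + 1) < norm (quad_sum N \<alpha> \<theta>)"
    for l N q :: nat and a \<alpha> \<theta>
  proof (rule ccontr)
    assume "\<not> int_dist (2 * real q * \<theta>) \<le> C / sqrt (real l)"
    then have id: "C / sqrt (real l) < int_dist (2 * real q * \<theta>)" by simp
    define X where "X = 2 * real N + 1"
    define s where "s = sqrt (real l)"
    have s2: "real l = s\<^sup>2" by (simp add: s_def)
    have \<rho>s: "1 \<le> \<rho> * s"
    proof -
      have "1 \<le> \<rho>\<^sup>2 * real l" using l \<rho> by (simp add: field_simps)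
      then have "1\<^sup>2 \<le> (\<rho> * s)\<^sup>2" by (simp add: s2 power_mult_distrib)
      then show ?thesis using \<rho> by (intro power2_le_imp_le[of 1]) (auto simp: s_def)
    qed
    then have s0: "s > 0" using \<rho>(1) by (intro zero_less_mult_pos[of \<rho> s]) auto
    have Ns: "real N \<le> s" unfolding s_def using N(1) by (intro real_le_rsqrt) (metis of_nat_le_iff of_nat_power)
    have sX: "s \<le> X"
    proof -
      have "real l \<le> real ((N + 1)\<^sup>2)" using N(2) by (intro of_nat_mono) simp
      then have "s\<^sup>2 \<le> (real N + 1)\<^sup>2" by (simp add: s2 add.commute)
      then have "s \<le> real N + 1" by (rule power2_le_imp_le) simp
      then show ?thesis by (simp add: X_def)
    qed
    define R where "R = nat \<lceil>\<rho> * s\<rceil>"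
    have R: "\<rho> * s \<le> real R" "real R \<le> 2 * (\<rho> * s)" "R > 0" using \<rho>s by (auto simp: R_def) linarith+
    define \<beta> where "\<beta> = \<bar>2 * \<alpha> - of_int a / real q\<bar>"
    have id0: "int_dist (2 * real q * \<theta>) > 0" using id C s0 by (smt (verit) divide_nonneg_nonneg s_def)
    have "norm (quad_sum N \<alpha> \<theta>) \<le> X / (2 * real R * int_dist (2 * real q * \<theta>))
      + X * (4 * pi * real q * \<beta> * (real R * real N + real q * (real R)\<^sup>2)) + 4 * real q * real R"
      unfolding X_def \<beta>_def by (rule norm_quad_sum_le_near_rational[OF R(3) q(1) id0])
    also have "X / (2 * real R * int_dist (2 * real q * \<theta>)) \<le> X / (2 * (\<rho> * s) * (C / s))"
      using R \<rho> \<rho>s C s0 id id0 by (intro divide_left_mono mult_mono mult_pos_pos) (auto simp: X_def s_def)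
    also have "X / (2 * (\<rho> * s) * (C / s)) = e / 2 * X"
      using \<rho> s0 e by (simp add: C_def)
    finally have 1: "norm (quad_sum N \<alpha> \<theta>) \<le> e / 2 * X
      + X * (4 * pi * real q * \<beta> * (real R * real N + real q * (real R)\<^sup>2)) + 4 * real q * real R" by simp
    have "\<beta> * (real R * real N + real q * (real R)\<^sup>2) \<le> T / s\<^sup>2 * ((2 * (\<rho> * s)) * s + real Q * (2 * (\<rho> * s))\<^sup>2)"
      using \<beta> R Ns q T s0 \<rho> unfolding \<beta>_def s2
      by (intro mult_mono add_mono power_mono) auto
    also have "\<dots> = T * (2 * \<rho> + 4 * real Q * \<rho>\<^sup>2)"
      using s0 by (simp add: field_simps power2_eq_square)
    also have "\<dots> \<le> T * (2 * \<rho> + 4 * real Q * \<rho>)"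
      using \<rho> T by (intro mult_left_mono add_left_mono) (auto simp: power2_eq_square mult_left_le)
    also have "\<dots> = \<rho> * T * (2 + 4 * real Q)" by (simp add: algebra_simps)
    finally have "4 * pi * real q * (\<beta> * (real R * real N + real q * (real R)\<^sup>2)) \<le> 4 * pi * real Q * (\<rho> * T * (2 + 4 * real Q))"
      using q T \<rho> by (intro mult_mono[of "4 * pi * real q" "4 * pi * real Q"]) (auto simp: \<beta>_def)
    then have "X * (4 * pi * real q * \<beta> * (real R * real N + real q * (real R)\<^sup>2)) \<le> X * (4 * pi * real Q * (\<rho> * T * (2 + 4 * real Q)))"
      by (intro mult_left_mono) (auto simp: X_def mult.assoc)
    moreover have "4 * real q * real R \<le> 4 * real Q * (2 * (\<rho> * X))"
    proof (intro mult_mono)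
      show "real R \<le> 2 * (\<rho> * X)" using R(2) mult_left_mono[OF sX, of \<rho>] \<rho> by linarith
    qed (use q in auto)
    moreover have "X * (4 * pi * real Q * (\<rho> * T * (2 + 4 * real Q))) + 4 * real Q * (2 * (\<rho> * X)) = X * (\<rho> * D)"
      by (simp add: D_def algebra_simps)
    moreover have "X * (\<rho> * D) \<le> X * (e / 2)" using \<rho>D by (intro mult_left_mono) (auto simp: X_def)
    ultimately have "norm (quad_sum N \<alpha> \<theta>) \<le> e / 2 * X + X * (e / 2)" using 1 by linarith
    then show False using big by (simp add: X_def)
  qed
  with C show ?thesis by blast
qed

section \<open>Spheres of nearby radii\<close>

text \<open>The normalisation of the circle method: a box of \<open>(2 N + 1)\<^sup>d\<close> points, averaged over \<open>P\<close> frequencies,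
corresponds to the expected number of points on the sphere.\<close>

lemma box_volume_div_modulus_le:
  assumes d: "d \<ge> 2" and l: "l \<ge> 1" and N: "N\<^sup>2 \<le> l" and P: "P = d * l + 1"
  shows "(2 * real N + 1) ^ d / real P \<le> 3 ^ d * sqrt (real l) ^ (d - 2)"
proof -
  define s where "s = sqrt (real l)"
  have Ns: "real N \<le> s" unfolding s_def using N by (intro real_le_rsqrt) (metis of_nat_le_iff of_nat_power)
  have "s \<ge> 1" using l by (simp add: s_def)
  then have "(2 * real N + 1) ^ d \<le> (3 * s) ^ d" using Ns by (intro power_mono) auto
  also have "\<dots> = 3 ^ d * (s\<^sup>2 * s ^ (d - 2))"
    using power_add[of s 2 "d - 2"] d by (simp only: power_mult_distrib le_add_diff_inverse)
  also have "s\<^sup>2 = real l" by (simp add: s_def)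
  also have "3 ^ d * (real l * s ^ (d - 2)) \<le> 3 ^ d * (real P * s ^ (d - 2))"
  proof -
    have "1 * l \<le> d * l" using d by (intro mult_right_mono) auto
    then have "l \<le> P" unfolding P by linarith
    then show ?thesis using \<open>s \<ge> 1\<close> by (intro mult_left_mono mult_right_mono) auto
  qed
  finally have "(2 * real N + 1) ^ d \<le> 3 ^ d * (real P * s ^ (d - 2))" .
  moreover have "real P > 0" unfolding P by (simp only: of_nat_0_less_iff)
  ultimately show ?thesis by (simp add: s_def pos_divide_le_eq mult_ac)
qed

lemma ex_floor_sqrt: "\<exists>N::nat. N\<^sup>2 \<le> l \<and> l < (N + 1)\<^sup>2"
proof
  show "(floor_sqrt l)\<^sup>2 \<le> l \<and> l < (floor_sqrt l + 1)\<^sup>2"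
    using floor_sqrt_power2_le[of l] Suc_floor_sqrt_power2_gt[of l] by simp
qed

lemma norm_sphere_sum_le:
  fixes \<xi> :: "'d::finite \<Rightarrow> real"
  assumes N: "N\<^sup>2 \<le> l" "l < (N + 1)\<^sup>2" and P: "P = CARD('d) * l + 1"
  shows "norm (sphere_sum l \<xi>) \<le> 1 / real P * (\<Sum>k<P. \<Prod>i\<in>UNIV. norm (quad_sum N (real k / real P) (\<xi> i)))"
proof -
  have "norm (\<Sum>k<P. ee (- (real l * (real k / real P))) * (\<Prod>i\<in>UNIV. quad_sum N (real k / real P) (\<xi> i)))
      \<le> (\<Sum>k<P. \<Prod>i\<in>UNIV. norm (quad_sum N (real k / real P) (\<xi> i)))"
    by (intro sum_norm_le) (simp add: norm_mult prod_norm)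
  then show ?thesis
    unfolding sphere_sum_eq[OF N P order.refl] norm_mult
    by (intro mult_mono) (auto simp: norm_divide)
qed

text \<open>The two counts differ by a factor \<open>1 - e(m \<alpha>)\<close> under the sum over \<open>\<alpha>\<close>. At a major point with
denominator \<open>q\<close> the modulus \<open>8 \<cdot> Q!\<close> absorbs \<open>2 q\<close>, and \<open>m \<le> \<eta> l\<close> makes the remaining phase small; the
minor points are negligible without any cancellation. The factor 8 only serves the
count of residues at the prime 2.\<close>

lemma sphere_count_nearby_radii:
  assumes d: "CARD('d::finite) \<ge> 5" and e: "e > 0"
  shows "\<exists>\<eta>>0. \<exists>Q l0. \<forall>(l::nat) m. l0 \<le> l \<longrightarrow> 8 * fact Q dvd m \<longrightarrow> real m \<le> \<eta> * real l \<longrightarrow> m \<le> l \<longrightarrow>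
    \<bar>real (card (lattice_sphere (int l) :: (int ^ 'd) set)) - real (card (lattice_sphere (int (l - m)) :: (int ^ 'd) set))\<bar>
      \<le> e * sqrt (real l) ^ (CARD('d) - 2)"
proof -
  define e' where "e' = e / (3 * 3 ^ CARD('d))"
  have e': "e' > 0" using e by (simp add: e'_def)
  obtain Q T K l0 where T: "T > 0" "K \<ge> 0" and
    minor: "\<forall>(l::nat) N P. l0 \<le> l \<longrightarrow> l < (N + 1)\<^sup>2 \<longrightarrow> P = CARD('d) * l + 1 \<longrightarrow>
      (\<exists>M. M \<subseteq> {..<P} \<and> real (card M) \<le> K \<and>
        (\<forall>k\<in>M. \<exists>q a. 0 < q \<and> q \<le> Q \<and> \<bar>2 * (real k / real P) - of_int a / real q\<bar> \<le> T / real l) \<and>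
        (\<forall>\<theta> :: 'd \<Rightarrow> real. (\<Sum>k\<in>{..<P} - M. \<Prod>i\<in>UNIV. norm (quad_sum N (real k / real P) (\<theta> i)))
            \<le> e' * (2 * real N + 1) ^ CARD('d)))"
    using minor_arcs[OF d e'] by (elim exE conjE)
  \<comment> \<open>Each major point contributes at most \<open>\<pi> T \<eta> X\<^sup>d\<close>, so all of them together at most \<open>e' X\<^sup>d\<close>.\<close>
  define \<eta> where "\<eta> = e' / (pi * T * (K + 1))"
  have \<eta>: "\<eta> > 0" using e' T by (simp add: \<eta>_def)
  have main: "\<bar>real (card (lattice_sphere (int l) :: (int ^ 'd) set)) - real (card (lattice_sphere (int (l - m)) :: (int ^ 'd) set))\<bar>
      \<le> e * sqrt (real l) ^ (CARD('d) - 2)"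
    if l: "max l0 1 \<le> l" and m: "8 * fact Q dvd m" "real m \<le> \<eta> * real l" "m \<le> l" for l m :: nat
  proof -
    obtain N where N: "N\<^sup>2 \<le> l" "l < (N + 1)\<^sup>2" using ex_floor_sqrt by blast
    define P where "P = CARD('d) * l + 1"
    define X where "X = 2 * real N + 1"
    define G where "G k = (\<Prod>i\<in>(UNIV :: 'd set). quad_sum N (real k / real P) 0)" for k
    have nG: "norm (G k) = (\<Prod>i\<in>(UNIV :: 'd set). norm (quad_sum N (real k / real P) 0))" for k
      by (simp add: G_def norm_power)
    have l1: "l \<ge> 1" "l0 \<le> l" using l by auto
    obtain M where M: "M \<subseteq> {..<P}" "real (card M) \<le> K"
      "\<forall>k\<in>M. \<exists>q a. 0 < q \<and> q \<le> Q \<and> \<bar>2 * (real k / real P) - of_int a / real q\<bar> \<le> T / real l"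
      "\<forall>\<theta> :: 'd \<Rightarrow> real. (\<Sum>k\<in>{..<P} - M. \<Prod>i\<in>UNIV. norm (quad_sum N (real k / real P) (\<theta> i))) \<le> e' * (2 * real N + 1) ^ CARD('d)"
      using minor[rule_format, OF l1(2) N(2) P_def] by (elim exE conjE)
    define D where "D k = ee (- (real l * (real k / real P))) - ee (- (real (l - m) * (real k / real P)))" for k
    have D_eq: "norm (D k) = norm (ee (real m * (real k / real P)) - 1)" for k
    proof -
      have "- (real (l - m) * (real k / real P)) = - (real l * (real k / real P)) + real m * (real k / real P)"
        using m(3) by (simp add: of_nat_diff left_diff_distrib diff_divide_distrib)
      then have "D k = ee (- (real l * (real k / real P))) - ee (- (real l * (real k / real P))) * ee (real m * (real k / real P))"
        by (simp only: D_def ee_add)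
      then have "D k = ee (- (real l * (real k / real P))) * (1 - ee (real m * (real k / real P)))"
        by (simp only: right_diff_distrib mult_1_right)
      then show ?thesis by (simp add: norm_mult norm_minus_commute)
    qed
    have D2: "norm (D k) \<le> 2" for k
      unfolding D_def using norm_triangle_ineq4[of "ee (- (real l * (real k / real P)))" "ee (- (real (l - m) * (real k / real P)))"] by simp
    have D_major: "norm (D k) \<le> pi * T * \<eta>" if k: "k \<in> M" for k
    proof -
      obtain q a where q: "0 < q" "q \<le> Q" and qa: "\<bar>2 * (real k / real P) - of_int a / real q\<bar> \<le> T / real l"
        using M(3) k by blast
      define \<beta> where "\<beta> = 2 * (real k / real P) - of_int a / real q"
      have "q dvd fact Q" using q by (intro dvd_fact) auto
      then have "2 * q dvd 8 * fact Q" by (intro mult_dvd_mono) auto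
      then have "2 * q dvd m" using m(1) dvd_trans by blast
      then obtain t where t: "m = 2 * q * t" by blast
      have "real m * (real k / real P) = real m / 2 * \<beta> + of_int (int t * a)"
        using q by (simp add: \<beta>_def t field_simps)
      then have "norm (D k) = norm (ee (real m / 2 * \<beta>) - 1)" unfolding D_eq by (simp only: ee_add_of_int)
      also have "\<dots> \<le> 2 * pi * \<bar>real m / 2 * \<beta>\<bar>" by (rule norm_ee_minus_one_le)
      also have "\<dots> = pi * (real m * \<bar>\<beta>\<bar>)" by (simp add: abs_mult)
      also have "\<dots> \<le> pi * ((\<eta> * real l) * (T / real l))"
        using m(2) qa \<eta> by (intro mult_left_mono mult_mono) (auto simp: \<beta>_def)
      also have "\<dots> = pi * T * \<eta>" using l1 by simp
      finally show ?thesis .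
    qed
    have "sphere_sum l (\<lambda>_ :: 'd. 0) - sphere_sum (l - m) (\<lambda>_ :: 'd. 0) = 1 / of_nat P * (\<Sum>k<P. D k * G k)"
      unfolding sphere_sum_eq[OF N P_def order.refl] sphere_sum_eq[OF N P_def diff_le_self]
      by (simp add: D_def G_def sum_subtractf left_diff_distrib diff_divide_distrib)
    then have "norm (sphere_sum l (\<lambda>_ :: 'd. 0) - sphere_sum (l - m) (\<lambda>_ :: 'd. 0)) = 1 / real P * norm (\<Sum>k<P. D k * G k)"
      by (simp add: norm_mult norm_divide)
    also have "norm (\<Sum>k<P. D k * G k) \<le> 3 * e' * X ^ CARD('d)"
    proof -
      have "norm (\<Sum>k<P. D k * G k) \<le> (\<Sum>k<P. norm (D k) * norm (G k))"
        by (intro sum_norm_le) (simp add: norm_mult)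
      also have "\<dots> = (\<Sum>k\<in>{..<P} - M. norm (D k) * norm (G k)) + (\<Sum>k\<in>M. norm (D k) * norm (G k))"
        using M(1) by (intro sum.subset_diff) auto
      also have "\<dots> \<le> (\<Sum>k\<in>{..<P} - M. 2 * norm (G k)) + (\<Sum>k\<in>M. pi * T * \<eta> * X ^ CARD('d))"
      proof (intro add_mono sum_mono mult_mono)
        show "norm (G k) \<le> X ^ CARD('d)" for k
        proof -
          have "norm (G k) \<le> (\<Prod>i\<in>(UNIV :: 'd set). X)"
            unfolding nG X_def by (intro prod_mono) (auto simp: norm_quad_sum_le)
          then show ?thesis by simp
        qed
      qed (use D2 D_major T \<eta> in auto)
      also have "(\<Sum>k\<in>{..<P} - M. 2 * norm (G k)) \<le> 2 * (e' * X ^ CARD('d))"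
        using M(4)[rule_format, of "\<lambda>_. 0"] by (simp add: nG X_def flip: sum_distrib_left)
      also have "(\<Sum>k\<in>M. pi * T * \<eta> * X ^ CARD('d)) \<le> e' * X ^ CARD('d)"
      proof -
        have "real (card M) * (pi * T * \<eta>) \<le> (K + 1) * (pi * T * \<eta>)"
          using M(2) T \<eta> by (intro mult_right_mono) auto
        also have "\<dots> = e'"
        proof -
          have "pi * T * (K + 1) \<noteq> 0" using T by simp
          then show ?thesis unfolding \<eta>_def by (simp only: mult.commute[of "K + 1"] mult.assoc[symmetric] times_divide_eq_right times_divide_eq_left) (simp add: mult_ac)
        qed
        finally have "real (card M) * (pi * T * \<eta>) * X ^ CARD('d) \<le> e' * X ^ CARD('d)"
          by (intro mult_right_mono) (auto simp: X_def)
        then show ?thesis by simp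
      qed
      finally show ?thesis by simp
    qed
    also have "1 / real P * (3 * e' * X ^ CARD('d)) = 3 * e' * (X ^ CARD('d) / real P)" by simp
    also have "\<dots> \<le> 3 * e' * (3 ^ CARD('d) * sqrt (real l) ^ (CARD('d) - 2))"
      unfolding X_def using e' d l1 N(1) by (intro mult_left_mono box_volume_div_modulus_le) (auto simp: P_def)
    also have "\<dots> = e * sqrt (real l) ^ (CARD('d) - 2)"
      by (simp add: e'_def)
    finally have fin: "norm (sphere_sum l (\<lambda>_ :: 'd. 0) - sphere_sum (l - m) (\<lambda>_ :: 'd. 0)) \<le> e * sqrt (real l) ^ (CARD('d) - 2)"
      by (simp add: divide_right_mono)
    have "norm (of_nat a - of_nat b :: complex) = \<bar>real a - real b\<bar>" for a b
      by (metis norm_of_real of_real_diff of_real_of_nat_eq)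
    then show ?thesis using fin by (simp add: sphere_sum_0)
  qed
  show ?thesis by (rule exI[of _ \<eta>], rule conjI[OF \<eta>], rule exI[of _ Q], rule exI[of _ "max l0 1"], intro allI impI) (rule main)
qed

section \<open>Sums of five squares to a fixed modulus\<close>

text \<open>The \<open>(p + 1)/2\<close> squares and the \<open>(p + 1)/2\<close> residues \<open>- 1 - b\<^sup>2\<close> cannot be disjoint modulo \<open>p\<close>.\<close>

lemma prime_two_squares_plus_one:
  fixes p :: nat
  assumes p: "prime p" "odd p"
  shows "\<exists>a b :: int. int p dvd a\<^sup>2 + b\<^sup>2 + 1"
proof -
  define h where "h = (int p - 1) div 2"
  have ph: "int p = 2 * h + 1" using p(2) by (auto simp: h_def elim!: oddE)
  have h0: "h \<ge> 0" using p(1) prime_ge_2_nat[of p] by (simp add: h_def)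
  define f where "f a = a\<^sup>2 mod int p" for a :: int
  define g where "g b = (- 1 - b\<^sup>2) mod int p" for b :: int
  have sq: "a = b" if "a \<in> {0..h}" "b \<in> {0..h}" "int p dvd a\<^sup>2 - b\<^sup>2" for a b :: int
  proof -
    have "int p dvd (a - b) * (a + b)" using that(3) by (simp add: power2_eq_square algebra_simps)
    then have "int p dvd a - b \<or> int p dvd a + b"
      using p(1) by (simp add: prime_dvd_mult_iff)
    moreover have "\<bar>a - b\<bar> < int p" "\<bar>a + b\<bar> < int p" using that ph by auto
    ultimately have "a - b = 0 \<or> a + b = 0"
      using dvd_imp_le_int[of "a - b" "int p"] dvd_imp_le_int[of "a + b" "int p"] by auto
    then show ?thesis using that by auto
  qed
  have "inj_on f {0..h}"
    by (intro inj_onI sq) (auto simp: f_def mod_eq_dvd_iff)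
  then have cf: "card (f ` {0..h}) = nat (h + 1)" by (simp add: card_image)
  have "inj_on g {0..h}"
  proof (intro inj_onI sq)
    fix a b assume "g a = g b"
    then have "int p dvd - (a\<^sup>2 - b\<^sup>2)" by (simp add: g_def mod_eq_dvd_iff)
    then show "int p dvd a\<^sup>2 - b\<^sup>2" by (simp only: dvd_minus_iff)
  qed
  then have cg: "card (g ` {0..h}) = nat (h + 1)" by (simp add: card_image)
  have "f ` {0..h} \<inter> g ` {0..h} \<noteq> {}"
  proof
    assume e: "f ` {0..h} \<inter> g ` {0..h} = {}"
    have "f ` {0..h} \<union> g ` {0..h} \<subseteq> {0..<int p}"
      using p(1) by (auto simp: f_def g_def prime_gt_0_nat)
    then have "card (f ` {0..h} \<union> g ` {0..h}) \<le> card {0..<int p}" by (intro card_mono) auto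
    then have "nat (h + 1) + nat (h + 1) \<le> p"
      using e cf cg by (simp add: card_Un_disjoint)
    then show False using ph h0 by linarith
  qed
  then obtain a b where "f a = g b" by auto
  then have "int p dvd a\<^sup>2 - (- 1 - b\<^sup>2)" by (simp add: f_def g_def mod_eq_dvd_iff)
  then have "int p dvd a\<^sup>2 + b\<^sup>2 + 1" by (simp add: algebra_simps)
  then show ?thesis by blast
qed

lemma solve_linear_dvd:
  fixes a c m :: int
  assumes "coprime a m"
  shows "\<exists>s. m dvd a * s + c"
proof -
  obtain x y where "a * x + m * y = 1"
    using bezout_int[of a m] assms by (auto simp: coprime_iff_gcd_eq_1 mult.commute)
  then have "a * (- c * x) + c = m * (c * y)" by (simp add: algebra_simps) (metis distrib_left mult.commute mult.left_commute mult_1_right)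
  then show ?thesis by (metis dvd_triv_left)
qed

text \<open>Built up one prime at a time: a new prime is added by the Chinese remainder theorem, a repeated prime by
Hensel lifting in whichever of \<open>a\<close>, \<open>b\<close> is not divisible by it.\<close>

lemma odd_two_squares_plus_one:
  fixes m :: nat
  assumes "odd m"
  shows "\<exists>a b :: int. int m dvd a\<^sup>2 + b\<^sup>2 + 1"
  using assms
proof (induction m rule: prime_divisors_induct)
  case (factor p x)
  then have odd: "odd p" "odd x" by auto
  obtain a b :: int where ab: "int x dvd a\<^sup>2 + b\<^sup>2 + 1" using factor odd by blast
  then obtain c where c: "a\<^sup>2 + b\<^sup>2 + 1 = int x * c" by blast
  show ?case
  proof (cases "p dvd x")
    case True
    then have px: "int p dvd int x" by simp
    have lift: "\<exists>a b :: int. int (p * x) dvd a\<^sup>2 + b\<^sup>2 + 1"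
      if ab: "a\<^sup>2 + b\<^sup>2 + 1 = int x * c" and a: "\<not> int p dvd a" for a b c :: int
    proof -
      have "coprime (2 * a) (int p)"
      proof -
        have "coprime (int p) a" using a factor.hyps by (intro prime_imp_coprime) auto
        moreover have "coprime (int p) 2" using odd(1) by (simp add: coprime_right_2_iff_odd)
        ultimately show ?thesis by (simp add: coprime_commute)
      qed
      then obtain s where "int p dvd 2 * a * s + c" using solve_linear_dvd by blast
      then have "int p dvd (2 * a * s + c) + int x * s\<^sup>2" using px by simp
      then have "int x * int p dvd int x * ((2 * a * s + c) + int x * s\<^sup>2)" by (rule mult_dvd_mono[OF dvd_refl])
      moreover have "(a + int x * s)\<^sup>2 + b\<^sup>2 + 1 = (a\<^sup>2 + b\<^sup>2 + 1) + int x * (2 * a * s + int x * s\<^sup>2)"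
        by (simp add: power2_eq_square algebra_simps)
      ultimately have "int (p * x) dvd (a + int x * s)\<^sup>2 + b\<^sup>2 + 1"
        unfolding ab by (simp add: algebra_simps)
      then show ?thesis by blast
    qed
    have "\<not> (int p dvd a \<and> int p dvd b)"
    proof
      assume "int p dvd a \<and> int p dvd b"
      then have "int p dvd a\<^sup>2 + b\<^sup>2" by (simp add: power2_eq_square)
      moreover have "int p dvd a\<^sup>2 + b\<^sup>2 + 1" using px ab dvd_trans by blast
      ultimately have "int p dvd 1" by (simp add: dvd_add_right_iff)
      then show False using factor.hyps by auto
    qed
    then show ?thesis using lift[of a b c] lift[of b a c] c by (auto simp: add_ac)
  next
    case False
    then have cop: "coprime p x" using factor.hyps by (intro prime_imp_coprime) auto
    obtain a' b' :: int where ab': "int p dvd a'\<^sup>2 + b'\<^sup>2 + 1"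
      using prime_two_squares_plus_one[OF factor.hyps odd(1)] by blast
    have copi: "coprime (int p) (int x)" using cop by simp
    obtain u where u: "[u = a'] (mod int p)" "[u = a] (mod int x)"
      using binary_chinese_remainder_int[OF copi] by blast
    obtain v where v: "[v = b'] (mod int p)" "[v = b] (mod int x)"
      using binary_chinese_remainder_int[OF copi] by blast
    have "[u\<^sup>2 + v\<^sup>2 + 1 = a'\<^sup>2 + b'\<^sup>2 + 1] (mod int p)" using u v by (intro cong_add cong_pow cong_refl)
    then have 1: "int p dvd u\<^sup>2 + v\<^sup>2 + 1" using ab' by (simp add: cong_dvd_iff)
    have "[u\<^sup>2 + v\<^sup>2 + 1 = a\<^sup>2 + b\<^sup>2 + 1] (mod int x)" using u v by (intro cong_add cong_pow cong_refl)
    then have 2: "int x dvd u\<^sup>2 + v\<^sup>2 + 1" using ab by (simp add: cong_dvd_iff)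
    show ?thesis using divides_mult[OF 1 2 copi] by auto
  qed
qed auto

text \<open>Passing from \<open>2\<^sup>k\<close> to \<open>2\<^bsup>k+1\<^esup>\<close>, one of the odd numbers \<open>x\<close> and \<open>x + 2\<^bsup>k-1\<^esup>\<close> is a root.\<close>

lemma square_root_mod_power_of_two:
  fixes n :: int
  assumes n: "8 dvd n - 1"
  shows "\<exists>x. 2 ^ k dvd x\<^sup>2 - n"
proof (cases "k \<ge> 3")
  case False
  then have "(2::int) ^ k dvd 2 ^ 3" by (intro le_imp_power_dvd) auto
  then have "(2::int) ^ k dvd 8" by simp
  then have "2 ^ k dvd n - 1" by (rule dvd_trans[OF _ n])
  then have "2 ^ k dvd 1\<^sup>2 - n" by (simp add: dvd_diff_commute)
  then show ?thesis by blast
next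
  case True
  then have "\<exists>x. odd x \<and> 2 ^ k dvd x\<^sup>2 - n"
  proof (induction k rule: dec_induct)
    case base
    have "8 dvd 1\<^sup>2 - n" using n by (simp add: dvd_diff_commute)
    then show ?case by (intro exI[of _ 1]) auto
  next
    case (step k)
    then obtain x c where x: "odd x" and c: "x\<^sup>2 - n = 2 ^ k * c" by blast
    obtain j where j: "k = j + 3" using step.hyps by (metis add.commute le_Suc_ex)
    show ?case
    proof (cases "even c")
      case True
      then obtain b where "c = 2 * b" by blast
      then have "x\<^sup>2 - n = 2 ^ Suc k * b" using c by simp
      then have "2 ^ Suc k dvd x\<^sup>2 - n" by (rule dvdI)
      then show ?thesis using x by blast
    next
      case False
      have "(x + 2 ^ (k - 1))\<^sup>2 - n = (x\<^sup>2 - n) + 2 ^ k * x + 2 ^ k * 2 ^ (j + 1)"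
        by (simp add: j power2_eq_square power_add algebra_simps)
      also have "\<dots> = 2 ^ k * (c + x + 2 ^ (j + 1))" by (simp add: c algebra_simps)
      also have "2 ^ Suc k dvd \<dots>"
      proof -
        have "2 dvd c + x + 2 ^ (j + 1)" using False x by simp
        then have "2 ^ k * 2 dvd 2 ^ k * (c + x + 2 ^ (j + 1))" by (intro mult_dvd_mono) auto
        then show ?thesis by (simp add: mult.commute)
      qed
      finally have "2 ^ Suc k dvd (x + 2 ^ (k - 1))\<^sup>2 - n" .
      moreover have "odd (x + 2 ^ (k - 1))" using x j by simp
      ultimately show ?thesis by blast
    qed
  qed
  then show ?thesis by blast
qed

text \<open>The pairs with a common divisor \<open>g\<close> have density \<open>1/g\<^sup>2\<close>. Only divisors of the odd number \<open>m\<close> occur,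
so \<open>g \<ge> 3\<close>, and the series of \<open>1/g\<^sup>2\<close> from there on is at most one half by telescoping. It is here
that the final constant becomes independent of \<open>m\<close>.\<close>

lemma card_coprime_pairs_ge:
  assumes m: "odd (m::nat)"
  shows "real m ^ 2 / 2 \<le> real (card {(s, u). s \<in> {0..<int m} \<and> u \<in> {0..<int m} \<and> gcd (gcd s u) (int m) = 1})"
proof -
  define G where "G = {(s, u). s \<in> {0..<int m} \<and> u \<in> {0..<int m} \<and> gcd (gcd s u) (int m) = 1}"
  define D where "D g = {s \<in> {0..<int m}. int g dvd s}" for g :: nat
  have m0: "m > 0" using m by (cases m) auto
  have cD: "real (card (D g)) = real m / real g" if g: "g dvd m" "g > 0" for g
  proof -
    obtain h where h: "m = g * h" using g by blast
    have "D g = (\<lambda>j. int g * j) ` {0..<int h}"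
    proof (intro equalityI subsetI)
      fix x assume "x \<in> D g"
      then obtain y where y: "x = int g * y" and x: "0 \<le> x" "x < int g * int h" by (auto simp: D_def h)
      have "0 \<le> y" "y < int h" using x g(2) by (auto simp: y zero_le_mult_iff)
      then show "x \<in> (\<lambda>j. int g * j) ` {0..<int h}" using y by auto
    qed (use g(2) in \<open>auto simp: D_def h\<close>)
    then have "card (D g) = h"
      using g(2) by (simp add: card_image inj_on_def)
    then show ?thesis using g by (simp add: h)
  qed
  have finD: "finite (D g)" for g
    by (rule finite_subset[of _ "{0..<int m}"]) (auto simp: D_def)
  define S where "S = {g. g dvd m \<and> g \<ge> 3}"
  have finS: "finite S" using m0 by (auto simp: S_def)
  have sub: "{0..<int m} \<times> {0..<int m} - G \<subseteq> (\<Union>g\<in>S. D g \<times> D g)"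
  proof clarify
    fix s u assume su: "s \<in> {0..<int m}" "u \<in> {0..<int m}" "(s, u) \<notin> G"
    define g where "g = nat (gcd (gcd s u) (int m))"
    have gi: "int g = gcd (gcd s u) (int m)" by (simp add: g_def)
    have "int g dvd int m" unfolding gi by simp
    then have gm: "g dvd m" by simp
    have "g \<noteq> 1" using su gi by (auto simp: G_def)
    moreover have "g \<noteq> 2" using gm m by auto
    moreover have "g \<noteq> 0" using gm m0 by auto
    ultimately have "g \<in> S" using gm by (auto simp: S_def)
    moreover have "int g dvd s" "int g dvd u" unfolding gi by (auto intro: dvd_trans[OF gcd_dvd1])
    ultimately show "(s, u) \<in> (\<Union>g\<in>S. D g \<times> D g)" using su by (auto simp: D_def)
  qed
  have tele: "(\<Sum>g\<in>{3..n}. 1 / real g ^ 2) \<le> 1 / 2 - 1 / real n" if "n \<ge> 2" for n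
    using that
  proof (induction n rule: dec_induct)
    case (step n)
    have "1 / real (Suc n) ^ 2 \<le> 1 / (real n * real (Suc n))"
      using step.hyps by (intro divide_left_mono) (auto simp: power2_eq_square)
    also have "\<dots> = 1 / real n - 1 / real (Suc n)" using step.hyps by (simp add: field_simps)
    finally show ?case using step by simp
  qed simp
  have finG: "finite G" by (rule finite_subset[of _ "{0..<int m} \<times> {0..<int m}"]) (auto simp: G_def)
  have "real (card ({0..<int m} \<times> {0..<int m} - G)) \<le> real (card (\<Union>g\<in>S. D g \<times> D g))"
    using finS finD by (intro of_nat_mono card_mono sub) auto
  also have "\<dots> \<le> real (\<Sum>g\<in>S. card (D g \<times> D g))"
    by (intro of_nat_mono card_UN_le finS)
  also have "\<dots> = (\<Sum>g\<in>S. real m ^ 2 * (1 / real g ^ 2))"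
    unfolding of_nat_sum by (intro sum.cong refl) (simp add: card_cartesian_product cD S_def power2_eq_square)
  also have "\<dots> \<le> (\<Sum>g\<in>{3..m + 2}. real m ^ 2 * (1 / real g ^ 2))"
    using m0 by (intro sum_mono2) (auto simp: S_def dest: dvd_imp_le)
  also have "\<dots> = real m ^ 2 * (\<Sum>g\<in>{3..m + 2}. 1 / real g ^ 2)" by (rule sum_distrib_left[symmetric])
  also have "\<dots> \<le> real m ^ 2 * (1 / 2)"
  proof (rule mult_left_mono)
    have "0 \<le> 1 / real (m + 2)" by simp
    then show "(\<Sum>g\<in>{3..m + 2}. 1 / real g ^ 2) \<le> 1 / 2" using tele[of "m + 2"] by linarith
  qed simp
  finally have "real (card ({0..<int m} \<times> {0..<int m} - G)) \<le> real m ^ 2 / 2" by simp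
  moreover have "card ({0..<int m} \<times> {0..<int m} - G) = m * m - card G"
    using finG by (subst card_Diff_subset) (auto simp: G_def card_cartesian_product)
  moreover have "card G \<le> m * m"
  proof -
    have "G \<subseteq> {0..<int m} \<times> {0..<int m}" by (auto simp: G_def)
    then have "card G \<le> card ({0..<int m} \<times> {0..<int m})" by (intro card_mono) auto
    then show ?thesis by (simp add: card_cartesian_product)
  qed
  ultimately show ?thesis unfolding G_def[symmetric] by (simp add: power2_eq_square of_nat_diff)
qed

text \<open>One solution comes from Bezout's identity; adding multiples of \<open>(u, -s)\<close> gives \<open>m\<close> different ones.\<close>

lemma card_linear_form_solutions:
  fixes s u n :: int and m :: nat
  assumes m: "m > 0" and g: "gcd (gcd s u) (int m) = 1"
  shows "m \<le> card {(t, v). t \<in> {0..<int m} \<and> v \<in> {0..<int m} \<and> int m dvd n - (s * t + u * v)}" (is "_ \<le> card ?S")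
proof -
  obtain x y where xy: "x * s + y * u = gcd s u" using bezout_int by blast
  have cop: "coprime (gcd s u) (int m)" using g by (simp add: coprime_iff_gcd_eq_1)
  then obtain k where "int m dvd gcd s u * k + (- n)" using solve_linear_dvd by blast
  then have k: "int m dvd n - gcd s u * k" by (simp add: dvd_diff_commute)
  define f where "f j = ((x * k + u * j) mod int m, (y * k - s * j) mod int m)" for j :: int
  have inj: "inj_on f {0..<int m}"
  proof (rule inj_onI)
    fix i j assume ij: "i \<in> {0..<int m}" "j \<in> {0..<int m}" "f i = f j"
    then have "int m dvd (x * k + u * i) - (x * k + u * j)" "int m dvd (y * k - s * i) - (y * k - s * j)"
      by (simp_all add: f_def mod_eq_dvd_iff)
    then have "int m dvd u * (i - j)" "int m dvd - (s * (i - j))" by (simp_all add: algebra_simps)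
    then have "int m dvd u * (i - j)" "int m dvd s * (i - j)" by (simp_all only: dvd_minus_iff)
    then have "int m dvd x * (s * (i - j)) + y * (u * (i - j))" by simp
    also have "x * (s * (i - j)) + y * (u * (i - j)) = (x * s + y * u) * (i - j)" by (simp add: algebra_simps)
    finally have "int m dvd gcd s u * (i - j)" unfolding xy .
    then have "int m dvd i - j" using cop by (simp add: coprime_dvd_mult_right_iff coprime_commute)
    moreover have "\<bar>i - j\<bar> < int m" using ij by auto
    ultimately show "i = j" using dvd_imp_le_int[of "i - j" "int m"] by auto
  qed
  have "f ` {0..<int m} \<subseteq> ?S"
  proof
    fix p assume "p \<in> f ` {0..<int m}"
    then obtain j where p: "p = f j" by auto
    have "[s * ((x * k + u * j) mod int m) + u * ((y * k - s * j) mod int m) = s * (x * k + u * j) + u * (y * k - s * j)] (mod int m)"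
      by (intro cong_add cong_mult cong_refl) (auto simp: cong_def)
    then have "int m dvd (n - (s * ((x * k + u * j) mod int m) + u * ((y * k - s * j) mod int m))) \<longleftrightarrow>
        int m dvd n - (s * (x * k + u * j) + u * (y * k - s * j))"
      by (intro cong_dvd_iff cong_diff cong_refl)
    also have "s * (x * k + u * j) + u * (y * k - s * j) = (x * s + y * u) * k" by (simp add: algebra_simps)
    finally show "p \<in> ?S" using k m unfolding xy p by (simp add: f_def)
  qed
  moreover have "finite ?S" by (rule finite_subset[of _ "{0..<int m} \<times> {0..<int m}"]) auto
  ultimately have "card (f ` {0..<int m}) \<le> card ?S" by (intro card_mono)
  then show ?thesis using inj by (simp add: card_image)
qed

definition four_squares_mod :: "int \<Rightarrow> nat \<Rightarrow> (int \<times> int \<times> int \<times> int) set" where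
  "four_squares_mod n m = {(x, y, z, w). x \<in> {0..<int m} \<and> y \<in> {0..<int m} \<and> z \<in> {0..<int m} \<and> w \<in> {0..<int m}
     \<and> int m dvd n - (x\<^sup>2 + y\<^sup>2 + z\<^sup>2 + w\<^sup>2)}"

definition five_squares_mod :: "int \<Rightarrow> nat \<Rightarrow> (int \<times> int \<times> int \<times> int \<times> int) set" where
  "five_squares_mod n m = {(x, y). x \<in> {0..<int m} \<and> y \<in> four_squares_mod (n - x\<^sup>2) m}"

lemma finite_four_squares_mod: "finite (four_squares_mod n m)"
  by (rule finite_subset[of _ "{0..<int m} \<times> {0..<int m} \<times> {0..<int m} \<times> {0..<int m}"]) (auto simp: four_squares_mod_def)

lemma finite_five_squares_mod: "finite (five_squares_mod n m)"
  by (rule finite_subset[of _ "{0..<int m} \<times> {0..<int m} \<times> {0..<int m} \<times> {0..<int m} \<times> {0..<int m}"])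
     (auto simp: five_squares_mod_def four_squares_mod_def)

text \<open>If \<open>a\<^sup>2 + b\<^sup>2 \<equiv> - 1\<close>, then \<open>(z, w) \<mapsto> (a z + b w, b z - a w)\<close> changes the sign of \<open>z\<^sup>2 + w\<^sup>2\<close>, so the
sum of four squares becomes \<open>x\<^sup>2 - z'\<^sup>2 + y\<^sup>2 - w'\<^sup>2\<close>, a product form \<open>s t + u v\<close> in
\<open>s = x - z'\<close>, \<open>t = x + z'\<close>, \<open>u = y - w'\<close>, \<open>v = y + w'\<close>. For fixed \<open>s\<close>, \<open>u\<close> without a common factor with \<open>m\<close> it is a linear congruence in \<open>(t, v)\<close>. The change of variables
is inverted with \<open>h\<close>, the inverse of 2, and works at once for all odd \<open>m\<close>, without factorisation.\<close>

lemma card_four_squares_mod_odd: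
  assumes m: "odd (m::nat)"
  shows "real m ^ 3 / 2 \<le> real (card (four_squares_mod n m))"
proof -
  have m0: "m > 0" using m by (cases m) auto
  define G where "G = {(s, u). s \<in> {0..<int m} \<and> u \<in> {0..<int m} \<and> gcd (gcd s u) (int m) = 1}"
  define L where "L p = {(t, v). t \<in> {0..<int m} \<and> v \<in> {0..<int m} \<and> int m dvd n - (fst p * t + snd p * v)}" for p
  have finG: "finite G" by (rule finite_subset[of _ "{0..<int m} \<times> {0..<int m}"]) (auto simp: G_def)
  have finL: "finite (L p)" for p by (rule finite_subset[of _ "{0..<int m} \<times> {0..<int m}"]) (auto simp: L_def)
  obtain a b :: int where ab: "int m dvd a\<^sup>2 + b\<^sup>2 + 1" using odd_two_squares_plus_one[OF m] by blast
  have "coprime (2::int) (int m)" using m by (simp add: coprime_left_2_iff_odd)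
  then obtain h where h0: "int m dvd 2 * h + (- 1)" using solve_linear_dvd by blast
  then have h: "int m dvd 2 * h - 1" by simp
  define zp where "zp s t = h * (t - s)" for s t :: int
  define f where "f = (\<lambda>((s, u), (t, v)). ((h * (s + t)) mod int m, (h * (u + v)) mod int m,
     (- (a * zp s t + b * zp u v)) mod int m, (- (b * zp s t - a * zp u v)) mod int m))"
  have hcancel: "int m dvd x" if "int m dvd 2 * h * x" for x
  proof -
    have "int m dvd 2 * h * x - (2 * h - 1) * x" using that h by (intro dvd_diff) auto
    then show ?thesis by (simp add: algebra_simps)
  qed
  have inj: "inj_on f (SIGMA p:G. L p)"
  proof (rule inj_onI)
    fix p1 p2 assume p: "p1 \<in> (SIGMA p:G. L p)" "p2 \<in> (SIGMA p:G. L p)" "f p1 = f p2"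
    obtain s u t v where p1: "p1 = ((s, u), (t, v))" by (metis surj_pair)
    obtain s' u' t' v' where p2: "p2 = ((s', u'), (t', v'))" by (metis surj_pair)
    define Z W where "Z = zp s t - zp s' t'" and "W = zp u v - zp u' v'"
    have e: "int m dvd h * (s + t) - h * (s' + t')" "int m dvd h * (u + v) - h * (u' + v')"
       "int m dvd (- (a * zp s t + b * zp u v)) - (- (a * zp s' t' + b * zp u' v'))"
       "int m dvd (- (b * zp s t - a * zp u v)) - (- (b * zp s' t' - a * zp u' v'))"
      using p(3) by (simp_all add: f_def p1 p2 mod_eq_dvd_iff)
    have "int m dvd - (a * Z + b * W)" using e(3) by (simp add: Z_def W_def algebra_simps)
    then have 1: "int m dvd a * Z + b * W" by (simp only: dvd_minus_iff)
    have "int m dvd - (b * Z - a * W)" using e(4) by (simp add: Z_def W_def algebra_simps)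
    then have 2: "int m dvd b * Z - a * W" by (simp only: dvd_minus_iff)
    have "int m dvd (a\<^sup>2 + b\<^sup>2 + 1) * Z - (a * (a * Z + b * W) + b * (b * Z - a * W))"
      by (simp only: ab 1 2 dvd_diff dvd_add dvd_mult dvd_mult2)
    also have "\<dots> = Z" by (simp add: power2_eq_square algebra_simps)
    finally have Z: "int m dvd Z" .
    have "int m dvd (a\<^sup>2 + b\<^sup>2 + 1) * W - (b * (a * Z + b * W) - a * (b * Z - a * W))"
      by (simp only: ab 1 2 dvd_diff dvd_mult dvd_mult2)
    also have "\<dots> = W" by (simp add: power2_eq_square algebra_simps)
    finally have W: "int m dvd W" .
    have "int m dvd (h * (s + t) - h * (s' + t')) + Z" using e(1) Z by (rule dvd_add)
    also have "\<dots> = 2 * h * (t - t')" by (simp add: Z_def zp_def algebra_simps)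
    finally have t: "int m dvd t - t'" by (rule hcancel)
    have "int m dvd (h * (s + t) - h * (s' + t')) - Z" using e(1) Z by (rule dvd_diff)
    also have "\<dots> = 2 * h * (s - s')" by (simp add: Z_def zp_def algebra_simps)
    finally have s: "int m dvd s - s'" by (rule hcancel)
    have "int m dvd (h * (u + v) - h * (u' + v')) + W" using e(2) W by (rule dvd_add)
    also have "\<dots> = 2 * h * (v - v')" by (simp add: W_def zp_def algebra_simps)
    finally have v: "int m dvd v - v'" by (rule hcancel)
    have "int m dvd (h * (u + v) - h * (u' + v')) - W" using e(2) W by (rule dvd_diff)
    also have "\<dots> = 2 * h * (u - u')" by (simp add: W_def zp_def algebra_simps)
    finally have u: "int m dvd u - u'" by (rule hcancel)
    have eq: "x = y" if "int m dvd x - y" "x \<in> {0..<int m}" "y \<in> {0..<int m}" for x y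
    proof -
      have "\<bar>x - y\<bar> < int m" using that by auto
      then show ?thesis using that(1) dvd_imp_le_int[of "x - y" "int m"] by auto
    qed
    have "s = s'" "u = u'" "t = t'" "v = v'"
      using p(1,2) s t u v by (auto simp: p1 p2 G_def L_def intro: eq)
    then show "p1 = p2" by (simp add: p1 p2)
  qed
  have sub: "f ` (SIGMA p:G. L p) \<subseteq> four_squares_mod n m"
  proof
    fix q assume "q \<in> f ` (SIGMA p:G. L p)"
    then obtain s u t v where q: "q = f ((s, u), (t, v))" and L: "int m dvd n - (s * t + u * v)" by (auto simp: L_def)
    define x y z w where "x = h * (s + t)" and "y = h * (u + v)" and "z = - (a * zp s t + b * zp u v)"
      and "w = - (b * zp s t - a * zp u v)"
    have "int m dvd (n - (s * t + u * v)) - (a\<^sup>2 + b\<^sup>2 + 1) * ((zp s t)\<^sup>2 + (zp u v)\<^sup>2) - (2 * h - 1) * ((2 * h + 1) * (s * t + u * v))"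
      by (simp only: ab h L dvd_diff dvd_mult dvd_mult2)
    also have "\<dots> = n - (x\<^sup>2 + y\<^sup>2 + z\<^sup>2 + w\<^sup>2)"
      by (simp add: x_def y_def z_def w_def zp_def power2_eq_square algebra_simps)
    finally have d: "int m dvd n - (x\<^sup>2 + y\<^sup>2 + z\<^sup>2 + w\<^sup>2)" .
    have "[n - ((x mod int m)\<^sup>2 + (y mod int m)\<^sup>2 + (z mod int m)\<^sup>2 + (w mod int m)\<^sup>2) = n - (x\<^sup>2 + y\<^sup>2 + z\<^sup>2 + w\<^sup>2)] (mod int m)"
      by (intro cong_diff cong_add cong_pow cong_refl) (auto simp: cong_def)
    then have "int m dvd n - ((x mod int m)\<^sup>2 + (y mod int m)\<^sup>2 + (z mod int m)\<^sup>2 + (w mod int m)\<^sup>2)"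
      using d by (simp add: cong_dvd_iff)
    then show "q \<in> four_squares_mod n m" using m0 by (simp add: q f_def four_squares_mod_def x_def y_def z_def w_def)
  qed
  have "real m ^ 3 / 2 = real m ^ 2 / 2 * real m" by (simp add: power_numeral_reduce)
  also have "\<dots> \<le> real (card G) * real m"
    using card_coprime_pairs_ge[OF m] by (intro mult_right_mono) (auto simp: G_def)
  also have "\<dots> = (\<Sum>p\<in>G. real m)" by simp
  also have "\<dots> \<le> (\<Sum>p\<in>G. real (card (L p)))"
  proof (intro sum_mono of_nat_mono)
    fix p assume "p \<in> G"
    then have "gcd (gcd (fst p) (snd p)) (int m) = 1" by (auto simp: G_def)
    then show "m \<le> card (L p)" unfolding L_def by (rule card_linear_form_solutions[OF m0])
  qed
  also have "\<dots> = real (card (SIGMA p:G. L p))" using finG finL by (simp add: card_SigmaI)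
  also have "\<dots> = real (card (f ` (SIGMA p:G. L p)))" using inj by (simp add: card_image)
  also have "\<dots> \<le> real (card (four_squares_mod n m))" by (intro of_nat_mono card_mono finite_four_squares_mod sub)
  finally show ?thesis .
qed

lemma card_five_squares_mod_odd:
  assumes m: "odd (m::nat)"
  shows "real m ^ 4 / 2 \<le> real (card (five_squares_mod n m))"
proof -
  have "real m ^ 4 / 2 = (\<Sum>x\<in>{0..<int m}. real m ^ 3 / 2)" by (simp add: power_numeral_reduce)
  also have "\<dots> \<le> (\<Sum>x\<in>{0..<int m}. real (card (four_squares_mod (n - x\<^sup>2) m)))" by (intro sum_mono card_four_squares_mod_odd m)
  also have "\<dots> = real (card (SIGMA x:{0..<int m}. four_squares_mod (n - x\<^sup>2) m))" by (simp add: card_SigmaI finite_four_squares_mod)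
  also have "(SIGMA x:{0..<int m}. four_squares_mod (n - x\<^sup>2) m) = five_squares_mod n m" by (auto simp: five_squares_mod_def)
  finally show ?thesis .
qed

lemma sum_four_squares_residue_eight: "\<exists>a\<in>{0..<8}. \<exists>b\<in>{0..<8}. \<exists>c\<in>{0..<8}. \<exists>d\<in>{0..<8}. 8 dvd (n::int) - (a\<^sup>2 + b\<^sup>2 + c\<^sup>2 + d\<^sup>2)"
proof -
  have w: "\<exists>a\<in>{0..<8}. \<exists>b\<in>{0..<8}. \<exists>c\<in>{0..<8}. \<exists>d\<in>{0..<8::int}. n mod 8 = a\<^sup>2 + b\<^sup>2 + c\<^sup>2 + d\<^sup>2"
  proof -
    have "n mod 8 \<in> {0, 1, 2, 3, 4, 5, 6, 7}" by auto
    moreover have "\<exists>a\<in>{0..<8}. \<exists>b\<in>{0..<8}. \<exists>c\<in>{0..<8}. \<exists>d\<in>{0..<8::int}. k = a\<^sup>2 + b\<^sup>2 + c\<^sup>2 + d\<^sup>2"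
      if "k = a\<^sup>2 + b\<^sup>2 + c\<^sup>2 + d\<^sup>2" "a \<in> {0..<8}" "b \<in> {0..<8}" "c \<in> {0..<8}" "d \<in> {0..<8}" for k a b c d :: int
      using that by blast
    note this[of _ 0 0 0 0] this[of _ 1 0 0 0] this[of _ 1 1 0 0] this[of _ 1 1 1 0]
      this[of _ 2 0 0 0] this[of _ 2 1 0 0] this[of _ 2 1 1 0] this[of _ 2 1 1 1]
    ultimately show ?thesis by fastforce
  qed
  moreover have "8 dvd n - n mod 8" by (rule dvd_minus_mod)
  ultimately show ?thesis by metis
qed

text \<open>Four coordinates are fixed modulo 8 so that the first one must have a square congruent to 1 modulo 8;
such a square root exists modulo every power of 2. The other digits of the four coordinates are free.\<close>

lemma card_five_squares_mod_power_of_two: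
  assumes k: "k \<ge> 3"
  shows "(2 ^ k / 8) ^ 4 \<le> real (card (five_squares_mod n (2 ^ k)))"
proof -
  define j where "j = k - 3"
  have K: "(2::nat) ^ k = 8 * 2 ^ j" using k power_add[of "2::nat" 3 "k - 3"] by (simp add: j_def)
  define m where "m = (2::nat) ^ k"
  have mj: "int m = 8 * 2 ^ j" by (simp add: m_def K)
  obtain a b c d where abcd: "a \<in> {0..<8}" "b \<in> {0..<8}" "c \<in> {0..<8}" "d \<in> {0..<8}"
     "8 dvd (n - 1) - (a\<^sup>2 + b\<^sup>2 + c\<^sup>2 + d\<^sup>2)" using sum_four_squares_residue_eight[of "n - 1"] by blast
  define T where "T = {0..<(2::int) ^ j}"
  define r where "r y z w v = n - ((a + 8 * y)\<^sup>2 + (b + 8 * z)\<^sup>2 + (c + 8 * w)\<^sup>2 + (d + 8 * v)\<^sup>2)" for y z w v :: int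
  define x0 where "x0 y z w v = (SOME x. int m dvd x\<^sup>2 - r y z w v)" for y z w v
  have x0: "int m dvd (x0 y z w v)\<^sup>2 - r y z w v" for y z w v
  proof -
    \<comment> \<open>Shifting the four coordinates by multiples of 8 does not affect the residue modulo 8.\<close>
    have "r y z w v - 1 = ((n - 1) - (a\<^sup>2 + b\<^sup>2 + c\<^sup>2 + d\<^sup>2))
      - 8 * (2 * (a * y + b * z + c * w + d * v) + 8 * (y\<^sup>2 + z\<^sup>2 + w\<^sup>2 + v\<^sup>2))"
      by (simp add: r_def power2_eq_square algebra_simps)
    then have "8 dvd r y z w v - 1" by (simp only: dvd_diff[OF abcd(5) dvd_triv_left])
    then have "\<exists>x. int m dvd x\<^sup>2 - r y z w v" using square_root_mod_power_of_two[of "r y z w v" k] by (simp add: m_def)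
    then show ?thesis unfolding x0_def by (rule someI_ex)
  qed
  define f where "f = (\<lambda>(y, z, w, v). (x0 y z w v mod int m, a + 8 * y, b + 8 * z, c + 8 * w, d + 8 * v))"
  have "inj_on f (T \<times> T \<times> T \<times> T)" by (auto simp: inj_on_def f_def)
  then have "card (f ` (T \<times> T \<times> T \<times> T)) = (2 ^ j) ^ 4"
    by (simp add: card_image card_cartesian_product T_def power_numeral_reduce nat_power_eq)
  moreover have "f ` (T \<times> T \<times> T \<times> T) \<subseteq> five_squares_mod n m"
  proof
    fix q assume "q \<in> f ` (T \<times> T \<times> T \<times> T)"
    then obtain y z w v where T: "y \<in> T" "z \<in> T" "w \<in> T" "v \<in> T" and q: "q = f (y, z, w, v)" by blast
    have rng: "e + 8 * t \<in> {0..<int m}" if "e \<in> {0..<8}" "t \<in> T" for e t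
      using that by (auto simp: T_def mj)
    have "[n - (x0 y z w v mod int m)\<^sup>2 - ((a + 8 * y)\<^sup>2 + (b + 8 * z)\<^sup>2 + (c + 8 * w)\<^sup>2 + (d + 8 * v)\<^sup>2)
      = n - (x0 y z w v)\<^sup>2 - ((a + 8 * y)\<^sup>2 + (b + 8 * z)\<^sup>2 + (c + 8 * w)\<^sup>2 + (d + 8 * v)\<^sup>2)] (mod int m)"
      by (intro cong_diff cong_pow cong_refl) (auto simp: cong_def)
    moreover have "n - (x0 y z w v)\<^sup>2 - ((a + 8 * y)\<^sup>2 + (b + 8 * z)\<^sup>2 + (c + 8 * w)\<^sup>2 + (d + 8 * v)\<^sup>2) = - ((x0 y z w v)\<^sup>2 - r y z w v)"
      by (simp add: r_def)
    ultimately have "int m dvd n - (x0 y z w v mod int m)\<^sup>2 - ((a + 8 * y)\<^sup>2 + (b + 8 * z)\<^sup>2 + (c + 8 * w)\<^sup>2 + (d + 8 * v)\<^sup>2)"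
      using x0[of y z w v] by (simp only: cong_dvd_iff dvd_minus_iff)
    then show "q \<in> five_squares_mod n m"
      using rng T abcd unfolding q by (simp add: f_def five_squares_mod_def four_squares_mod_def m_def)
  qed
  ultimately have "(2 ^ j) ^ 4 \<le> card (five_squares_mod n m)" using card_mono[OF finite_five_squares_mod, of "f ` (T \<times> T \<times> T \<times> T)" n m] by simp
  then have "real ((2 ^ j) ^ 4) \<le> real (card (five_squares_mod n m))" by (rule of_nat_mono)
  moreover have "(2::real) ^ k / 8 = 2 ^ j" using arg_cong[OF K, of real] by simp
  ultimately show ?thesis by (simp add: m_def)
qed

lemma card_five_squares_mod_mult:
  assumes cop: "coprime a b" and pos: "a > 0" "b > 0"
  shows "card (five_squares_mod n a) * card (five_squares_mod n b) \<le> card (five_squares_mod n (a * b))"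
proof -
  define crt where "crt x y = (SOME z. z \<in> {0..<int (a * b)} \<and> [z = x] (mod int a) \<and> [z = y] (mod int b))" for x y
  have crt: "crt x y \<in> {0..<int (a * b)} \<and> [crt x y = x] (mod int a) \<and> [crt x y = y] (mod int b)" for x y
  proof -
    have "coprime (int a) (int b)" using cop by simp
    from binary_chinese_remainder_int[OF this, of x y] obtain z where z: "[z = x] (mod int a)" "[z = y] (mod int b)" by blast
    have zm: "[z mod int (a * b) = z] (mod int a)" "[z mod int (a * b) = z] (mod int b)"
      unfolding cong_def by (rule mod_mod_cancel, simp)+
    have "[z mod int (a * b) = x] (mod int a)" "[z mod int (a * b) = y] (mod int b)"
      by (rule cong_trans[OF zm(1) z(1)], rule cong_trans[OF zm(2) z(2)])
    moreover have "z mod int (a * b) \<in> {0..<int (a * b)}" using pos by simp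
    ultimately have "z mod int (a * b) \<in> {0..<int (a * b)} \<and> [z mod int (a * b) = x] (mod int a) \<and> [z mod int (a * b) = y] (mod int b)"
      by (intro conjI)
    then show ?thesis unfolding crt_def by (rule someI)
  qed
  define f where "f = (\<lambda>((x0, x1, x2, x3, x4), (y0, y1, y2, y3, y4)). (crt x0 y0, crt x1 y1, crt x2 y2, crt x3 y3, crt x4 y4))"
  have eq: "x = x'" if "[x = x'] (mod int m)" "0 \<le> x" "x < int m" "0 \<le> x'" "x' < int m" for x x' m
    using that by (simp add: cong_def)
  have crt_inj: "x = x' \<and> y = y'" if "crt x y = crt x' y'" "x \<in> {0..<int a}" "x' \<in> {0..<int a}" "y \<in> {0..<int b}" "y' \<in> {0..<int b}" for x x' y y'
  proof -
    have c: "[crt x y = x] (mod int a)" "[crt x y = x'] (mod int a)" "[crt x y = y] (mod int b)" "[crt x y = y'] (mod int b)"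
      using crt[of x y] crt[of x' y'] unfolding that(1) by blast+
    have "[x = x'] (mod int a)" by (rule cong_trans[OF cong_sym[OF c(1)] c(2)])
    then have "x = x'" using that by (intro eq[of x x' a]) auto
    have "[y = y'] (mod int b)" by (rule cong_trans[OF cong_sym[OF c(3)] c(4)])
    then have "y = y'" using that by (intro eq[of y y' b]) auto
    with \<open>x = x'\<close> show ?thesis ..
  qed
  have "inj_on f (five_squares_mod n a \<times> five_squares_mod n b)"
  proof (rule inj_onI)
    fix p p' assume pp: "p \<in> five_squares_mod n a \<times> five_squares_mod n b" "p' \<in> five_squares_mod n a \<times> five_squares_mod n b" "f p = f p'"
    obtain x0 x1 x2 x3 x4 where x: "fst p = (x0, x1, x2, x3, x4)" by (rule prod_cases5)
    obtain y0 y1 y2 y3 y4 where y: "snd p = (y0, y1, y2, y3, y4)" by (rule prod_cases5)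
    obtain u0 u1 u2 u3 u4 where u: "fst p' = (u0, u1, u2, u3, u4)" by (rule prod_cases5)
    obtain v0 v1 v2 v3 v4 where v: "snd p' = (v0, v1, v2, v3, v4)" by (rule prod_cases5)
    have p: "p = ((x0, x1, x2, x3, x4), (y0, y1, y2, y3, y4))" and p': "p' = ((u0, u1, u2, u3, u4), (v0, v1, v2, v3, v4))"
      using x y u v by (simp_all add: prod_eq_iff)
    have A: "(x0, x1, x2, x3, x4) \<in> five_squares_mod n a" "(y0, y1, y2, y3, y4) \<in> five_squares_mod n b"
      "(u0, u1, u2, u3, u4) \<in> five_squares_mod n a" "(v0, v1, v2, v3, v4) \<in> five_squares_mod n b"
      and e: "f ((x0, x1, x2, x3, x4), (y0, y1, y2, y3, y4)) = f ((u0, u1, u2, u3, u4), (v0, v1, v2, v3, v4))"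
      using pp unfolding p p' by simp_all
    have e': "crt x0 y0 = crt u0 v0" "crt x1 y1 = crt u1 v1" "crt x2 y2 = crt u2 v2"
      "crt x3 y3 = crt u3 v3" "crt x4 y4 = crt u4 v4" using e by (simp_all add: f_def)
    have ra: "x0 \<in> {0..<int a}" "x1 \<in> {0..<int a}" "x2 \<in> {0..<int a}" "x3 \<in> {0..<int a}" "x4 \<in> {0..<int a}"
      "u0 \<in> {0..<int a}" "u1 \<in> {0..<int a}" "u2 \<in> {0..<int a}" "u3 \<in> {0..<int a}" "u4 \<in> {0..<int a}"
      "y0 \<in> {0..<int b}" "y1 \<in> {0..<int b}" "y2 \<in> {0..<int b}" "y3 \<in> {0..<int b}" "y4 \<in> {0..<int b}"
      "v0 \<in> {0..<int b}" "v1 \<in> {0..<int b}" "v2 \<in> {0..<int b}" "v3 \<in> {0..<int b}" "v4 \<in> {0..<int b}"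
      using A by (simp_all add: five_squares_mod_def four_squares_mod_def)
    show "p = p'"
      unfolding p p' using crt_inj[OF e'(1)] crt_inj[OF e'(2)] crt_inj[OF e'(3)] crt_inj[OF e'(4)] crt_inj[OF e'(5)] ra by simp
  qed
  moreover have "f ` (five_squares_mod n a \<times> five_squares_mod n b) \<subseteq> five_squares_mod n (a * b)"
  proof
    fix q assume "q \<in> f ` (five_squares_mod n a \<times> five_squares_mod n b)"
    then obtain x0 x1 x2 x3 x4 y0 y1 y2 y3 y4 where q: "q = f ((x0, x1, x2, x3, x4), (y0, y1, y2, y3, y4))"
      and A: "(x0, x1, x2, x3, x4) \<in> five_squares_mod n a" "(y0, y1, y2, y3, y4) \<in> five_squares_mod n b" by fast
    have ca: "[n - (crt x0 y0)\<^sup>2 - ((crt x1 y1)\<^sup>2 + (crt x2 y2)\<^sup>2 + (crt x3 y3)\<^sup>2 + (crt x4 y4)\<^sup>2)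
        = n - x0\<^sup>2 - (x1\<^sup>2 + x2\<^sup>2 + x3\<^sup>2 + x4\<^sup>2)] (mod int a)"
      using crt by (intro cong_diff cong_add cong_pow cong_refl) blast+
    have cb: "[n - (crt x0 y0)\<^sup>2 - ((crt x1 y1)\<^sup>2 + (crt x2 y2)\<^sup>2 + (crt x3 y3)\<^sup>2 + (crt x4 y4)\<^sup>2)
        = n - y0\<^sup>2 - (y1\<^sup>2 + y2\<^sup>2 + y3\<^sup>2 + y4\<^sup>2)] (mod int b)"
      using crt by (intro cong_diff cong_add cong_pow cong_refl) blast+
    have "int a dvd n - (crt x0 y0)\<^sup>2 - ((crt x1 y1)\<^sup>2 + (crt x2 y2)\<^sup>2 + (crt x3 y3)\<^sup>2 + (crt x4 y4)\<^sup>2)"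
      using A(1) cong_dvd_iff[OF ca] by (simp add: five_squares_mod_def four_squares_mod_def)
    moreover have "int b dvd n - (crt x0 y0)\<^sup>2 - ((crt x1 y1)\<^sup>2 + (crt x2 y2)\<^sup>2 + (crt x3 y3)\<^sup>2 + (crt x4 y4)\<^sup>2)"
      using A(2) cong_dvd_iff[OF cb] by (simp add: five_squares_mod_def four_squares_mod_def)
    ultimately have "int a * int b dvd n - (crt x0 y0)\<^sup>2 - ((crt x1 y1)\<^sup>2 + (crt x2 y2)\<^sup>2 + (crt x3 y3)\<^sup>2 + (crt x4 y4)\<^sup>2)"
      using cop by (intro divides_mult) auto
    then show "q \<in> five_squares_mod n (a * b)"
      unfolding q using crt by (simp add: f_def five_squares_mod_def four_squares_mod_def)
  qed
  ultimately have "card (five_squares_mod n a \<times> five_squares_mod n b) \<le> card (five_squares_mod n (a * b))"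
    by (intro card_inj_on_le finite_five_squares_mod)
  then show ?thesis by (simp add: card_cartesian_product)
qed

text \<open>The constant is \<open>1/8192 = 1/(8\<^sup>4 \<cdot> 2)\<close>: a factor \<open>8\<^bsup>-4\<^esup>\<close> from the power of 2 and a factor one half from the odd part.\<close>

lemma card_five_squares_mod_ge:
  assumes M: "8 dvd M" "M > 0"
  shows "real M ^ 4 / 8192 \<le> real (card (five_squares_mod n M))"
proof -
  have "M \<noteq> 0" "\<not> is_unit (2::nat)" using M(2) by auto
  then obtain m where m: "M = 2 ^ multiplicity 2 M * m" "\<not> 2 dvd m" by (rule multiplicity_decompose')
  define k where "k = multiplicity 2 M"
  have km: "M = 2 ^ k * m" "odd m" using m by (simp_all add: k_def)
  have "k \<ge> 3"
  proof -
    have "coprime (2::nat) m" using km(2) by simp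
    then have "coprime ((2::nat) ^ 3) m" by (subst coprime_power_left_iff) simp
    moreover have "2 ^ 3 dvd 2 ^ k * m" using M(1) km by simp
    ultimately have "(2::nat) ^ 3 dvd 2 ^ k" using coprime_dvd_mult_left_iff by blast
    then show ?thesis by (rule power_dvd_imp_le) simp
  qed
  have cop: "coprime ((2::nat) ^ k) m" using km(2) by simp
  have m0: "m > 0" using km M(2) by (cases m) auto
  have "real M ^ 4 / 8192 = (2 ^ k / 8) ^ 4 * (real m ^ 4 / 2)"
    by (simp add: km(1) power_mult_distrib power_divide)
  also have "\<dots> \<le> real (card (five_squares_mod n (2 ^ k))) * real (card (five_squares_mod n m))"
    using card_five_squares_mod_power_of_two[OF \<open>k \<ge> 3\<close>] card_five_squares_mod_odd[OF km(2)] by (intro mult_mono) auto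
  also have "\<dots> \<le> real (card (five_squares_mod n M))"
    using card_five_squares_mod_mult[OF cop _ m0, of n] unfolding km(1) of_nat_mult[symmetric] by (intro of_nat_mono) simp
  finally show ?thesis .
qed

section \<open>Lattice points in shells and on spheres\<close>

definition five_squares_shell :: "int \<Rightarrow> nat \<Rightarrow> real \<Rightarrow> (int \<times> int \<times> int \<times> int \<times> int) set" where
  "five_squares_shell n M h = {(v, w, x, y, z). 0 \<le> n - (v\<^sup>2 + w\<^sup>2 + x\<^sup>2 + y\<^sup>2 + z\<^sup>2)
     \<and> of_int (n - (v\<^sup>2 + w\<^sup>2 + x\<^sup>2 + y\<^sup>2 + z\<^sup>2)) \<le> h \<and> int M dvd n - (v\<^sup>2 + w\<^sup>2 + x\<^sup>2 + y\<^sup>2 + z\<^sup>2)}"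

lemma finite_five_squares_shell: "finite (five_squares_shell n M h)"
proof (rule finite_subset)
  have *: "v \<in> {- \<bar>n\<bar>..\<bar>n\<bar>}" if "v\<^sup>2 \<le> n" for v :: int
  proof -
    have "\<bar>v\<bar> \<le> v\<^sup>2" using self_le_power[of "\<bar>v\<bar>" 2] by (cases "v = 0") auto
    then show ?thesis using that by auto
  qed
  show "five_squares_shell n M h \<subseteq> {- \<bar>n\<bar>..\<bar>n\<bar>} \<times> {- \<bar>n\<bar>..\<bar>n\<bar>} \<times> {- \<bar>n\<bar>..\<bar>n\<bar>} \<times> {- \<bar>n\<bar>..\<bar>n\<bar>} \<times> {- \<bar>n\<bar>..\<bar>n\<bar>}"
  proof
    fix p assume p: "p \<in> five_squares_shell n M h"
    obtain v w x y z where e: "p = (v, w, x, y, z)" by (rule prod_cases5)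
    have "v\<^sup>2 + w\<^sup>2 + x\<^sup>2 + y\<^sup>2 + z\<^sup>2 \<le> n" using p by (simp add: e five_squares_shell_def)
    moreover have "v\<^sup>2 \<ge> 0" "w\<^sup>2 \<ge> 0" "x\<^sup>2 \<ge> 0" "y\<^sup>2 \<ge> 0" "z\<^sup>2 \<ge> 0" by simp_all
    ultimately have "v\<^sup>2 \<le> n" "w\<^sup>2 \<le> n" "x\<^sup>2 \<le> n" "y\<^sup>2 \<le> n" "z\<^sup>2 \<le> n" by linarith+
    then show "p \<in> {- \<bar>n\<bar>..\<bar>n\<bar>} \<times> {- \<bar>n\<bar>..\<bar>n\<bar>} \<times> {- \<bar>n\<bar>..\<bar>n\<bar>} \<times> {- \<bar>n\<bar>..\<bar>n\<bar>} \<times> {- \<bar>n\<bar>..\<bar>n\<bar>}"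
      unfolding e using * by blast
  qed
qed auto

text \<open>The condition allows \<open>r + M t\<close> to range over an interval of length \<open>\<eta> s/2\<close> that ends at the square root of \<open>n\<close>.\<close>

lemma progression_in_shell:
  fixes n r :: int and \<eta> s x0 :: real
  assumes M: "M > 0" and \<eta>: "0 < \<eta>" "\<eta> \<le> 1" and s: "s > 0" "4 * real M \<le> \<eta> * s"
    and n: "s\<^sup>2 / 4 \<le> of_int n" "of_int n \<le> s\<^sup>2"
  shows "\<exists>W :: int set. finite W \<and> \<eta> * s / (4 * real M) \<le> real (card W) \<and>
    (\<forall>t\<in>W. (r + int M * t)\<^sup>2 \<le> n \<and> of_int (n - (r + int M * t)\<^sup>2) \<le> \<eta> * s\<^sup>2)"
proof -
  define u where "u = sqrt (of_int n)"
  have n0: "0 \<le> real_of_int n" using n(1) by (smt (verit) divide_nonneg_nonneg zero_le_power2)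
  have u2: "u\<^sup>2 = of_int n" using n0 by (simp add: u_def)
  have us: "u \<le> s" using n(2) s(1) unfolding u_def by (intro real_le_lsqrt) auto
  have "(s / 2)\<^sup>2 \<le> u\<^sup>2" using n(1) by (simp add: u2 power_divide)
  then have u: "s / 2 \<le> u" by (rule power2_le_imp_le) (use n0 in \<open>simp add: u_def\<close>)
  define W where "W = {\<lceil>(u - \<eta> * s / 2 - of_int r) / real M\<rceil>..\<lfloor>(u - of_int r) / real M\<rfloor>}"
  have "(u - of_int r) / real M - (u - \<eta> * s / 2 - of_int r) / real M = \<eta> * s / (2 * real M)"
    using M by (simp add: field_simps)
  moreover have "\<eta> * s / (2 * real M) - 1 \<ge> \<eta> * s / (4 * real M)" using s M by (simp add: field_simps)
  moreover have "real (card W) \<ge> (u - of_int r) / real M - (u - \<eta> * s / 2 - of_int r) / real M - 1"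
    unfolding W_def by (simp, linarith)
  ultimately have "\<eta> * s / (4 * real M) \<le> real (card W)" by linarith
  moreover have "(r + int M * t)\<^sup>2 \<le> n \<and> of_int (n - (r + int M * t)\<^sup>2) \<le> \<eta> * s\<^sup>2" if t: "t \<in> W" for t
  proof -
    define v where "v = real_of_int (r + int M * t)"
    have "(u - \<eta> * s / 2 - of_int r) / real M \<le> of_int t" "of_int t \<le> (u - of_int r) / real M"
      using t by (auto simp: W_def ceiling_le_iff le_floor_iff)
    then have v: "u - \<eta> * s / 2 \<le> v" "v \<le> u" using M by (simp_all add: v_def field_simps)
    have "\<eta> * s \<le> s" using \<eta> s by simp
    then have v0: "0 \<le> u - \<eta> * s / 2" using u by linarith
    have "v\<^sup>2 \<le> u\<^sup>2" using v v0 by (intro power_mono) auto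
    moreover have "u\<^sup>2 - v\<^sup>2 \<le> \<eta> * s\<^sup>2"
    proof -
      have "(u - \<eta> * s / 2)\<^sup>2 \<le> v\<^sup>2" using v v0 by (intro power_mono) auto
      then have "u\<^sup>2 - v\<^sup>2 \<le> \<eta> * s * u - (\<eta> * s / 2)\<^sup>2" by (simp add: power2_eq_square algebra_simps)
      also have "\<dots> \<le> \<eta> * s * u" by simp
      also have "\<dots> \<le> \<eta> * s * s" using us \<eta> s by (intro mult_left_mono) auto
      finally show ?thesis by (simp add: power2_eq_square mult.assoc)
    qed
    moreover have "v\<^sup>2 = of_int ((r + int M * t)\<^sup>2)" by (simp add: v_def)
    ultimately show ?thesis unfolding u2 by (simp only: of_int_le_iff of_int_diff)
  qed
  moreover have "finite W" by (simp add: W_def)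
  ultimately show ?thesis by blast
qed

text \<open>Write each coordinate as a residue plus a multiple of \<open>M\<close>. For every solution of the congruence the multiples
in four coordinates may be chosen freely as long as these stay below \<open>D\<close>, and the first coordinate then lies in a
progression meeting the shell in many points.\<close>

lemma card_five_squares_shell_ge:
  fixes n :: int and \<eta> s D :: real
  assumes M: "8 dvd M" "M > 0" and \<eta>: "0 < \<eta>" "\<eta> \<le> 1" and s: "s > 0" "4 * real M \<le> \<eta> * s"
    and n: "s\<^sup>2 / 2 \<le> of_int n" "of_int n \<le> s\<^sup>2" and D: "2 * real M \<le> D" "16 * D\<^sup>2 \<le> s\<^sup>2"
  shows "D ^ 4 * \<eta> * s / (524288 * real M) \<le> real (card (five_squares_shell n M (\<eta> * s\<^sup>2)))"
proof -
  define b where "b = nat \<lfloor>D / real M\<rfloor>"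
  have DM: "D / real M \<ge> 2" using D M by (simp add: field_simps)
  have b: "D / (2 * real M) \<le> real b" "real b \<le> D / real M" using DM by (simp_all add: b_def) linarith+
  define T where "T = {0..<int b}"
  define rem where "rem x t = (case (x, t) of ((x0, x1, x2, x3, x4), (t1, t2, t3, t4)) \<Rightarrow>
     n - ((x1 + int M * t1)\<^sup>2 + (x2 + int M * t2)\<^sup>2 + (x3 + int M * t3)\<^sup>2 + (x4 + int M * t4)\<^sup>2))" 
    for x :: "int \<times> int \<times> int \<times> int \<times> int" and t :: "int \<times> int \<times> int \<times> int"
  have small: "0 \<le> real_of_int ((x + int M * t)\<^sup>2) \<and> of_int ((x + int M * t)\<^sup>2) \<le> D\<^sup>2" if "x \<in> {0..<int M}" "t \<in> T" for x t
  proof -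
    have "x + int M * t \<le> int M * (t + 1)" using that by (simp add: algebra_simps)
    also have "\<dots> \<le> int M * int b" using that by (intro mult_left_mono) (auto simp: T_def)
    finally have "real_of_int (x + int M * t) \<le> real_of_int (int M * int b)" by (simp only: of_int_le_iff)
    also have "\<dots> = real M * real b" by simp
    also have "\<dots> \<le> D" using b(2) M by (simp add: field_simps)
    finally have "real_of_int (x + int M * t) \<le> D" .
    moreover have "0 \<le> real_of_int (x + int M * t)" using that by (auto simp: T_def)
    ultimately have "(real_of_int (x + int M * t))\<^sup>2 \<le> D\<^sup>2" by (intro power_mono)
    then show ?thesis by simp
  qed
  define Y where "Y = five_squares_mod n M \<times> (T \<times> T \<times> T \<times> T)"
  have rem: "s\<^sup>2 / 4 \<le> of_int (rem x t) \<and> of_int (rem x t) \<le> s\<^sup>2" if "(x, t) \<in> Y" for x t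
  proof -
    obtain x0 x1 x2 x3 x4 where x: "x = (x0, x1, x2, x3, x4)" by (rule prod_cases5)
    obtain t1 t2 t3 t4 where t: "t = (t1, t2, t3, t4)" by (rule prod_cases4)
    have xt: "x1 \<in> {0..<int M}" "x2 \<in> {0..<int M}" "x3 \<in> {0..<int M}" "x4 \<in> {0..<int M}"
      "t1 \<in> T" "t2 \<in> T" "t3 \<in> T" "t4 \<in> T" using that by (auto simp: x t Y_def five_squares_mod_def four_squares_mod_def)
    have "real_of_int (rem x t) = of_int n - (of_int ((x1 + int M * t1)\<^sup>2) + of_int ((x2 + int M * t2)\<^sup>2)
        + of_int ((x3 + int M * t3)\<^sup>2) + of_int ((x4 + int M * t4)\<^sup>2))"
      by (simp add: x t rem_def)
    then show ?thesis
      using small[OF xt(1) xt(5)] small[OF xt(2) xt(6)] small[OF xt(3) xt(7)] small[OF xt(4) xt(8)] n D(2)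
      by linarith
  qed
  have "\<forall>p. \<exists>W. p \<in> Y \<longrightarrow> finite W \<and> \<eta> * s / (4 * real M) \<le> real (card W) \<and>
    (\<forall>t0\<in>W. (fst (fst p) + int M * t0)\<^sup>2 \<le> rem (fst p) (snd p) \<and> of_int (rem (fst p) (snd p) - (fst (fst p) + int M * t0)\<^sup>2) \<le> \<eta> * s\<^sup>2)"
  proof
    fix p show "\<exists>W. p \<in> Y \<longrightarrow> finite W \<and> \<eta> * s / (4 * real M) \<le> real (card W) \<and>
    (\<forall>t0\<in>W. (fst (fst p) + int M * t0)\<^sup>2 \<le> rem (fst p) (snd p) \<and> of_int (rem (fst p) (snd p) - (fst (fst p) + int M * t0)\<^sup>2) \<le> \<eta> * s\<^sup>2)"
    proof (cases "p \<in> Y")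
      case True
      then have "s\<^sup>2 / 4 \<le> of_int (rem (fst p) (snd p))" "of_int (rem (fst p) (snd p)) \<le> s\<^sup>2"
        using rem[of "fst p" "snd p"] by simp_all
      from progression_in_shell[OF M(2) \<eta> s this, of "fst (fst p)"] show ?thesis by blast
    qed blast
  qed
  then obtain W where W: "\<forall>p. p \<in> Y \<longrightarrow> finite (W p) \<and> \<eta> * s / (4 * real M) \<le> real (card (W p)) \<and>
    (\<forall>t0\<in>W p. (fst (fst p) + int M * t0)\<^sup>2 \<le> rem (fst p) (snd p) \<and> of_int (rem (fst p) (snd p) - (fst (fst p) + int M * t0)\<^sup>2) \<le> \<eta> * s\<^sup>2)"
    by (rule choice[THEN exE])
  define f where "f = (\<lambda>(((x0, x1, x2, x3, x4), (t1, t2, t3, t4)), t0).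
    (x0 + int M * t0, x1 + int M * t1, x2 + int M * t2, x3 + int M * t3, x4 + int M * t4))"
  have dm: "x = x' \<and> t = t'" if "x + int M * t = x' + int M * t'" "x \<in> {0..<int M}" "x' \<in> {0..<int M}" for x x' t t'
  proof -
    have "(x + int M * t) mod int M = (x' + int M * t') mod int M" by (simp only: that(1))
    then have "x = x'" using that(2,3) by simp
    then show ?thesis using that(1) M by simp
  qed
  have inj: "inj_on f (SIGMA p:Y. W p)"
  proof (rule inj_onI)
    fix p p' assume pp: "p \<in> (SIGMA p:Y. W p)" "p' \<in> (SIGMA p:Y. W p)" "f p = f p'"
    obtain x0 x1 x2 x3 x4 where x: "fst (fst p) = (x0, x1, x2, x3, x4)" by (rule prod_cases5)
    obtain t1 t2 t3 t4 where t: "snd (fst p) = (t1, t2, t3, t4)" by (rule prod_cases4)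
    obtain u0 u1 u2 u3 u4 where u: "fst (fst p') = (u0, u1, u2, u3, u4)" by (rule prod_cases5)
    obtain v1 v2 v3 v4 where v: "snd (fst p') = (v1, v2, v3, v4)" by (rule prod_cases4)
    obtain t0 v0 where t0: "t0 = snd p" "v0 = snd p'" by blast
    have p: "p = (((x0, x1, x2, x3, x4), (t1, t2, t3, t4)), t0)" and p': "p' = (((u0, u1, u2, u3, u4), (v1, v2, v3, v4)), v0)"
      using x t u v t0 by (simp_all add: prod_eq_iff)
    have r: "x0 \<in> {0..<int M}" "x1 \<in> {0..<int M}" "x2 \<in> {0..<int M}" "x3 \<in> {0..<int M}" "x4 \<in> {0..<int M}"
      "u0 \<in> {0..<int M}" "u1 \<in> {0..<int M}" "u2 \<in> {0..<int M}" "u3 \<in> {0..<int M}" "u4 \<in> {0..<int M}"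
      using pp(1,2) unfolding p p' by (simp_all add: Y_def five_squares_mod_def four_squares_mod_def)
    have e: "x0 + int M * t0 = u0 + int M * v0" "x1 + int M * t1 = u1 + int M * v1" "x2 + int M * t2 = u2 + int M * v2"
      "x3 + int M * t3 = u3 + int M * v3" "x4 + int M * t4 = u4 + int M * v4"
      using pp(3) unfolding p p' f_def by simp_all
    show "p = p'" unfolding p p'
      using dm[OF e(1) r(1,6)] dm[OF e(2) r(2,7)] dm[OF e(3) r(3,8)] dm[OF e(4) r(4,9)] dm[OF e(5) r(5,10)] by simp
  qed
  have sub: "f ` (SIGMA p:Y. W p) \<subseteq> five_squares_shell n M (\<eta> * s\<^sup>2)"
  proof
    fix q assume "q \<in> f ` (SIGMA p:Y. W p)"
    then obtain p where pY: "p \<in> (SIGMA p:Y. W p)" and q: "q = f p" by blast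
    obtain x0 x1 x2 x3 x4 where x: "fst (fst p) = (x0, x1, x2, x3, x4)" by (rule prod_cases5)
    obtain t1 t2 t3 t4 where t: "snd (fst p) = (t1, t2, t3, t4)" by (rule prod_cases4)
    obtain t0 where t0: "t0 = snd p" by blast
    have p: "p = (((x0, x1, x2, x3, x4), (t1, t2, t3, t4)), t0)" using x t t0 by (simp add: prod_eq_iff)
    have Y: "((x0, x1, x2, x3, x4), (t1, t2, t3, t4)) \<in> Y" and tW: "t0 \<in> W ((x0, x1, x2, x3, x4), (t1, t2, t3, t4))"
      using pY unfolding p by simp_all
    have 1: "(x0 + int M * t0)\<^sup>2 \<le> rem (x0, x1, x2, x3, x4) (t1, t2, t3, t4)"
      "real_of_int (rem (x0, x1, x2, x3, x4) (t1, t2, t3, t4) - (x0 + int M * t0)\<^sup>2) \<le> \<eta> * s\<^sup>2"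
      using W[rule_format, OF Y] tW by (simp_all only: fst_conv snd_conv)
    have c: "[n - ((x0 + int M * t0)\<^sup>2 + (x1 + int M * t1)\<^sup>2 + (x2 + int M * t2)\<^sup>2 + (x3 + int M * t3)\<^sup>2 + (x4 + int M * t4)\<^sup>2)
        = n - (x0\<^sup>2 + x1\<^sup>2 + x2\<^sup>2 + x3\<^sup>2 + x4\<^sup>2)] (mod int M)"
      by (intro cong_diff cong_add cong_pow cong_refl) (auto simp: cong_def)
    have "int M dvd n - (x0\<^sup>2 + x1\<^sup>2 + x2\<^sup>2 + x3\<^sup>2 + x4\<^sup>2)"
      using Y by (simp add: Y_def five_squares_mod_def four_squares_mod_def diff_diff_eq add.assoc)
    then have 2: "int M dvd n - ((x0 + int M * t0)\<^sup>2 + (x1 + int M * t1)\<^sup>2 + (x2 + int M * t2)\<^sup>2 + (x3 + int M * t3)\<^sup>2 + (x4 + int M * t4)\<^sup>2)"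
      using cong_dvd_iff[OF c] by simp
    have 3: "rem (x0, x1, x2, x3, x4) (t1, t2, t3, t4) - (x0 + int M * t0)\<^sup>2
       = n - ((x0 + int M * t0)\<^sup>2 + (x1 + int M * t1)\<^sup>2 + (x2 + int M * t2)\<^sup>2 + (x3 + int M * t3)\<^sup>2 + (x4 + int M * t4)\<^sup>2)"
      by (simp add: rem_def)
    have 4: "0 \<le> rem (x0, x1, x2, x3, x4) (t1, t2, t3, t4) - (x0 + int M * t0)\<^sup>2" using 1(1) by simp
    show "q \<in> five_squares_shell n M (\<eta> * s\<^sup>2)"
      using 1(2) 4 2 unfolding 3 unfolding q p f_def five_squares_shell_def by (simp only: prod.case mem_Collect_eq simp_thms)
  qed
  have finY: "finite Y" by (simp add: Y_def finite_five_squares_mod T_def)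
  have D0: "D \<ge> 0" using D(1) by (smt (verit) of_nat_0_le_iff)
  have "D ^ 4 * \<eta> * s / (524288 * real M) = real M ^ 4 / 8192 * (D / (2 * real M)) ^ 4 * (\<eta> * s / (4 * real M))"
    using M(2) by (simp add: field_simps power_numeral_reduce)
  also have "\<dots> \<le> real (card (five_squares_mod n M)) * real b ^ 4 * (\<eta> * s / (4 * real M))"
    using card_five_squares_mod_ge[OF M, of n] b(1) \<eta> s D0 by (intro mult_right_mono mult_mono power_mono) auto
  also have "\<dots> = (\<Sum>p\<in>Y. \<eta> * s / (4 * real M))"
    by (simp add: Y_def card_cartesian_product T_def power_numeral_reduce)
  also have "\<dots> \<le> (\<Sum>p\<in>Y. real (card (W p)))" using W by (intro sum_mono) blast
  also have "\<dots> = real (card (SIGMA p:Y. W p))"   proof -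
    have "\<forall>p\<in>Y. finite (W p)" using W by blast
    then show ?thesis using finY by (simp only: card_SigmaI of_nat_sum)
  qed
  also have "\<dots> = real (card (f ` (SIGMA p:Y. W p)))" using inj by (simp add: card_image)
  also have "\<dots> \<le> real (card (five_squares_shell n M (\<eta> * s\<^sup>2)))"
    by (intro of_nat_mono card_mono finite_five_squares_shell sub)
  finally show ?thesis .
qed

lemma obtain_five:
  assumes "CARD('d::finite) \<ge> 5"
  obtains a b c d e :: "'d::finite" where "distinct [a, b, c, d, e]"
proof -
  obtain J :: "'d set" where J: "card J = 5" using obtain_subset_with_card_n[OF assms] by blast
  then obtain xs where xs: "set xs = J" "distinct xs" "length xs = 5"
    using finite_distinct_list[of J] by (metis card.infinite distinct_card zero_neq_numeral)
  then obtain a b c d e where "xs = [a, b, c, d, e]"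
    by (auto simp: length_Suc_conv eval_nat_numeral)
  then show ?thesis using that xs by blast
qed

definition shell :: "nat \<Rightarrow> nat \<Rightarrow> real \<Rightarrow> (int ^ 'd::finite) set" where
  "shell l M h = {v. 0 \<le> int l - sqnorm v \<and> of_int (int l - sqnorm v) \<le> h \<and> int M dvd int l - sqnorm v}"

text \<open>All coordinates but five are chosen freely in \<open>[0, D]\<close>. Since their squares sum to at most half of \<open>l\<close>, the remaining
five-dimensional shell still has radius comparable to the original one.\<close>

lemma card_shell_ge:
  assumes d: "CARD('d::finite) \<ge> 5" and M: "8 dvd M" "M > 0" and \<eta>: "0 < \<eta>" "\<eta> \<le> 1"
    and l: "l > 0" "4 * real M \<le> \<eta> * sqrt (real l)"
    and D: "D = sqrt (real l) / (2 * real CARD('d))" "2 * real M \<le> D"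
    and fin: "finite (shell l M (\<eta> * real l) :: (int ^ 'd) set)"
  shows "(D / 2) ^ (CARD('d) - 5) * (D ^ 4 * \<eta> * sqrt (real l) / (524288 * real M))
    \<le> real (card (shell l M (\<eta> * real l) :: (int ^ 'd) set))"
proof -
  define s where "s = sqrt (real l)"
  have s: "s > 0" "s\<^sup>2 = real l" using l by (auto simp: s_def)
  obtain p0 p1 p2 p3 p4 :: 'd where dist: "distinct [p0, p1, p2, p3, p4]" using obtain_five[OF d] .
  define J where "J = {p0, p1, p2, p3, p4}"
  have ne: "p0 \<noteq> p1" "p0 \<noteq> p2" "p0 \<noteq> p3" "p0 \<noteq> p4" "p1 \<noteq> p2" "p1 \<noteq> p3" "p1 \<noteq> p4"
    "p2 \<noteq> p3" "p2 \<noteq> p4" "p3 \<noteq> p4" using dist by auto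
  note ne = ne ne[symmetric]
  have cJ: "card J = 5" by (simp add: J_def ne)
  define b where "b = nat \<lfloor>D\<rfloor>"
  have D2: "D \<ge> 2" using D(2) M(2) by linarith
  have b: "D / 2 \<le> real b" "real b \<le> D" using D2 by (simp_all add: b_def) linarith+
  define G where "G = PiE (-J) (\<lambda>_. {0..<int b})"
  define n where "n g = int l - (\<Sum>i\<in>-J. (g i)\<^sup>2)" for g :: "'d \<Rightarrow> int"
  define F where "F = (\<lambda>(g, (v0, v1, v2, v3, v4)). (\<chi> i. if i = p0 then v0 else if i = p1 then v1 else if i = p2 then v2
     else if i = p3 then v3 else if i = p4 then v4 else g i) :: int ^ 'd)"
  have Dsq: "16 * D\<^sup>2 \<le> s\<^sup>2" "real (card (-J)) * D\<^sup>2 \<le> s\<^sup>2 / 2"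
  proof -
    define k where "k = real CARD('d)"
    have k: "k \<ge> 5" using d by (simp add: k_def)
    have D_s: "D\<^sup>2 * (4 * k\<^sup>2) = s\<^sup>2" using k by (simp add: D(1) k_def s_def[symmetric] power_divide power_mult_distrib)
    have "5 * 5 \<le> k * k" using k by (intro mult_mono) auto
    then have "D\<^sup>2 * 16 \<le> D\<^sup>2 * (4 * k\<^sup>2)" by (intro mult_left_mono) (auto simp: power2_eq_square)
    then show "16 * D\<^sup>2 \<le> s\<^sup>2" using D_s by simp
    have "real (card (-J)) \<le> k" by (simp add: k_def card_mono)
    moreover have "2 * k \<le> 4 * k\<^sup>2" using k by (simp add: power2_eq_square) 
    ultimately have "D\<^sup>2 * (2 * real (card (-J))) \<le> D\<^sup>2 * (4 * k\<^sup>2)" by (intro mult_left_mono) auto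
    then show "real (card (-J)) * D\<^sup>2 \<le> s\<^sup>2 / 2" using D_s by (simp add: mult_ac)
  qed
  have ng: "s\<^sup>2 / 2 \<le> of_int (n g)" "of_int (n g) \<le> s\<^sup>2" if g: "g \<in> G" for g
  proof -
    have "(\<Sum>i\<in>-J. (real_of_int (g i))\<^sup>2) \<le> (\<Sum>i\<in>-J. D\<^sup>2)"
    proof (intro sum_mono power_mono)
      fix i assume "i \<in> -J"
      then have "g i \<in> {0..<int b}" using g by (auto simp: G_def)
      then show "real_of_int (g i) \<le> D" "0 \<le> real_of_int (g i)" using b(2) by auto
    qed
    also have "\<dots> \<le> s\<^sup>2 / 2" using Dsq(2) by simp
    finally show "s\<^sup>2 / 2 \<le> of_int (n g)" by (simp add: n_def s(2))
    have "0 \<le> (\<Sum>i\<in>-J. (real_of_int (g i))\<^sup>2)" by (intro sum_nonneg) auto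
    then show "of_int (n g) \<le> s\<^sup>2" by (simp add: n_def s(2))
  qed
  have F_sq: "sqnorm (F (g, (v0, v1, v2, v3, v4))) = v0\<^sup>2 + v1\<^sup>2 + v2\<^sup>2 + v3\<^sup>2 + v4\<^sup>2 + (\<Sum>i\<in>-J. (g i)\<^sup>2)" for g v0 v1 v2 v3 v4
  proof -
    let ?v = "F (g, (v0, v1, v2, v3, v4))"
    have "sqnorm ?v = (\<Sum>i\<in>J. (?v $ i)\<^sup>2) + (\<Sum>i\<in>-J. (?v $ i)\<^sup>2)"
      unfolding sqnorm_def by (subst sum.union_disjoint[symmetric]) auto
    also have "(\<Sum>i\<in>-J. (?v $ i)\<^sup>2) = (\<Sum>i\<in>-J. (g i)\<^sup>2)"
      by (intro sum.cong refl) (auto simp: F_def J_def)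
    also have "(\<Sum>i\<in>J. (?v $ i)\<^sup>2) = v0\<^sup>2 + v1\<^sup>2 + v2\<^sup>2 + v3\<^sup>2 + v4\<^sup>2"
      by (simp add: J_def F_def ne)
    finally show ?thesis .
  qed
  have sub: "F ` (SIGMA g:G. five_squares_shell (n g) M (\<eta> * s\<^sup>2)) \<subseteq> shell l M (\<eta> * real l)"
  proof
    fix q assume "q \<in> F ` (SIGMA g:G. five_squares_shell (n g) M (\<eta> * s\<^sup>2))"
    then obtain p where p: "p \<in> (SIGMA g:G. five_squares_shell (n g) M (\<eta> * s\<^sup>2))" "q = F p" by blast
    obtain v0 v1 v2 v3 v4 where v: "snd p = (v0, v1, v2, v3, v4)" by (rule prod_cases5)
    obtain g where g: "g = fst p" by blast
    have pe: "p = (g, (v0, v1, v2, v3, v4))" using v g by (simp add: prod_eq_iff)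
    have sh: "(v0, v1, v2, v3, v4) \<in> five_squares_shell (n g) M (\<eta> * s\<^sup>2)" using p(1) unfolding pe by simp
    have eq: "int l - sqnorm q = n g - (v0\<^sup>2 + v1\<^sup>2 + v2\<^sup>2 + v3\<^sup>2 + v4\<^sup>2)"
      unfolding p(2) pe F_sq by (simp add: n_def)
    show "q \<in> shell l M (\<eta> * real l)"
      unfolding shell_def mem_Collect_eq eq using sh unfolding s(2) five_squares_shell_def by (simp only: prod.case mem_Collect_eq)
  qed
  have inj: "inj_on F (SIGMA g:G. five_squares_shell (n g) M (\<eta> * s\<^sup>2))"
  proof (rule inj_onI)
    fix p p' assume p: "p \<in> (SIGMA g:G. five_squares_shell (n g) M (\<eta> * s\<^sup>2))" "p' \<in> (SIGMA g:G. five_squares_shell (n g) M (\<eta> * s\<^sup>2))" "F p = F p'"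
    obtain v0 v1 v2 v3 v4 where v: "snd p = (v0, v1, v2, v3, v4)" by (rule prod_cases5)
    obtain w0 w1 w2 w3 w4 where w: "snd p' = (w0, w1, w2, w3, w4)" by (rule prod_cases5)
    obtain g g' where g: "g = fst p" "g' = fst p'" by blast
    have pe: "p = (g, (v0, v1, v2, v3, v4))" "p' = (g', (w0, w1, w2, w3, w4))" using v w g by (simp_all add: prod_eq_iff)
    have G: "g \<in> G" "g' \<in> G" using p by (auto simp: pe)
    have c: "F p $ i = F p' $ i" for i by (simp only: p(3))
    have "g i = g' i" if "i \<in> -J" for i
      using c[of i] that by (simp add: pe F_def J_def)
    then have "g = g'" using G unfolding G_def by (intro PiE_ext) auto
    moreover have "v0 = w0" using c[of p0] by (simp add: pe F_def)
    moreover have "v1 = w1" using c[of p1] by (simp add: pe F_def ne)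
    moreover have "v2 = w2" using c[of p2] by (simp add: pe F_def ne)
    moreover have "v3 = w3" using c[of p3] by (simp add: pe F_def ne)
    moreover have "v4 = w4" using c[of p4] by (simp add: pe F_def ne)
    ultimately show "p = p'" by (simp add: pe)
  qed
  have finG: "finite G" unfolding G_def by (intro finite_PiE) auto
  have cG: "card G = b ^ (CARD('d) - 5)"
    unfolding G_def by (subst card_PiE) (auto simp: Compl_eq_Diff_UNIV card_Diff_subset cJ)
  have "(D / 2) ^ (CARD('d) - 5) * (D ^ 4 * \<eta> * s / (524288 * real M)) \<le> real (card G) * (D ^ 4 * \<eta> * s / (524288 * real M))"
    unfolding cG of_nat_power using b(1) D2 \<eta> s(1) by (intro mult_right_mono power_mono) auto
  also have "\<dots> = (\<Sum>g\<in>G. D ^ 4 * \<eta> * s / (524288 * real M))" by simp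
  also have "\<dots> \<le> (\<Sum>g\<in>G. real (card (five_squares_shell (n g) M (\<eta> * s\<^sup>2))))"
    using l(2) ng D(2) Dsq(1) by (intro sum_mono card_five_squares_shell_ge M \<eta> s(1)) (auto simp: s_def)
  also have "\<dots> = real (card (SIGMA g:G. five_squares_shell (n g) M (\<eta> * s\<^sup>2)))" using finG by (simp add: card_SigmaI finite_five_squares_shell)
  also have "\<dots> = real (card (F ` (SIGMA g:G. five_squares_shell (n g) M (\<eta> * s\<^sup>2))))" using inj by (simp add: card_image)
  also have "\<dots> \<le> real (card (shell l M (\<eta> * real l) :: (int ^ 'd) set))"
    by (intro of_nat_mono card_mono fin sub)
  finally show ?thesis by (simp only: s_def)
qed

lemma shell_subset_spheres:
  assumes M: "M > 0" and h: "0 \<le> h" "h \<le> real l"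
  shows "(shell l M h :: (int ^ 'd::finite) set) \<subseteq> (\<Union>k\<in>{0..nat \<lfloor>h / real M\<rfloor>}. lattice_sphere (int (l - M * k)))"
proof
  fix v :: "int ^ 'd" assume v: "v \<in> shell l M h"
  then obtain k where k: "int l - sqnorm v = int M * k" by (auto simp: shell_def)
  have "0 \<le> int M * k" using v k by (simp add: shell_def)
  then have k0: "0 \<le> k" using M by (simp add: zero_le_mult_iff)
  have "real_of_int (int M * k) \<le> h" using v unfolding k[symmetric] by (simp add: shell_def)
  then have kh: "of_int k \<le> h / real M" using M by (simp add: field_simps)
  then have "k \<le> \<lfloor>h / real M\<rfloor>" by linarith
  then have "nat k \<in> {0..nat \<lfloor>h / real M\<rfloor>}" by auto
  moreover have "int (l - M * nat k) = sqnorm v"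
  proof -
    have "int M * k \<le> int l"
      using k sqnorm_nonneg[of v] by linarith
    then have "M * nat k \<le> l" using k0 by (metis int_nat_eq of_nat_le_iff of_nat_mult)
    then show ?thesis using k k0 by (simp add: of_nat_diff)
  qed
  ultimately show "v \<in> (\<Union>k\<in>{0..nat \<lfloor>h / real M\<rfloor>}. lattice_sphere (int (l - M * k)))"
    by (auto simp: lattice_sphere_def intro!: bexI[of _ "nat k"])
qed

text \<open>The shell with \<open>|v|\<^sup>2 \<equiv> l\<close> modulo \<open>M\<close> is covered by about \<open>\<eta> l/M\<close> spheres, and none of them has
noticeably more points than the outermost one. The constant \<open>c\<close> in the count of the shell depends on the
dimension only; it is fixed before the accuracy \<open>c/4\<close> of the comparison and with it \<open>M\<close> and \<open>\<eta>\<close> are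
chosen.\<close>

lemma sphere_count_lower:
  assumes d: "CARD('d::finite) \<ge> 5"
  shows "\<exists>c>0. \<exists>l0. \<forall>l::nat. l0 \<le> l \<longrightarrow> c * sqrt (real l) ^ (CARD('d) - 2) \<le> real (card (lattice_sphere (int l) :: (int ^ 'd) set))"
proof -
  define d' where "d' = CARD('d)"
  have d5: "d' \<ge> 5" using d by (simp add: d'_def)
  \<comment> \<open>This is the constant that \<open>card_shell_ge\<close> gives for \<open>D = s/(2 d)\<close>.\<close>
  define c where "c = (1 / (4 * real d')) ^ (d' - 5) * (1 / (2 * real d')) ^ 4 / 524288"
  have c: "c > 0" using d5 by (simp add: c_def)
  define r where "r l = real (card (lattice_sphere (int l) :: (int ^ 'd) set))" for l :: nat
  have "c / 4 > 0" using c by simp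
  from sphere_count_nearby_radii[OF d this] obtain \<eta>0 Q l0 where \<eta>0: "\<eta>0 > 0" and
    cmp: "\<forall>(l::nat) m. l0 \<le> l \<longrightarrow> 8 * fact Q dvd m \<longrightarrow> real m \<le> \<eta>0 * real l \<longrightarrow> m \<le> l \<longrightarrow>
      \<bar>r l - r (l - m)\<bar> \<le> c / 4 * sqrt (real l) ^ (CARD('d) - 2)"
    unfolding r_def by (elim exE conjE)
  define \<eta> where "\<eta> = min \<eta>0 1"
  have \<eta>: "0 < \<eta>" "\<eta> \<le> 1" "\<eta> \<le> \<eta>0" using \<eta>0 by (auto simp: \<eta>_def)
  define M where "M = 8 * (fact Q :: nat)"
  have M: "8 dvd M" "M > 0" by (auto simp: M_def)
  define B where "B = 4 * real M / \<eta> + 4 * real d' * real M + 1"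
  have B: "B \<ge> 1" using \<eta> by (simp add: B_def)
  have "c / 4 * sqrt (real l) ^ (d' - 2) \<le> r l" if l: "max l0 (nat \<lceil>B\<^sup>2\<rceil>) \<le> l" for l
  proof -
    define s where "s = sqrt (real l)"
    have "B\<^sup>2 \<le> real l" using l by linarith
    then have sB: "B \<le> s" unfolding s_def by (rule real_le_rsqrt)
    have s1: "s \<ge> 1" using sB B by linarith
    then have l0: "l > 0" by (cases "l = 0") (auto simp: s_def)
    have s2: "s\<^sup>2 = real l" by (simp add: s_def)
    have "4 * real M / \<eta> \<le> B" "4 * real d' * real M \<le> B" using \<eta> by (simp_all add: B_def)
    then have "4 * real M / \<eta> \<le> s" "4 * real d' * real M \<le> s" using sB by linarith+
    then have Ms: "4 * real M \<le> \<eta> * s" "2 * real M \<le> s / (2 * real d')"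
      using \<eta> d5 by (simp_all add: field_simps)
    define H where "H = nat \<lfloor>\<eta> * real l / real M\<rfloor>"
    have hl: "\<eta> * real l \<le> real l" "0 \<le> \<eta> * real l" using \<eta> by (simp_all add: mult_left_le_one_le)
    note sub = shell_subset_spheres[OF M(2) hl(2,1), where 'd = 'd]
    have fin: "finite (shell l M (\<eta> * real l) :: (int ^ 'd) set)"
      by (rule finite_subset[OF sub]) (intro finite_UN_I finite_lattice_sphere, simp)
    have Hreal: "real H \<le> \<eta> * real l / real M" using hl by (simp add: H_def)
    have each: "r (l - M * k) \<le> r l + c / 4 * s ^ (d' - 2)" if k: "k \<in> {0..H}" for k
    proof -
      have "real k \<le> \<eta> * real l / real M" using k Hreal by simp
      then have "real (M * k) \<le> \<eta> * real l" using M(2) by (simp add: field_simps)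
      moreover have "\<eta> * real l \<le> \<eta>0 * real l" using \<eta> by (intro mult_right_mono) auto
      ultimately have 1: "real (M * k) \<le> \<eta>0 * real l" "real (M * k) \<le> real l" using hl by linarith+
      have 2: "8 * fact Q dvd M * k" by (simp add: M_def)
      have "l0 \<le> l" using l by simp
      moreover have "M * k \<le> l" using 1(2) by (simp only: of_nat_le_iff)
      ultimately have "\<bar>r l - r (l - M * k)\<bar> \<le> c / 4 * s ^ (d' - 2)"
        using cmp[rule_format, OF _ 2 1(1)] unfolding s_def d'_def by blast
      then show ?thesis by linarith
    qed
    have "c * \<eta> * s ^ d' / real M = (s / (2 * real d') / 2) ^ (CARD('d) - 5) * ((s / (2 * real d')) ^ 4 * \<eta> * s / (524288 * real M))"
    proof -
      have "s ^ d' = s ^ (d' - 5) * s ^ 5"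
        using power_add[of s "d' - 5" 5] d5 by (simp only: le_add_diff_inverse2)
      moreover have "s ^ 5 = s ^ 4 * s" by (simp add: power_numeral_reduce)
      moreover have "(s / (2 * real d') / 2) ^ (d' - 5) = (1 / (4 * real d')) ^ (d' - 5) * s ^ (d' - 5)"
        by (simp add: power_divide power_mult_distrib)
      moreover have "(s / (2 * real d')) ^ 4 = (1 / (2 * real d')) ^ 4 * s ^ 4"
        by (simp add: power_divide)
      ultimately show ?thesis unfolding c_def d'_def[symmetric] by simp
    qed
    also have "\<dots> \<le> real (card (shell l M (\<eta> * real l) :: (int ^ 'd) set))"
      unfolding s_def d'_def using d M \<eta> l0 Ms fin by (intro card_shell_ge) (auto simp: s_def d'_def)
    also have "\<dots> \<le> real (card (\<Union>k\<in>{0..H}. (lattice_sphere (int (l - M * k)) :: (int ^ 'd) set)))"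
      using sub unfolding H_def by (intro of_nat_mono card_mono finite_UN_I finite_lattice_sphere) auto
    also have "\<dots> \<le> real (\<Sum>k\<in>{0..H}. card (lattice_sphere (int (l - M * k)) :: (int ^ 'd) set))"
      by (intro of_nat_mono card_UN_le) simp
    also have "\<dots> = (\<Sum>k\<in>{0..H}. r (l - M * k))" unfolding r_def of_nat_sum ..
    also have "\<dots> \<le> (\<Sum>k\<in>{0..H}. r l + c / 4 * s ^ (d' - 2))" by (intro sum_mono each)
    also have "\<dots> = (real H + 1) * (r l + c / 4 * s ^ (d' - 2))" by simp
    also have "\<dots> \<le> (2 * \<eta> * s\<^sup>2 / real M) * (r l + c / 4 * s ^ (d' - 2))"
    proof (rule mult_right_mono)
      have "\<eta> * s * 1 \<le> \<eta> * s * s" using \<eta> s1 by (intro mult_left_mono) auto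
      then have "real M \<le> \<eta> * real l" using Ms(1) M(2) by (simp add: s2[symmetric] power2_eq_square mult.assoc)
      then have "1 \<le> \<eta> * real l / real M" using M(2) by simp
      then show "real H + 1 \<le> 2 * \<eta> * s\<^sup>2 / real M" using Hreal by (simp add: s2)
    qed (use c s1 in \<open>simp add: r_def\<close>)
    finally have count: "c * \<eta> * s ^ d' / real M \<le> (2 * \<eta> * s\<^sup>2 / real M) * (r l + c / 4 * s ^ (d' - 2))" .
    have pow: "s ^ d' = s\<^sup>2 * s ^ (d' - 2)"
      using power_add[of s 2 "d' - 2"] d5 by (simp only: le_add_diff_inverse)
    have "(\<eta> * s\<^sup>2 / real M) * (c * s ^ (d' - 2)) = c * \<eta> * s ^ d' / real M" unfolding pow by simp
    also note count
    also have "(2 * \<eta> * s\<^sup>2 / real M) * (r l + c / 4 * s ^ (d' - 2)) = (\<eta> * s\<^sup>2 / real M) * (2 * (r l + c / 4 * s ^ (d' - 2)))"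
      by (simp only: times_divide_eq_left times_divide_eq_right mult_ac)
    finally have "(\<eta> * s\<^sup>2 / real M) * (c * s ^ (d' - 2)) \<le> (\<eta> * s\<^sup>2 / real M) * (2 * (r l + c / 4 * s ^ (d' - 2)))" .
    moreover have "0 < \<eta> * s\<^sup>2 / real M" using \<eta> s1 M(2) by simp
    ultimately have "c * s ^ (d' - 2) \<le> 2 * (r l + c / 4 * s ^ (d' - 2))" by (simp only: mult_le_cancel_left_pos)
    then show ?thesis by (simp add: s_def)
  qed
  then show ?thesis unfolding r_def d'_def using c by (intro exI[of _ "c / 4"] conjI exI[of _ "max l0 (nat \<lceil>B\<^sup>2\<rceil>)"]) auto
qed

section \<open>Large sphere sums\<close>

text \<open>If one coordinate of \<open>r \<xi>\<close> is far from the integers, then at each of the boundedly many major points the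
quadratic sum in that coordinate is small, hence so is the product; the minor points are
negligible in any case. The number \<open>r = 2 \<cdot> Q!\<close> is a common multiple of all \<open>2 q\<close> that occur.\<close>

lemma sphere_sum_large_imp_rational:
  fixes e :: real
  assumes d: "CARD('d::finite) \<ge> 5" and e: "e > 0"
  shows "\<exists>r\<ge>2. \<exists>C>0. \<exists>l0. \<forall>(l::nat) (\<xi> :: 'd \<Rightarrow> real). l0 \<le> l \<longrightarrow>
     e * real (card (lattice_sphere (int l) :: (int ^ 'd) set)) \<le> norm (sphere_sum l \<xi>) \<longrightarrow>
     (\<forall>i. int_dist (real r * \<xi> i) \<le> C / sqrt (real l))"
proof -
  obtain c l1 where c: "c > 0" and
    lower: "\<forall>l::nat. l1 \<le> l \<longrightarrow> c * sqrt (real l) ^ (CARD('d) - 2) \<le> real (card (lattice_sphere (int l) :: (int ^ 'd) set))"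
    using sphere_count_lower[OF d] by (elim exE conjE)
  define e1 where "e1 = e * c / (4 * 3 ^ CARD('d))"
  have e1: "e1 > 0" using e c by (simp add: e1_def)
  obtain Q T K l2 where T: "T > 0" "K \<ge> 0" and
    minor: "\<forall>(l::nat) N P. l2 \<le> l \<longrightarrow> l < (N + 1)\<^sup>2 \<longrightarrow> P = CARD('d) * l + 1 \<longrightarrow>
      (\<exists>M. M \<subseteq> {..<P} \<and> real (card M) \<le> K \<and>
        (\<forall>k\<in>M. \<exists>q a. 0 < q \<and> q \<le> Q \<and> \<bar>2 * (real k / real P) - of_int a / real q\<bar> \<le> T / real l) \<and>
        (\<forall>\<theta> :: 'd \<Rightarrow> real. (\<Sum>k\<in>{..<P} - M. \<Prod>i\<in>UNIV. norm (quad_sum N (real k / real P) (\<theta> i)))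
            \<le> e1 * (2 * real N + 1) ^ CARD('d)))"
    using minor_arcs[OF d e1] by (elim exE conjE)
  define e2 where "e2 = e1 / (K + 1)"
  have e2: "e2 > 0" using e1 T by (simp add: e2_def)
  have T0: "T \<ge> 0" using T by simp
  obtain C l3 where C: "C > 0" and
    major: "\<forall>(l::nat) N q a \<alpha> \<theta>. l3 \<le> real l \<longrightarrow> N\<^sup>2 \<le> l \<longrightarrow> l < (N + 1)\<^sup>2 \<longrightarrow>
    0 < q \<longrightarrow> q \<le> Q \<longrightarrow> \<bar>2 * \<alpha> - of_int a / real q\<bar> \<le> T / real l \<longrightarrow>
    e2 * (2 * real N + 1) < norm (quad_sum N \<alpha> \<theta>) \<longrightarrow> int_dist (2 * real q * \<theta>) \<le> C / sqrt (real l)"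
    using quad_sum_large_imp_rational[OF T0 e2, of Q] by (elim exE conjE)
  define r where "r = 2 * (fact Q :: nat)"
  define C' where "C' = fact Q * C"
  have r2: "r \<ge> 2" using fact_ge_1[of Q, where 'a = nat] by (simp add: r_def)
  have C': "C' > 0" using C by (simp add: C'_def)
  have main: "int_dist (real r * \<xi> i) \<le> C' / sqrt (real l)"
    if l: "max (max l1 l2) (max 1 (nat \<lceil>l3\<rceil>)) \<le> l" and
      big: "e * real (card (lattice_sphere (int l) :: (int ^ 'd) set)) \<le> norm (sphere_sum l \<xi>)"
    for l :: nat and \<xi> :: "'d \<Rightarrow> real" and i
  proof (rule ccontr)
    assume "\<not> int_dist (real r * \<xi> i) \<le> C' / sqrt (real l)"
    then have not: "C' / sqrt (real l) < int_dist (real r * \<xi> i)" by simp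
    have "l1 \<le> l" "l2 \<le> l" "1 \<le> l" "nat \<lceil>l3\<rceil> \<le> l" using l by simp_all
    moreover from this have "l3 \<le> real l" by linarith
    ultimately have ls: "l1 \<le> l" "l2 \<le> l" "1 \<le> l" "l3 \<le> real l" by blast+
    obtain N where N: "N\<^sup>2 \<le> l" "l < (N + 1)\<^sup>2" using ex_floor_sqrt by blast
    define P where "P = CARD('d) * l + 1"
    define X where "X = 2 * real N + 1"
    obtain M where M: "M \<subseteq> {..<P}" "real (card M) \<le> K"
      "\<forall>k\<in>M. \<exists>q a. 0 < q \<and> q \<le> Q \<and> \<bar>2 * (real k / real P) - of_int a / real q\<bar> \<le> T / real l"
      "\<forall>\<theta> :: 'd \<Rightarrow> real. (\<Sum>k\<in>{..<P} - M. \<Prod>i\<in>UNIV. norm (quad_sum N (real k / real P) (\<theta> i))) \<le> e1 * (2 * real N + 1) ^ CARD('d)"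
      using minor[rule_format, OF ls(2) N(2) P_def] by (elim exE conjE)
    define g where "g k j = norm (quad_sum N (real k / real P) (\<xi> j))" for k j
    have gX: "0 \<le> g k j" "g k j \<le> X" for k j unfolding g_def X_def by (auto simp: norm_quad_sum_le)
    have small: "(\<Prod>j\<in>UNIV. g k j) \<le> e2 * X ^ CARD('d)" if k: "k \<in> M" for k
    proof -
      obtain q a where q: "0 < q" "q \<le> Q" and qa: "\<bar>2 * (real k / real P) - of_int a / real q\<bar> \<le> T / real l"
        using M(3) k by blast
      have "q dvd fact Q" using q by (intro dvd_fact) auto
      then obtain t where t: "fact Q = q * t" by blast
      have "g k i \<le> e2 * X"
      proof (rule ccontr)
        assume "\<not> g k i \<le> e2 * X"
        then have "e2 * (2 * real N + 1) < norm (quad_sum N (real k / real P) (\<xi> i))" by (simp add: g_def X_def)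
        from major[rule_format, OF ls(4) N q qa this] have id: "int_dist (2 * real q * \<xi> i) \<le> C / sqrt (real l)" .
        have "int_dist (real r * \<xi> i) = int_dist (of_int (int t) * (2 * real q * \<xi> i))"
          by (simp add: r_def t mult_ac)
        also have "\<dots> \<le> \<bar>of_int (int t)\<bar> * int_dist (2 * real q * \<xi> i)" by (rule int_dist_mult_le)
        also have "\<dots> \<le> real t * (C / sqrt (real l))" 
        proof -
          have "real t * int_dist (2 * real q * \<xi> i) \<le> real t * (C / sqrt (real l))" by (rule mult_left_mono[OF id]) simp
          then show ?thesis by (simp only: of_int_of_nat_eq abs_of_nat)
        qed
        also have "\<dots> \<le> real (fact Q) * (C / sqrt (real l))"
        proof (rule mult_right_mono)
          have "1 * t \<le> q * t" using q by (intro mult_right_mono) auto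
          then show "real t \<le> real (fact Q)" unfolding t by (simp only: of_nat_le_iff mult_1)
        qed (use C in simp)
        finally show False using not by (simp add: C'_def)
      qed
      have "(\<Prod>j\<in>UNIV. g k j) = g k i * (\<Prod>j\<in>UNIV - {i}. g k j)" by (rule prod.remove) auto
      also have "\<dots> \<le> (e2 * X) * (\<Prod>j\<in>UNIV - {i}. X)"
        using gX e2 \<open>g k i \<le> e2 * X\<close> by (intro mult_mono prod_mono prod_nonneg) (auto simp: X_def)
      also have "\<dots> = e2 * (X * X ^ (CARD('d) - 1))" by (simp add: card_Diff_singleton)
      also have "X * X ^ (CARD('d) - 1) = X ^ CARD('d)" by (subst power_Suc[symmetric]) (use d in simp)
      finally show ?thesis .
    qed
    have "(\<Sum>k<P. \<Prod>j\<in>UNIV. g k j) = (\<Sum>k\<in>{..<P} - M. \<Prod>j\<in>UNIV. g k j) + (\<Sum>k\<in>M. \<Prod>j\<in>UNIV. g k j)"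
      using M(1) by (intro sum.subset_diff) auto
    also have "\<dots> \<le> e1 * X ^ CARD('d) + (\<Sum>k\<in>M. e2 * X ^ CARD('d))"
      using M(4) by (intro add_mono sum_mono small) (simp_all add: g_def X_def)
    also have "\<dots> \<le> e1 * X ^ CARD('d) + e1 * X ^ CARD('d)"
    proof (rule add_left_mono)
      have "real (card M) * e2 \<le> (K + 1) * e2" using M(2) e2 by (intro mult_right_mono) auto
      also have "\<dots> = e1" using T by (simp add: e2_def)
      finally have "real (card M) * e2 * X ^ CARD('d) \<le> e1 * X ^ CARD('d)" by (intro mult_right_mono) (auto simp: X_def)
      then show "(\<Sum>k\<in>M. e2 * X ^ CARD('d)) \<le> e1 * X ^ CARD('d)" by simp
    qed
    finally have sumle: "(\<Sum>k<P. \<Prod>j\<in>UNIV. g k j) \<le> 2 * e1 * X ^ CARD('d)" by simp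
    have "norm (sphere_sum l \<xi>) \<le> 1 / real P * (\<Sum>k<P. \<Prod>j\<in>UNIV. g k j)"
      unfolding g_def by (rule norm_sphere_sum_le[OF N P_def])
    also have "\<dots> \<le> 1 / real P * (2 * e1 * X ^ CARD('d))" by (intro mult_left_mono sumle) auto
    also have "\<dots> = 2 * e1 * (X ^ CARD('d) / real P)" by simp
    also have "\<dots> \<le> 2 * e1 * (3 ^ CARD('d) * sqrt (real l) ^ (CARD('d) - 2))"
      unfolding X_def using e1 d ls N(1) by (intro mult_left_mono box_volume_div_modulus_le) (auto simp: P_def)
    also have "\<dots> = e * (c * sqrt (real l) ^ (CARD('d) - 2)) / 2" by (simp add: e1_def)
    also have "\<dots> < e * (c * sqrt (real l) ^ (CARD('d) - 2))"
    proof -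
      have "0 < e * (c * sqrt (real l) ^ (CARD('d) - 2))" using e c ls(3) by simp
      then show ?thesis by linarith
    qed
    also have "\<dots> \<le> e * real (card (lattice_sphere (int l) :: (int ^ 'd) set))"
      using lower ls(1) e by (intro mult_left_mono) auto
    finally show False using big by simp
  qed
  show ?thesis
    by (rule exI[of _ r], rule conjI[OF r2], rule exI[of _ C'], rule conjI[OF C'],
        rule exI[of _ "max (max l1 l2) (max 1 (nat \<lceil>l3\<rceil>))"], intro allI impI) (rule main)
qed

section \<open>Correlations and the discrete Fourier transform\<close>

text \<open>All phases lie within a quarter turn of the positive real axis.\<close>

lemma Re_sphere_sum_nonneg:
  fixes \<theta> :: "'d::finite \<Rightarrow> real" and a :: "'d \<Rightarrow> int"
  assumes a: "\<And>i. \<bar>\<theta> i - of_int (a i)\<bar> \<le> h" and h: "real CARD('d) * h * sqrt (real l) \<le> 1 / 4"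
  shows "0 \<le> Re (sphere_sum l \<theta>)"
proof -
  have "0 \<le> Re (ee (\<Sum>i\<in>UNIV. \<theta> i * of_int (v $ i)))" if v: "v \<in> lattice_sphere (int l)" for v :: "int ^ 'd"
  proof -
    define t where "t = (\<Sum>i\<in>UNIV. (\<theta> i - of_int (a i)) * of_int (v $ i))"
    have "(\<Sum>i\<in>UNIV. \<theta> i * of_int (v $ i)) = t + of_int (\<Sum>i\<in>UNIV. a i * v $ i)"
      by (simp add: t_def left_diff_distrib sum_subtractf)
    then have eq: "ee (\<Sum>i\<in>UNIV. \<theta> i * of_int (v $ i)) = ee t" by (simp only: ee_add_of_int)
    have vi: "\<bar>real_of_int (v $ i)\<bar> \<le> sqrt (real l)" for i
    proof -
      have "(v $ i)\<^sup>2 \<le> int l" using component_square_le_sqnorm[of v i] v by (simp add: lattice_sphere_def)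
      then have "real_of_int ((v $ i)\<^sup>2) \<le> real_of_int (int l)" by (simp only: of_int_le_iff)
      then show ?thesis by (intro real_le_rsqrt) simp
    qed
    have "\<bar>t\<bar> \<le> (\<Sum>i\<in>(UNIV :: 'd set). \<bar>(\<theta> i - of_int (a i)) * of_int (v $ i)\<bar>)" unfolding t_def by (rule sum_abs)
    also have "\<dots> \<le> (\<Sum>i\<in>(UNIV :: 'd set). h * sqrt (real l))"
      unfolding abs_mult by (intro sum_mono mult_mono a vi) (use a[of undefined] in auto)
    also have "\<dots> \<le> 1 / 4" using h by (simp add: mult.assoc)
    finally have "\<bar>t\<bar> \<le> 1 / 4" .
    then have "\<bar>2 * pi * t\<bar> \<le> 2 * pi * (1 / 4)" unfolding abs_mult by (intro mult_mono) auto
    then have "- (pi / 2) \<le> 2 * pi * t" "2 * pi * t \<le> pi / 2" unfolding abs_le_iff by linarith+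
    then have "0 \<le> cos (2 * pi * t)" by (intro cos_ge_zero) auto
    then show ?thesis unfolding eq by (simp add: ee_def)
  qed
  then show ?thesis unfolding sphere_sum_def Re_sum by (rule sum_nonneg)
qed

definition frequencies :: "nat \<Rightarrow> ('d::finite \<Rightarrow> nat) set" where
  "frequencies L = PiE UNIV (\<lambda>_. {..<L})"

definition dft :: "nat \<Rightarrow> (int ^ 'd::finite) set \<Rightarrow> ('d \<Rightarrow> nat) \<Rightarrow> complex" where
  "dft L B k = (\<Sum>x\<in>B. ee (\<Sum>i\<in>UNIV. - (real (k i) * of_int (x $ i) / real L)))"

lemma orthogonality_frequencies:
  fixes w :: "int ^ 'd::finite"
  assumes L: "L > 0" and w: "\<And>i. \<bar>w $ i\<bar> < int L"
  shows "(\<Sum>k\<in>frequencies L. ee (\<Sum>i\<in>UNIV. real (k i) * of_int (w $ i) / real L)) = (if w = 0 then of_nat L ^ CARD('d) else 0)"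
proof -
  have "(\<Sum>k\<in>frequencies L. ee (\<Sum>i\<in>UNIV. real (k i) * of_int (w $ i) / real L))
     = (\<Sum>k\<in>frequencies L. \<Prod>i\<in>UNIV. ee (real (k i) * of_int (w $ i) / real L))"
    by (simp add: ee_sum)
  also have "\<dots> = (\<Prod>i\<in>UNIV. \<Sum>n<L. ee (real n * of_int (w $ i) / real L))"
    unfolding frequencies_def by (rule prod_sum_PiE[symmetric]) auto
  also have "\<dots> = (\<Prod>i\<in>UNIV. if w $ i = 0 then of_nat L else 0)"
  proof (intro prod.cong refl)
    fix i
    have "int L dvd w $ i \<longleftrightarrow> w $ i = 0" using dvd_imp_le_int[of "w $ i" "int L"] w[of i] by auto
    then show "(\<Sum>n<L. ee (real n * of_int (w $ i) / real L)) = (if w $ i = 0 then of_nat L else 0)"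
      using orthogonality_ee[OF L, of "w $ i"] by simp
  qed
  also have "\<dots> = (if w = 0 then of_nat L ^ CARD('d) else 0)"
  proof (cases "w = 0")
    case False
    then obtain i where "w $ i \<noteq> 0" by (auto simp: vec_eq_iff)
    then show ?thesis using False by (auto intro!: prod_zero)
  qed simp
  finally show ?thesis .
qed

text \<open>The grid of \<open>L > 3 N\<close> points per coordinate is fine enough that \<open>w + x - y\<close> vanishes as soon as it vanishes
modulo \<open>L\<close>, so cyclic correlations are genuine ones.\<close>

lemma correlation_eq_dft:
  fixes B :: "(int ^ 'd::finite) set" and w :: "int ^ 'd"
  assumes B: "B \<subseteq> lattice_box N" and L: "3 * N < L" and w: "\<And>i. \<bar>w $ i\<bar> \<le> int N"
  shows "of_nat (card {x\<in>B. x + w \<in> B}) * of_nat L ^ CARD('d)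
    = (\<Sum>k\<in>frequencies L. of_real ((norm (dft L B k))\<^sup>2) * ee (\<Sum>i\<in>UNIV. real (k i) * of_int (w $ i) / real L))"
proof -
  have finB: "finite B" using B finite_lattice_box by (rule finite_subset)
  define p where "p k x = (\<Sum>i\<in>UNIV. real (k i) * of_int (x $ i) / real L)" for k :: "'d \<Rightarrow> nat" and x :: "int ^ 'd"
  have p_lin: "p k (w + x - y) = p k w + p k x - p k y" for k x y
    by (simp add: p_def algebra_simps add_divide_distrib diff_divide_distrib sum.distrib sum_subtractf)
  have F: "of_real ((norm (dft L B k))\<^sup>2) * ee (p k w) = (\<Sum>x\<in>B. \<Sum>y\<in>B. ee (p k (w + x - y)))" for k
  proof -
    have d: "dft L B k = (\<Sum>y\<in>B. ee (- p k y))" by (simp add: dft_def p_def sum_negf)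
    have "of_real ((norm (dft L B k))\<^sup>2) = cnj (dft L B k) * dft L B k"
      by (simp only: complex_norm_square mult.commute)
    also have "\<dots> = (\<Sum>x\<in>B. ee (p k x)) * (\<Sum>y\<in>B. ee (- p k y))" by (simp add: d cnj_ee)
    also have "\<dots> = (\<Sum>x\<in>B. \<Sum>y\<in>B. ee (p k x) * ee (- p k y))" by (rule sum_product)
    finally show ?thesis
      by (simp only: sum_distrib_right) (intro sum.cong refl, simp add: p_lin ee_add ee_diff mult_ac)
  qed
  have "(\<Sum>k\<in>frequencies L. of_real ((norm (dft L B k))\<^sup>2) * ee (p k w)) = (\<Sum>x\<in>B. \<Sum>k\<in>frequencies L. \<Sum>y\<in>B. ee (p k (w + x - y)))"
    unfolding F by (rule sum.swap)
  also have "\<dots> = (\<Sum>x\<in>B. \<Sum>y\<in>B. \<Sum>k\<in>frequencies L. ee (p k (w + x - y)))"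
    by (intro sum.cong refl sum.swap)
  also have "\<dots> = (\<Sum>x\<in>B. \<Sum>y\<in>B. if y = x + w then of_nat L ^ CARD('d) else 0)"
  proof (intro sum.cong refl)
    fix x y assume xy: "x \<in> B" "y \<in> B"
    have "\<bar>(w + x - y) $ i\<bar> < int L" for i
    proof -
      have "x $ i \<in> {- int N..int N}" "y $ i \<in> {- int N..int N}" using xy B by (auto simp: lattice_box_def)
      then show ?thesis using w[of i] L by simp linarith
    qed
    moreover have "L > 0" using L by simp
    ultimately have "(\<Sum>k\<in>frequencies L. ee (p k (w + x - y))) = (if w + x - y = 0 then of_nat L ^ CARD('d) else 0)"
      unfolding p_def by (intro orthogonality_frequencies)
    moreover have "w + x - y = 0 \<longleftrightarrow> y = x + w" by (auto simp: algebra_simps)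
    ultimately show "(\<Sum>k\<in>frequencies L. ee (p k (w + x - y))) = (if y = x + w then of_nat L ^ CARD('d) else 0)" by simp
  qed
  also have "\<dots> = (\<Sum>x\<in>B. if x + w \<in> B then of_nat L ^ CARD('d) else 0)"
    using finB by (simp add: sum.delta)
  also have "\<dots> = of_nat (card {x\<in>B. x + w \<in> B}) * of_nat L ^ CARD('d)"
    using finB by (simp add: sum.inter_filter[symmetric])
  finally show ?thesis by (simp add: p_def)
qed

lemma card_lattice_box: "card (lattice_box N :: (int ^ 'd::finite) set) = (2 * N + 1) ^ CARD('d)"
proof -
  have "bij_betw vec_nth (lattice_box N :: (int ^ 'd) set) (PiE UNIV (\<lambda>_. {- int N..int N}))"
    by (rule bij_betw_byWitness[where f' = vec_lambda]) (auto simp: lattice_box_def PiE_def)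
  then have "card (lattice_box N :: (int ^ 'd) set) = card (PiE (UNIV :: 'd set) (\<lambda>_. {- int N..int N}))"
    by (rule bij_betw_same_card)
  also have "\<dots> = (2 * N + 1) ^ CARD('d)" by (subst card_PiE) (auto simp: nat_add_distrib nat_mult_distrib)
  finally show ?thesis .
qed

text \<open>The value of the Fourier multiplier of the spherical average; the imaginary part of the sphere sum vanishes by
symmetry, and taking the real part makes this visible in the type.\<close>

definition sphere_mult :: "nat \<Rightarrow> ('d::finite \<Rightarrow> real) \<Rightarrow> real" where
  "sphere_mult l \<theta> = Re (sphere_sum l \<theta>) / real (card (lattice_sphere (int l) :: (int ^ 'd) set))"

lemma abs_sphere_mult_le: "\<bar>sphere_mult l \<theta>\<bar> \<le> 1"
proof -
  have "norm (sphere_sum l \<theta>) \<le> (\<Sum>v\<in>(lattice_sphere (int l) :: (int ^ 'a) set). 1)"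
    unfolding sphere_sum_def by (rule sum_norm_le) simp
  then have "\<bar>Re (sphere_sum l \<theta>)\<bar> \<le> real (card (lattice_sphere (int l) :: (int ^ 'a) set))"
    using abs_Re_le_cmod[of "sphere_sum l \<theta>"] by simp
  then show ?thesis by (cases "card (lattice_sphere (int l) :: (int ^ 'a) set) = 0") (simp_all add: sphere_mult_def)
qed

lemma sphere_correlation_eq:
  fixes B :: "(int ^ 'd::finite) set"
  assumes B: "B \<subseteq> lattice_box N" and L: "3 * N < L" and q: "real q * sqrt (real l) \<le> real N"
  shows "(\<Sum>x\<in>B. sphere_avg q (int l) (indicator B) x) * real L ^ CARD('d)
    = (\<Sum>k\<in>frequencies L. (norm (dft L B k))\<^sup>2 * sphere_mult l (\<lambda>i. real q * (real (k i) / real L)))"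
proof -
  have finB: "finite B" using B finite_lattice_box by (rule finite_subset)
  define S where "S = (lattice_sphere (int l) :: (int ^ 'd) set)"
  have w: "\<bar>(int q *s v) $ i\<bar> \<le> int N" if v: "v \<in> S" for v i
  proof -
    have "(v $ i)\<^sup>2 \<le> int l" using component_square_le_sqnorm[of v i] v by (simp add: S_def lattice_sphere_def)
    then have "real_of_int ((v $ i)\<^sup>2) \<le> real_of_int (int l)" by (simp only: of_int_le_iff)
    then have "\<bar>real_of_int (v $ i)\<bar> \<le> sqrt (real l)" by (intro real_le_rsqrt) simp
    then have "real q * \<bar>real_of_int (v $ i)\<bar> \<le> real q * sqrt (real l)" by (intro mult_left_mono) auto
    then have "real q * \<bar>real_of_int (v $ i)\<bar> \<le> real N" using q by linarith
    then have "real_of_int \<bar>int q * v $ i\<bar> \<le> real_of_int (int N)" by (simp add: abs_mult)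
    then show ?thesis by (simp only: of_int_le_iff vector_smult_component)
  qed
  have "(\<Sum>x\<in>B. \<Sum>v\<in>S. indicator B (x + int q *s v)) = (\<Sum>v\<in>S. \<Sum>x\<in>B. indicator B (x + int q *s v))"
    by (rule sum.swap)
  also have "\<dots> = (\<Sum>v\<in>S. real (card {x\<in>B. x + int q *s v \<in> B}))"
    using finB by (intro sum.cong refl) (simp add: indicator_def sum.inter_filter[symmetric] Int_def)
  finally have 1: "(\<Sum>x\<in>B. \<Sum>v\<in>S. indicator B (x + int q *s v)) = (\<Sum>v\<in>S. real (card {x\<in>B. x + int q *s v \<in> B}))" .
  have ph: "(\<Sum>i\<in>UNIV. real (k i) * of_int ((int q *s v) $ i) / real L) = (\<Sum>i\<in>UNIV. real q * (real (k i) / real L) * of_int (v $ i))" for k v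
    by (intro sum.cong refl) (simp add: mult_ac)
  have "of_real ((\<Sum>v\<in>S. real (card {x\<in>B. x + int q *s v \<in> B})) * real L ^ CARD('d))
      = (\<Sum>v\<in>S. of_nat (card {x\<in>B. x + int q *s v \<in> B}) * (of_nat L :: complex) ^ CARD('d))"
    by (simp add: sum_distrib_right)
  also have "\<dots> = (\<Sum>v\<in>S. \<Sum>k\<in>frequencies L. of_real ((norm (dft L B k))\<^sup>2) * ee (\<Sum>i\<in>UNIV. real q * (real (k i) / real L) * of_int (v $ i)))"
    unfolding ph[symmetric] by (intro sum.cong refl correlation_eq_dft[OF B L w])
  also have "\<dots> = (\<Sum>k\<in>frequencies L. of_real ((norm (dft L B k))\<^sup>2) * sphere_sum l (\<lambda>i. real q * (real (k i) / real L)))"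
    by (subst sum.swap) (simp add: sphere_sum_def S_def sum_distrib_left)
  finally have "Re (of_real ((\<Sum>v\<in>S. real (card {x\<in>B. x + int q *s v \<in> B})) * real L ^ CARD('d)))
     = Re (\<Sum>k\<in>frequencies L. of_real ((norm (dft L B k))\<^sup>2) * sphere_sum l (\<lambda>i. real q * (real (k i) / real L)))"
    by (rule arg_cong)
  then have 2: "(\<Sum>v\<in>S. real (card {x\<in>B. x + int q *s v \<in> B})) * real L ^ CARD('d)
     = (\<Sum>k\<in>frequencies L. (norm (dft L B k))\<^sup>2 * Re (sphere_sum l (\<lambda>i. real q * (real (k i) / real L))))"
    unfolding Re_complex_of_real Re_sum by (simp only: Re_complex_of_real Im_complex_of_real times_complex.sel mult_zero_left diff_zero)
  have "(\<Sum>x\<in>B. sphere_avg q (int l) (indicator B) x) * real L ^ CARD('d)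
     = 1 / real (card S) * ((\<Sum>x\<in>B. \<Sum>v\<in>S. indicator B (x + int q *s v)) * real L ^ CARD('d))"
    unfolding sphere_avg_def S_def sum_distrib_left[symmetric] by (simp only: mult.assoc)
  also have "\<dots> = 1 / real (card S) * (\<Sum>k\<in>frequencies L. (norm (dft L B k))\<^sup>2 * Re (sphere_sum l (\<lambda>i. real q * (real (k i) / real L))))"
    unfolding 1 2 ..
  also have "\<dots> = (\<Sum>k\<in>frequencies L. (norm (dft L B k))\<^sup>2 * sphere_mult l (\<lambda>i. real q * (real (k i) / real L)))"
    unfolding sphere_mult_def S_def by (simp add: sum_distrib_left)
  finally show ?thesis .
qed

section \<open>The sum of the multipliers and the theorem\<close>

text \<open>Let \<open>j\<close> be the first index with \<open>m\<^sub>j < - e\<close>. Then \<open>r\<^bsup>j+1\<^esup> \<xi>\<close> is within \<open>C\<close> divided by the \<open>j\<close>-th radius of an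
integer point. Passing from \<open>j\<close> to a later \<open>k\<close> multiplies this distance by \<open>r\<^bsup>k-j-1\<^esup>\<close> and divides the radius
by \<open>s\<^bsup>k-j\<^esup>\<close>, so the phases of \<open>m\<^sub>k\<close> are of size at most \<open>d C/s \<le> 1/4\<close> and \<open>m\<^sub>k \<ge> 0\<close>. Earlier
multipliers are at least \<open>- e\<close> by the choice of \<open>j\<close>, and \<open>m\<^sub>j\<close> itself is at least \<open>- 1\<close>.\<close>

lemma sum_sphere_mult_ge:
  fixes \<xi> :: "'d::finite \<Rightarrow> real" and e C :: real and r s l l0 :: nat
  assumes key: "\<And>l (\<xi> :: 'd \<Rightarrow> real) i. l0 \<le> l \<Longrightarrow>
      e * real (card (lattice_sphere (int l) :: (int ^ 'd) set)) \<le> norm (sphere_sum l \<xi>) \<Longrightarrow>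
      int_dist (real r * \<xi> i) \<le> C / sqrt (real l)"
    and e: "e \<ge> 0" and C: "C > 0" and s: "r < s" "4 * real CARD('d) * C \<le> real s" and l: "l0 \<le> l" "1 \<le> l"
  shows "- 1 - e * (real J + 1) \<le> (\<Sum>j = 0..J. sphere_mult (s ^ (2 * (J - j)) * l) (\<lambda>i. real (r ^ j) * \<xi> i))"
proof -
  define m where "m j = sphere_mult (s ^ (2 * (J - j)) * l) (\<lambda>i. real (r ^ j) * \<xi> i)" for j
  have s0: "s > 0" using s(1) by simp
  have m1: "- 1 \<le> m j" for j unfolding m_def 
    using abs_sphere_mult_le[of "s ^ (2 * (J - j)) * l" "\<lambda>i. real (r ^ j) * \<xi> i"] unfolding abs_le_iff by linarith
  have sq: "sqrt (real (s ^ (2 * k) * l)) = real s ^ k * sqrt (real l)" for k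
    by (simp add: power_even_eq real_sqrt_mult)
  have later: "0 \<le> m k" if j: "m j < - e" "j < k" "k \<le> J" for j k
  proof -
    define lj where "lj = s ^ (2 * (J - j)) * l"
    define lk where "lk = s ^ (2 * (J - k)) * l"
    define c where "c = real (card (lattice_sphere (int lj) :: (int ^ 'd) set))"
    have "1 * l \<le> lj" unfolding lj_def using s0 by (intro mult_right_mono) (auto simp: Suc_le_eq)
    then have ll: "l0 \<le> lj" using l by simp
    have c0: "c > 0"
    proof (rule ccontr)
      assume "\<not> c > 0"
      then have "c = 0" by (simp add: c_def)
      then have "m j = 0" by (simp add: m_def sphere_mult_def c_def lj_def)
      then show False using j(1) e by simp
    qed
    have "Re (sphere_sum lj (\<lambda>i. real (r ^ j) * \<xi> i)) / c < - e" using j(1) by (simp add: m_def sphere_mult_def c_def lj_def)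
    then have "Re (sphere_sum lj (\<lambda>i. real (r ^ j) * \<xi> i)) < - e * c" using c0 by (simp only: pos_divide_less_eq)
    then have "e * c \<le> \<bar>Re (sphere_sum lj (\<lambda>i. real (r ^ j) * \<xi> i))\<bar>" by simp
    also have "\<dots> \<le> norm (sphere_sum lj (\<lambda>i. real (r ^ j) * \<xi> i))" by (rule abs_Re_le_cmod)
    finally have id: "int_dist (real r * (real (r ^ j) * \<xi> i)) \<le> C / sqrt (real lj)" for i
      using key[OF ll] unfolding c_def by blast
    define t where "t = k - j - 1"
    have k: "k = t + (j + 1)" using j(2) by (simp add: t_def)
    define h where "h = real r ^ t * (C / sqrt (real lj))"
    have "\<bar>real (r ^ k) * \<xi> i - of_int (int (r ^ t) * round (real r * (real (r ^ j) * \<xi> i)))\<bar> \<le> h" for i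
    proof -
      have "real (r ^ k) * \<xi> i - of_int (int (r ^ t) * round (real r * (real (r ^ j) * \<xi> i)))
        = real r ^ t * (real r * (real (r ^ j) * \<xi> i) - of_int (round (real r * (real (r ^ j) * \<xi> i))))"
        by (simp add: k power_add right_diff_distrib mult_ac)
      then have "\<bar>real (r ^ k) * \<xi> i - of_int (int (r ^ t) * round (real r * (real (r ^ j) * \<xi> i)))\<bar>
        = real r ^ t * int_dist (real r * (real (r ^ j) * \<xi> i))"
        by (simp only: abs_mult int_dist_def) simp
      also have "\<dots> \<le> h" unfolding h_def by (intro mult_left_mono id) auto
      finally show ?thesis .
    qed
    moreover have "real CARD('d) * h * sqrt (real lk) \<le> 1 / 4"
    proof -
      define sl where "sl = sqrt (real l)"
      have sl: "sl > 0" using l by (simp add: sl_def)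
      have "J - j = (J - k) + (t + 1)" using k j by simp
      then have lj': "sqrt (real lj) = real s ^ (J - k) * real s ^ t * real s * sl"
        unfolding lj_def sq sl_def by (simp add: power_add)
      have lk': "sqrt (real lk) = real s ^ (J - k) * sl" unfolding lk_def sq sl_def ..
      have "real CARD('d) * h * sqrt (real lk) = (real CARD('d) * C / real s) * (real r ^ t / real s ^ t)"
        unfolding h_def lj' lk' using sl s0 by (simp add: field_simps)
      also have "\<dots> \<le> (1 / 4) * 1"
      proof (intro mult_mono)
        show "real CARD('d) * C / real s \<le> 1 / 4" using s(2) s0 by (simp add: field_simps)
        have "real r ^ t \<le> real s ^ t" using s(1) by (intro power_mono) auto
        then show "real r ^ t / real s ^ t \<le> 1" using s0 by simp
      qed auto
      finally show ?thesis by simp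
    qed
    ultimately have "0 \<le> Re (sphere_sum lk (\<lambda>i. real (r ^ k) * \<xi> i))" by (rule Re_sphere_sum_nonneg)
    then show ?thesis by (simp add: m_def sphere_mult_def lk_def)
  qed
  have "\<exists>j0. \<forall>j\<in>{0..J}. - e - (if j = j0 then 1 else 0) \<le> m j"
  proof (cases "\<exists>j\<le>J. m j < - e")
    case True
    define j0 where "j0 = (LEAST j. j \<le> J \<and> m j < - e)"
    have j0: "j0 \<le> J \<and> m j0 < - e" unfolding j0_def using True by (rule LeastI_ex)
    have "- e - (if j = j0 then 1 else 0) \<le> m j" if "j \<in> {0..J}" for j
    proof (cases j j0 rule: linorder_cases)
      case less
      then have "\<not> (j \<le> J \<and> m j < - e)" unfolding j0_def by (rule not_less_Least)
      then show ?thesis using that less by auto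
    next
      case equal
      then show ?thesis using m1[of j] e by simp
    next
      case greater
      then have "0 \<le> m j" using later[of j0 j] j0 that by simp
      then show ?thesis using e by auto
    qed
    then show ?thesis by blast
  next
    case False
    then show ?thesis by (intro exI[of _ "Suc J"]) (auto simp: not_less)
  qed
  then obtain j0 where j0: "\<forall>j\<in>{0..J}. - e - (if j = j0 then 1 else 0) \<le> m j" by blast
  have "(\<Sum>j = 0..J. if j = j0 then 1 else 0 :: real) \<le> 1" by simp
  then have "- 1 - e * (real J + 1) \<le> (\<Sum>j = 0..J. - e - (if j = j0 then 1 else 0))"
    by (simp add: sum_subtractf algebra_simps)
  also have "\<dots> \<le> (\<Sum>j = 0..J. m j)" using j0 by (intro sum_mono) blast
  finally show ?thesis by (simp add: m_def)
qed

lemma infsum_indicator: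
  fixes g :: "'a \<Rightarrow> real"
  assumes "finite B"
  shows "(\<Sum>\<^sub>\<infinity>x\<in>UNIV. indicator B x * g x) = (\<Sum>x\<in>B. g x)"
proof -
  have "(\<Sum>\<^sub>\<infinity>x\<in>UNIV. indicator B x * g x) = (\<Sum>\<^sub>\<infinity>x\<in>B. g x)"
    by (rule infsum_cong_neutral) auto
  then show ?thesis using assms by simp
qed

lemma sphere_mult_0:
  assumes "card (lattice_sphere (int l) :: (int ^ 'd::finite) set) > 0"
  shows "sphere_mult l (\<lambda>_ :: 'd. 0) = 1"
  using assms by (simp add: sphere_mult_def sphere_sum_0)

lemma sqdist_set_meets:
  fixes B :: "(int ^ 'd::finite) set"
  assumes "0 < (\<Sum>x\<in>B. \<Sum>j = 0..J. sphere_avg (r ^ j) (int s ^ (2 * (J - j)) * l) (indicator B) x)"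
  shows "sqdist_set B \<inter> {int r ^ (2 * j) * int s ^ (2 * (J - j)) * l | j. j \<le> J} \<noteq> {}"
proof -
  have "\<exists>x\<in>B. (\<Sum>j = 0..J. sphere_avg (r ^ j) (int s ^ (2 * (J - j)) * l) (indicator B) x) \<noteq> 0"
  proof (rule ccontr)
    assume "\<not> ?thesis"
    then have "(\<Sum>x\<in>B. \<Sum>j = 0..J. sphere_avg (r ^ j) (int s ^ (2 * (J - j)) * l) (indicator B) x) = 0"
      by (intro sum.neutral) blast
    then show False using assms by simp
  qed
  then obtain x where x: "x \<in> B" "(\<Sum>j = 0..J. sphere_avg (r ^ j) (int s ^ (2 * (J - j)) * l) (indicator B) x) \<noteq> 0" by blast
  then obtain j where j: "j \<le> J" "sphere_avg (r ^ j) (int s ^ (2 * (J - j)) * l) (indicator B) x \<noteq> 0"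
    by (meson sum.neutral atLeastAtMost_iff)
  then have "(\<Sum>v\<in>lattice_sphere (int s ^ (2 * (J - j)) * l). indicator B (x + int (r ^ j) *s v) :: real) \<noteq> 0"
    unfolding sphere_avg_def by (metis mult_zero_right)
  then obtain v where v: "v \<in> lattice_sphere (int s ^ (2 * (J - j)) * l)" "indicator B (x + int (r ^ j) *s v) \<noteq> (0::real)"
    by (meson sum.neutral)
  define y where "y = x + int (r ^ j) *s v"
  have y: "y \<in> B" using v(2) by (simp add: y_def indicator_def split: if_splits)
  have "sqnorm (y - x) = (int (r ^ j))\<^sup>2 * sqnorm v"
    by (simp add: y_def sqnorm_def power_mult_distrib sum_distrib_left)
  also have "\<dots> = int r ^ (2 * j) * int s ^ (2 * (J - j)) * l"
    using v(1) by (simp add: lattice_sphere_def power_mult power2_eq_square mult.assoc flip: power_mult_distrib)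
  finally have "int r ^ (2 * j) * int s ^ (2 * (J - j)) * l \<in> sqdist_set B"
    unfolding sqdist_set_def using x(1) y by (metis (mono_tags, lifting) mem_Collect_eq)
  then show ?thesis using j(1) by blast
qed

theorem proposition3p14:
  fixes \<delta> :: real
  assumes "CARD('d::finite) \<ge> 5" and "0 < \<delta>" and "\<delta> < 1"
  shows "\<exists>(r::nat) (s::nat) (J::nat) (\<zeta>::real) (c::real) (\<Lambda>\<^sub>0::nat).
    2 \<le> r \<and> r < s \<and> 0 < \<zeta> \<and> 0 < c \<and>
    (\<forall>\<^sub>F N in sequentially.
      \<forall>B :: (int ^ 'd) set.
        B \<subseteq> lattice_box N \<longrightarrow>
        \<delta> * real (card (lattice_box N :: (int ^ 'd) set)) \<le> real (card B) \<longrightarrow>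
        (\<forall>l::int. int \<Lambda>\<^sub>0 \<le> l \<longrightarrow> real_of_int l \<le> c * (real N)\<^sup>2 \<longrightarrow>
          1 / real (card (lattice_box N :: (int ^ 'd) set)) *
            (\<Sum>\<^sub>\<infinity>x\<in>UNIV. indicator B x *
              (\<Sum>j = 0..J. sphere_avg (r ^ j) (int s ^ (2 * (J - j)) * l) (indicator B) x))
            \<ge> \<zeta> \<and>
          sqdist_set B \<inter> {int r ^ (2 * j) * int s ^ (2 * (J - j)) * l | j. j \<le> J} \<noteq> {}))"
proof -
  define d where "d = CARD('d)"
  define \<gamma> where "\<gamma> = \<delta>\<^sup>2 / 2 ^ d"
  have \<gamma>: "\<gamma> > 0" using assms(2) by (simp add: \<gamma>_def)
  define e where "e = \<gamma> / 2"
  have e: "e > 0" using \<gamma> by (simp add: e_def)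
  obtain r C l0 where r: "r \<ge> 2" and C: "C > 0" and
    key: "\<forall>(l::nat) (\<xi> :: 'd \<Rightarrow> real). l0 \<le> l \<longrightarrow>
     e * real (card (lattice_sphere (int l) :: (int ^ 'd) set)) \<le> norm (sphere_sum l \<xi>) \<longrightarrow>
     (\<forall>i. int_dist (real r * \<xi> i) \<le> C / sqrt (real l))"
    using sphere_sum_large_imp_rational[OF assms(1) e] by (elim exE conjE)
  obtain c1 l1 where c1: "c1 > 0" and
    lower: "\<forall>l::nat. l1 \<le> l \<longrightarrow> c1 * sqrt (real l) ^ (CARD('d) - 2) \<le> real (card (lattice_sphere (int l) :: (int ^ 'd) set))"
    using sphere_count_lower[OF assms(1)] by (elim exE conjE)
  define s where "s = r + 1 + nat \<lceil>4 * real CARD('d) * C\<rceil>"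
  have s: "r < s" "4 * real CARD('d) * C \<le> real s"
  proof -
    show "r < s" by (simp add: s_def)
    have "4 * real CARD('d) * C \<le> real (nat \<lceil>4 * real CARD('d) * C\<rceil>)" by linarith
    then show "4 * real CARD('d) * C \<le> real s" unfolding s_def by simp
  qed
  \<comment> \<open>The zero frequency gains \<open>2 e (J + 1)\<close>, all others lose at most \<open>1 + e (J + 1)\<close>; \<open>e (J + 1) \<ge> 2\<close> leaves a surplus of 1.\<close>
  define J where "J = nat \<lceil>4 / \<gamma>\<rceil>"
  have J: "2 \<le> (real J + 1) * e"
  proof -
    have "4 / \<gamma> \<le> real J" unfolding J_def by linarith
    then have "4 \<le> real J * \<gamma>" using \<gamma> by (simp add: field_simps)
    then have "4 \<le> real J * \<gamma> + \<gamma>" by (rule add_increasing2[OF less_imp_le[OF \<gamma>]])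
    then show ?thesis by (simp add: e_def algebra_simps)
  qed
  \<comment> \<open>With this choice no translation \<open>r\<^sup>j v\<close> has a coordinate beyond \<open>N\<close>.\<close>
  define c where "c = 1 / real s ^ (2 * J)"
  have c: "c > 0" using s by (simp add: c_def)
  define l2 where "l2 = max l0 (max l1 1)"
  have main: "1 \<le> 1 / real (card (lattice_box N :: (int ^ 'd) set)) *
        (\<Sum>x\<in>B. \<Sum>j = 0..J. sphere_avg (r ^ j) (int s ^ (2 * (J - j)) * int l) (indicator B) x)"
    if B: "B \<subseteq> lattice_box N" "\<delta> * real (card (lattice_box N :: (int ^ 'd) set)) \<le> real (card B)"
      and l: "l2 \<le> l" "real l \<le> c * (real N)\<^sup>2" for N l and B :: "(int ^ 'd) set"
  proof -
    define V where "V = real (card (lattice_box N :: (int ^ 'd) set))"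
    define L where "L = 2 * (2 * N + 1)"
    have LV: "real L ^ d = 2 ^ d * V"
      unfolding V_def card_lattice_box d_def L_def of_nat_power of_nat_mult power_mult_distrib by simp
    have V0: "V > 0" by (simp add: V_def card_lattice_box)
    have L0: "3 * N < L" "L > 0" by (simp_all add: L_def)
    have finB: "finite B" using B(1) finite_lattice_box by (rule finite_subset)
    have BV: "real (card B) \<le> V" unfolding V_def by (intro of_nat_mono card_mono finite_lattice_box B)
    define F where "F k = (norm (dft L B k))\<^sup>2" for k
    define m where "m j k = sphere_mult (s ^ (2 * (J - j)) * l) (\<lambda>i. real (r ^ j) * (real (k i) / real L))" for j and k :: "'d \<Rightarrow> nat"
    have ll: "l0 \<le> l" "l1 \<le> l" "1 \<le> l" using l(1) by (simp_all add: l2_def)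
    have s0: "s > 0" using s by simp
    have corr: "(\<Sum>x\<in>B. sphere_avg (r ^ j) (int s ^ (2 * (J - j)) * int l) (indicator B) x) * real L ^ d = (\<Sum>k\<in>frequencies L. F k * m j k)"
      if j: "j \<in> {0..J}" for j
    proof -
      define q where "q = s ^ (2 * (J - j)) * l"
      have "real (r ^ j) * sqrt (real q) \<le> real N"
      proof (rule power2_le_imp_le)
        have "r ^ j \<le> s ^ j" using s by (intro power_mono) auto
        then have "(real (r ^ j))\<^sup>2 \<le> (real (s ^ j))\<^sup>2" by (intro power_mono) (simp_all only: of_nat_le_iff of_nat_0_le_iff)
        then have "(real (r ^ j) * sqrt (real q))\<^sup>2 \<le> (real (s ^ j))\<^sup>2 * real q"
          by (simp add: power_mult_distrib mult_right_mono)
        also have "\<dots> = real s ^ (2 * J) * real l"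
        proof -
          have "2 * J = 2 * j + 2 * (J - j)" using j by simp
          then have "real s ^ (2 * J) = real s ^ (2 * j) * real s ^ (2 * (J - j))" by (simp only: power_add)
          then show ?thesis by (simp add: q_def power_mult power_commutes mult.assoc flip: power_mult) (simp add: mult.commute)
        qed
        also have "\<dots> \<le> real s ^ (2 * J) * (c * (real N)\<^sup>2)" using l(2) by (intro mult_left_mono) auto
        also have "\<dots> = (real N)\<^sup>2" using s0 by (simp add: c_def)
        finally show "(real (r ^ j) * sqrt (real q))\<^sup>2 \<le> (real N)\<^sup>2" .
      qed simp
      from sphere_correlation_eq[OF B(1) L0(1) this]
      show ?thesis by (simp add: F_def m_def q_def d_def)
    qed
    have total: "(\<Sum>x\<in>B. \<Sum>j = 0..J. sphere_avg (r ^ j) (int s ^ (2 * (J - j)) * int l) (indicator B) x) * real L ^ d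
        = (\<Sum>k\<in>frequencies L. F k * (\<Sum>j = 0..J. m j k))" (is "?S * _ = _")
    proof -
      have "?S * real L ^ d = (\<Sum>j = 0..J. (\<Sum>x\<in>B. sphere_avg (r ^ j) (int s ^ (2 * (J - j)) * int l) (indicator B) x) * real L ^ d)"
        by (subst sum.swap) (simp add: sum_distrib_right)
      also have "\<dots> = (\<Sum>j = 0..J. \<Sum>k\<in>frequencies L. F k * m j k)" by (intro sum.cong refl corr)
      also have "\<dots> = (\<Sum>k\<in>frequencies L. F k * (\<Sum>j = 0..J. m j k))" by (subst sum.swap) (simp add: sum_distrib_left)
      finally show ?thesis .
    qed
    have lowerm: "- 1 - e * (real J + 1) \<le> (\<Sum>j = 0..J. m j k)" for k
      unfolding m_def
    proof (rule sum_sphere_mult_ge[where C = C and ?l0.0 = l0])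
      show "int_dist (real r * \<xi> i) \<le> C / sqrt (real l)" if "l0 \<le> l"
        "e * real (card (lattice_sphere (int l) :: (int ^ 'd) set)) \<le> norm (sphere_sum l \<xi>)" for l and \<xi> :: "'d \<Rightarrow> real" and i
        using key that by blast
    qed (use e C s ll in auto)
    define k0 where "k0 = (\<lambda>_ :: 'd. 0 :: nat)"
    have k0: "k0 \<in> frequencies L" using L0(2) by (auto simp: k0_def frequencies_def PiE_def)
    have m0: "(\<Sum>j = 0..J. m j k0) = real J + 1"
    proof -
      have "m j k0 = 1" for j
      proof -
        have "1 * l \<le> s ^ (2 * (J - j)) * l" using s0 by (intro mult_right_mono) (auto simp: Suc_le_eq)
        then have "l1 \<le> s ^ (2 * (J - j)) * l" "s ^ (2 * (J - j)) * l > 0" using ll by linarith+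
        then have "0 < c1 * sqrt (real (s ^ (2 * (J - j)) * l)) ^ (CARD('d) - 2)"
          "c1 * sqrt (real (s ^ (2 * (J - j)) * l)) ^ (CARD('d) - 2) \<le> real (card (lattice_sphere (int (s ^ (2 * (J - j)) * l)) :: (int ^ 'd) set))"
          using c1 lower by (simp, blast)
        then have "real (card (lattice_sphere (int (s ^ (2 * (J - j)) * l)) :: (int ^ 'd) set)) > 0" by linarith
        then have "card (lattice_sphere (int (s ^ (2 * (J - j)) * l)) :: (int ^ 'd) set) > 0" by simp
        from sphere_mult_0[OF this] show ?thesis by (simp add: m_def k0_def)
      qed
      then show ?thesis by simp
    qed
    have F0: "F k0 = (real (card B))\<^sup>2" by (simp add: F_def dft_def k0_def)
    have parseval: "(\<Sum>k\<in>frequencies L. F k) = real (card B) * real L ^ d"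
    proof -
      have "of_nat (card {x\<in>B. x + 0 \<in> B}) * of_nat L ^ CARD('d)
        = (\<Sum>k\<in>frequencies L. of_real ((norm (dft L B k))\<^sup>2) * ee (\<Sum>i\<in>UNIV. real (k i) * of_int ((0 :: int ^ 'd) $ i) / real L))"
        by (rule correlation_eq_dft[OF B(1) L0(1)]) simp
      then have "complex_of_real (real (card B) * real L ^ d) = complex_of_real (\<Sum>k\<in>frequencies L. F k)"
        by (simp add: F_def d_def)
      then show ?thesis by (simp only: of_real_eq_iff)
    qed
    have finf: "finite (frequencies L :: ('d \<Rightarrow> nat) set)" unfolding frequencies_def by (intro finite_PiE) auto
    define A where "A = 1 + e * (real J + 1)"
    have A0: "A \<ge> 0" using e by (simp add: A_def)
    have "(real J + 1) * (real (card B))\<^sup>2 - A * (real (card B) * real L ^ d) \<le> F k0 * (real J + 1 + A) - A * (\<Sum>k\<in>frequencies L. F k)"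
      unfolding parseval F0 using A0 by (simp add: algebra_simps)
    also have "\<dots> = (\<Sum>k\<in>frequencies L. (if k = k0 then F k0 * (real J + 1 + A) else 0) - A * F k)"
      using k0 finf by (simp add: sum_subtractf sum_distrib_left)
    also have "\<dots> \<le> (\<Sum>k\<in>frequencies L. F k * (\<Sum>j = 0..J. m j k))"
    proof (rule sum_mono)
      fix k
      show "(if k = k0 then F k0 * (real J + 1 + A) else 0) - A * F k \<le> F k * (\<Sum>j = 0..J. m j k)"
      proof (cases "k = k0")
        case True
        then show ?thesis unfolding True m0 by (simp add: algebra_simps)
      next
        case False
        have "F k * (- A) \<le> F k * (\<Sum>j = 0..J. m j k)"
          using lowerm[of k] by (intro mult_left_mono) (auto simp: A_def F_def)
        then show ?thesis using False by (simp add: mult.commute)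
      qed
    qed
    finally have "(real J + 1) * (real (card B))\<^sup>2 - A * (real (card B) * real L ^ d) \<le> ?S * real L ^ d"
      unfolding total .
    moreover have "(real J + 1) * (\<gamma> * V * real L ^ d) \<le> (real J + 1) * (real (card B))\<^sup>2"
    proof (rule mult_left_mono)
      have "(\<delta> * V)\<^sup>2 \<le> (real (card B))\<^sup>2" using B(2) assms(2) V0 by (intro power_mono) (auto simp: V_def)
      moreover have "\<gamma> * V * real L ^ d = (\<delta> * V)\<^sup>2" by (simp add: LV \<gamma>_def power2_eq_square)
      ultimately show "\<gamma> * V * real L ^ d \<le> (real (card B))\<^sup>2" by simp
    qed simp
    moreover have "A * (real (card B) * real L ^ d) \<le> A * (V * real L ^ d)"
      using BV A0 by (intro mult_left_mono mult_right_mono) auto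
    moreover have "(real J + 1) * (\<gamma> * V * real L ^ d) - A * (V * real L ^ d) = ((real J + 1) * e - 1) * (V * real L ^ d)"
      by (simp add: A_def e_def algebra_simps)
    moreover have "1 * (V * real L ^ d) \<le> ((real J + 1) * e - 1) * (V * real L ^ d)"
      using J V0 by (intro mult_right_mono) auto
    ultimately have "V * real L ^ d \<le> ?S * real L ^ d" by linarith
    then have "V \<le> ?S" using L0(2) by simp
    then show ?thesis using V0 by (simp add: V_def field_simps)
  qed
  have full: "\<forall>B :: (int ^ 'd) set.
        B \<subseteq> lattice_box N \<longrightarrow>
        \<delta> * real (card (lattice_box N :: (int ^ 'd) set)) \<le> real (card B) \<longrightarrow>
        (\<forall>l::int. int l2 \<le> l \<longrightarrow> real_of_int l \<le> c * (real N)\<^sup>2 \<longrightarrow>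
          1 / real (card (lattice_box N :: (int ^ 'd) set)) *
            (\<Sum>\<^sub>\<infinity>x\<in>UNIV. indicator B x *
              (\<Sum>j = 0..J. sphere_avg (r ^ j) (int s ^ (2 * (J - j)) * l) (indicator B) x))
            \<ge> 1 \<and>
          sqdist_set B \<inter> {int r ^ (2 * j) * int s ^ (2 * (J - j)) * l | j. j \<le> J} \<noteq> {})" for N
  proof (intro allI impI)
    fix B :: "(int ^ 'd) set" and l :: int
    assume B: "B \<subseteq> lattice_box N" "\<delta> * real (card (lattice_box N :: (int ^ 'd) set)) \<le> real (card B)"
      and l: "int l2 \<le> l" "real_of_int l \<le> c * (real N)\<^sup>2"
    have finB: "finite B" using B(1) finite_lattice_box by (rule finite_subset)
    obtain n where n: "l = int n" using l(1) by (metis nonneg_int_cases of_nat_0_le_iff order_trans)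
    define S where "S = (\<Sum>x\<in>B. \<Sum>j = 0..J. sphere_avg (r ^ j) (int s ^ (2 * (J - j)) * l) (indicator B) x)"
    have S1: "1 \<le> 1 / real (card (lattice_box N :: (int ^ 'd) set)) * S"
      unfolding S_def n using l by (intro main B) (simp_all add: n)
    have "0 < S"
    proof (rule ccontr)
      assume "\<not> 0 < S"
      then have "1 / real (card (lattice_box N :: (int ^ 'd) set)) * S \<le> 0" by (intro mult_nonneg_nonpos) auto
      then show False using S1 by simp
    qed
    then show "1 / real (card (lattice_box N :: (int ^ 'd) set)) *
            (\<Sum>\<^sub>\<infinity>x\<in>UNIV. indicator B x *
              (\<Sum>j = 0..J. sphere_avg (r ^ j) (int s ^ (2 * (J - j)) * l) (indicator B) x))
            \<ge> 1 \<and>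
          sqdist_set B \<inter> {int r ^ (2 * j) * int s ^ (2 * (J - j)) * l | j. j \<le> J} \<noteq> {}"
      using S1 unfolding infsum_indicator[OF finB] S_def by (intro conjI sqdist_set_meets)
  qed
  show ?thesis
    by (rule exI[of _ r], rule exI[of _ s], rule exI[of _ J], rule exI[of _ 1], rule exI[of _ c], rule exI[of _ l2],
        intro conjI r s(1) c zero_less_one always_eventually allI) (rule full[THEN spec])
qed

end
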